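(* Let $G=(V,E)$ be a directed graph on $n$ vertices and $m$ edges with positive real capacities $w$, a designated source vertex $s$ and a designated sink vertex $t$. There is a data structure occupying $\mathcal{O}(n^2)$ space that, given any edge $e\in E$ and any value $\Delta\ge -w(e)$, and letting $G_e$ be the graph obtained from $G$ by changing the capacity of $e$ from $w(e)$ to $w(e)+\Delta$, can report (1) the capacity of the $(s,t)$-mincut of $G_e$ in $\mathcal{O}(1)$ time, (2) an $(s,t)$-mincut $C$ of $G_e$ in $\mathcal{O}(|C|)$ time, and (3) the DAG $\mathcal{D}_{PQ}(G_e)$, which occupies $\mathcal{O}(m)$ space, in $\mathcal{O}(m)$ time.
   Context: An $(s,t)$-cut is a set $C\subset V$ with $s\in C$, $t\notin C$; its capacity is the total capacity of edges from $C$ to $V\setminus C$; an $(s,t)$-mincut is one of minimum capacity. For a directed graph $H$, a cut in a DAG whose nodes partition $V$ is a set of nodes containing the node of $s$ but not that of $t$; it is $1$-transversal if its edge-set (edges with exactly one endpoint in it) meets every simple path of the DAG in at most one edge. $\mathcal{D}_{PQ}(H)$ denotes the Picard–Queyranne DAG of $H$: a directed acyclic graph with $\mathcal{O}(m)$ edges whose nodes partition the vertex set (obtained by contracting strongly connected components of the residual graph of a maximum flow), with the property that an $(s,t)$-cut $C$ of $H$ is an $(s,t)$-mincut of $H$ if and only if $C$ is a union of nodes forming a $1$-transversal cut of $\mathcal{D}_{PQ}(H)$.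
   Formalization: The plain contraction of the residual graph can lack the stated 1-transversal property (e.g. arcs s→t and a→b only), so the reported DAG contains all its edges but may have extra edges out of the node of t or into the node of s; nodes, O(m) size and the mincut property are as stated. *)

theory Defs
  imports Complex_Main "Graph_Theory.Graph_Theory"
begin

section \<open>Capacitated networks and minimum cuts\<close>

record 'a network =
  graph :: "'a pair_pre_digraph"
  cap :: "'a \<times> 'a \<Rightarrow> real"
  src :: 'a
  snk :: 'a

abbreviation V :: "'a network \<Rightarrow> 'a set" where "V N \<equiv> pverts (graph N)"
abbreviation E :: "'a network \<Rightarrow> ('a \<times> 'a) set" where "E N \<equiv> parcs (graph N)"

text \<open>The vertices are named by the numbers below \<open>n\<close>, so that a machine can refer to them.\<close>

definition positive_network :: "nat \<Rightarrow> nat network \<Rightarrow> bool" where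
  "positive_network n N \<longleftrightarrow>
     pair_fin_digraph (graph N) \<and> V N = {..<n} \<and>
     src N \<in> V N \<and> snk N \<in> V N \<and> src N \<noteq> snk N \<and> (\<forall>e\<in>E N. cap N e > 0)"

definition change_cap :: "'a network \<Rightarrow> 'a \<times> 'a \<Rightarrow> real \<Rightarrow> 'a network" where
  "change_cap N e \<Delta> = N\<lparr>cap := (cap N)(e := cap N e + \<Delta>)\<rparr>"

definition st_cut :: "'a network \<Rightarrow> 'a set \<Rightarrow> bool" where
  "st_cut N C \<longleftrightarrow> C \<subseteq> V N \<and> src N \<in> C \<and> snk N \<notin> C"

definition cut_cap :: "'a network \<Rightarrow> 'a set \<Rightarrow> real" where
  "cut_cap N C = (\<Sum>e \<in> {e \<in> E N. fst e \<in> C \<and> snd e \<notin> C}. cap N e)"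

definition st_mincut :: "'a network \<Rightarrow> 'a set \<Rightarrow> bool" where
  "st_mincut N C \<longleftrightarrow> st_cut N C \<and> (\<forall>C'. st_cut N C' \<longrightarrow> cut_cap N C \<le> cut_cap N C')"

definition mincut_cap :: "'a network \<Rightarrow> real" where
  "mincut_cap N = Min (cut_cap N ` {C. st_cut N C})"


section \<open>Maximum flows and the Picard--Queyranne DAG\<close>

definition net_out :: "'a network \<Rightarrow> ('a \<times> 'a \<Rightarrow> real) \<Rightarrow> 'a \<Rightarrow> real" where
  "net_out N f v = (\<Sum>e \<in> {e \<in> E N. fst e = v}. f e) - (\<Sum>e \<in> {e \<in> E N. snd e = v}. f e)"

definition st_flow :: "'a network \<Rightarrow> ('a \<times> 'a \<Rightarrow> real) \<Rightarrow> bool" where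
  "st_flow N f \<longleftrightarrow>
     (\<forall>e\<in>E N. 0 \<le> f e \<and> f e \<le> cap N e) \<and> (\<forall>v \<in> V N - {src N, snk N}. net_out N f v = 0)"

definition max_flow :: "'a network \<Rightarrow> ('a \<times> 'a \<Rightarrow> real) \<Rightarrow> bool" where
  "max_flow N f \<longleftrightarrow>
     st_flow N f \<and> (\<forall>g. st_flow N g \<longrightarrow> net_out N g (src N) \<le> net_out N f (src N))"

definition residual :: "'a network \<Rightarrow> ('a \<times> 'a \<Rightarrow> real) \<Rightarrow> 'a pair_pre_digraph" where
  "residual N f =
     \<lparr>pverts = V N,
      parcs = {(u, v). (u, v) \<in> E N \<and> f (u, v) < cap N (u, v) \<or> (v, u) \<in> E N \<and> 0 < f (v, u)}\<rparr>"

definition contract_sccs :: "'a pair_pre_digraph \<Rightarrow> 'a set pair_pre_digraph" where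
  "contract_sccs R =
     \<lparr>pverts = pre_digraph.sccs_verts (with_proj R),
      parcs = {(X, Y). X \<in> pre_digraph.sccs_verts (with_proj R) \<and>
                       Y \<in> pre_digraph.sccs_verts (with_proj R) \<and> X \<noteq> Y \<and>
                       (\<exists>x\<in>X. \<exists>y\<in>Y. (x, y) \<in> parcs R)}\<rparr>"

definition dag_cut :: "'a network \<Rightarrow> 'a set pair_pre_digraph \<Rightarrow> 'a set set \<Rightarrow> bool" where
  "dag_cut N D U \<longleftrightarrow> U \<subseteq> pverts D \<and> src N \<in> \<Union>U \<and> snk N \<notin> \<Union>U"

definition cut_edges :: "'b pair_pre_digraph \<Rightarrow> 'b set \<Rightarrow> ('b \<times> 'b) set" where
  "cut_edges D U = {a \<in> parcs D. (fst a \<in> U) \<noteq> (snd a \<in> U)}"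

definition one_transversal :: "'b pair_pre_digraph \<Rightarrow> 'b set \<Rightarrow> bool" where
  "one_transversal D U \<longleftrightarrow>
     (\<forall>X p Y. pre_digraph.apath (with_proj D) X p Y \<longrightarrow> card (set p \<inter> cut_edges D U) \<le> 1)"

text \<open>
  The nodes are the strongly connected components of the residual graph of a maximum flow, and
  every contracted residual arc is an edge. If some vertex lies on no path from the source to the
  sink along arcs of positive capacity, then these edges alone may fail to characterise the minimum
  cuts: given an arc \<open>a \<rightarrow> b\<close> that is a connected component of its own, adding \<open>a\<close> to a minimum cut
  that avoids \<open>a\<close> and \<open>b\<close> would give a 1-transversal cut
  that is not a minimum cut. Hence extra edges out of the sink's node or into the source's
  node are admitted. No set of nodes that contains the source's node and avoids the sink's node is
  left by such an edge, so they do not change which of these sets are closed under successors.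
\<close>

definition PQ_dag :: "'a network \<Rightarrow> 'a set pair_pre_digraph \<Rightarrow> bool" where
  "PQ_dag N D \<longleftrightarrow>
     pair_fin_digraph D \<and> acyclic (parcs D) \<and>
     (\<exists>f. max_flow N f \<and>
          pverts D = pverts (contract_sccs (residual N f)) \<and>
          parcs (contract_sccs (residual N f)) \<subseteq> parcs D \<and>
          parcs D \<subseteq> parcs (contract_sccs (residual N f)) \<union> {(X, Y). snk N \<in> X \<or> src N \<in> Y}) \<and>
     (\<forall>C. st_cut N C \<longrightarrow>
          (st_mincut N C \<longleftrightarrow> (\<exists>U. C = \<Union>U \<and> dag_cut N D U \<and> one_transversal D U)))"


section \<open>The machine model\<close>

text \<open>
  A unit-cost random access machine. A cell holds either an integer below \<open>W\<close>, with the usual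
  word arithmetic modulo \<open>W\<close>, or a real number. Reals can only be copied, added, subtracted and
  compared. The data structure is a read-only array, addressed indirectly; besides it there are
  registers and a scratch array. Results are written to an output stream.
\<close>

datatype cell = Idx nat | Val real

datatype instr =
    Const nat nat
  | Copy nat nat
  | Add nat nat nat
  | Sub nat nat nat
  | Mul nat nat nat
  | Div nat nat nat
  | Read nat nat
  | Load nat nat
  | Store nat nat
  | Jump nat
  | JumpLess nat nat nat
  | Emit nat

record state =
  pc :: nat
  reg :: "nat \<Rightarrow> cell"
  scratch :: "cell list"
  emitted :: "cell list"

definition set_reg :: "state \<Rightarrow> nat \<Rightarrow> cell \<Rightarrow> state" where
  "set_reg \<sigma> r c = \<sigma>\<lparr>reg := (reg \<sigma>)(r := c), pc := Suc (pc \<sigma>)\<rparr>"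

fun add_cell :: "nat \<Rightarrow> cell \<Rightarrow> cell \<Rightarrow> cell option" where
  "add_cell W (Idx a) (Idx b) = Some (Idx ((a + b) mod W))"
| "add_cell W (Val x) (Val y) = Some (Val (x + y))"
| "add_cell W _ _ = None"

text \<open>On integers, subtraction is truncated at 0.\<close>

fun sub_cell :: "cell \<Rightarrow> cell \<Rightarrow> cell option" where
  "sub_cell (Idx a) (Idx b) = Some (Idx (a - b))"
| "sub_cell (Val x) (Val y) = Some (Val (x - y))"
| "sub_cell _ _ = None"

fun mul_cell :: "nat \<Rightarrow> cell \<Rightarrow> cell \<Rightarrow> cell option" where
  "mul_cell W (Idx a) (Idx b) = Some (Idx ((a * b) mod W))"
| "mul_cell W _ _ = None"

fun div_cell :: "cell \<Rightarrow> cell \<Rightarrow> cell option" where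
  "div_cell (Idx a) (Idx b) = Some (Idx (a div b))"
| "div_cell _ _ = None"

fun less_cell :: "cell \<Rightarrow> cell \<Rightarrow> bool option" where
  "less_cell (Idx a) (Idx b) = Some (a < b)"
| "less_cell (Val x) (Val y) = Some (x < y)"
| "less_cell _ _ = None"

fun fetch :: "cell list \<Rightarrow> cell \<Rightarrow> cell option" where
  "fetch M (Idx a) = (if a < length M then Some (M ! a) else None)"
| "fetch M (Val x) = None"

fun update :: "cell list \<Rightarrow> cell \<Rightarrow> cell \<Rightarrow> cell list option" where
  "update M (Idx a) c = (if a < length M then Some (M[a := c]) else None)"
| "update M (Val x) c = None"

text \<open>
  The destination is the first operand, except that \<open>Store a r\<close> writes register \<open>r\<close> to the
  address held in register \<open>a\<close>. The result \<open>None\<close> signals a run-time error: an out-of-bounds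
  access or an operation on cells of the wrong kind.
\<close>

fun exec :: "nat \<Rightarrow> cell list \<Rightarrow> instr \<Rightarrow> state \<Rightarrow> state option" where
  "exec W D (Const r k) \<sigma> = Some (set_reg \<sigma> r (Idx (k mod W)))"
| "exec W D (Copy r a) \<sigma> = Some (set_reg \<sigma> r (reg \<sigma> a))"
| "exec W D (Add r a b) \<sigma> = map_option (set_reg \<sigma> r) (add_cell W (reg \<sigma> a) (reg \<sigma> b))"
| "exec W D (Sub r a b) \<sigma> = map_option (set_reg \<sigma> r) (sub_cell (reg \<sigma> a) (reg \<sigma> b))"
| "exec W D (Mul r a b) \<sigma> = map_option (set_reg \<sigma> r) (mul_cell W (reg \<sigma> a) (reg \<sigma> b))"
| "exec W D (Div r a b) \<sigma> = map_option (set_reg \<sigma> r) (div_cell (reg \<sigma> a) (reg \<sigma> b))"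
| "exec W D (Read r a) \<sigma> = map_option (set_reg \<sigma> r) (fetch D (reg \<sigma> a))"
| "exec W D (Load r a) \<sigma> = map_option (set_reg \<sigma> r) (fetch (scratch \<sigma>) (reg \<sigma> a))"
| "exec W D (Store a r) \<sigma> =
     map_option (\<lambda>M. \<sigma>\<lparr>scratch := M, pc := Suc (pc \<sigma>)\<rparr>) (update (scratch \<sigma>) (reg \<sigma> a) (reg \<sigma> r))"
| "exec W D (Jump l) \<sigma> = Some (\<sigma>\<lparr>pc := l\<rparr>)"
| "exec W D (JumpLess a b l) \<sigma> =
     map_option (\<lambda>t. \<sigma>\<lparr>pc := (if t then l else Suc (pc \<sigma>))\<rparr>) (less_cell (reg \<sigma> a) (reg \<sigma> b))"
| "exec W D (Emit r) \<sigma> = Some (\<sigma>\<lparr>emitted := emitted \<sigma> @ [reg \<sigma> r], pc := Suc (pc \<sigma>)\<rparr>)"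

text \<open>
  \<open>run W D P T \<sigma> = Some os\<close> iff program \<open>P\<close>, started in \<open>\<sigma>\<close>, halts without error after at most \<open>T\<close>
  steps with output \<open>os\<close>. A program halts when control leaves its instruction list.
\<close>

fun run :: "nat \<Rightarrow> cell list \<Rightarrow> instr list \<Rightarrow> nat \<Rightarrow> state \<Rightarrow> cell list option" where
  "run W D P 0 \<sigma> = (if pc \<sigma> \<ge> length P then Some (emitted \<sigma>) else None)"
| "run W D P (Suc T) \<sigma> =
     (if pc \<sigma> \<ge> length P then Some (emitted \<sigma>)
      else Option.bind (exec W D (P ! pc \<sigma>) \<sigma>) (run W D P T))"

fun fits :: "nat \<Rightarrow> cell \<Rightarrow> bool" where
  "fits W (Idx k) \<longleftrightarrow> k < W"
| "fits W (Val x) \<longleftrightarrow> True"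

text \<open>
  Real cells of the data structure must hold integer combinations of the capacities with
  coefficients of absolute value below \<open>W\<close>. Without such a restriction a single real could encode
  an unbounded amount of information and the space bound would be meaningless.
\<close>

fun storable :: "nat \<Rightarrow> 'a network \<Rightarrow> cell \<Rightarrow> bool" where
  "storable W N (Idx k) \<longleftrightarrow> k < W"
| "storable W N (Val x) \<longleftrightarrow>
     (\<exists>c :: 'a \<times> 'a \<Rightarrow> int. (\<forall>e\<in>E N. \<bar>c e\<bar> < int W) \<and> x = (\<Sum>e\<in>E N. of_int (c e) * cap N e))"

definition query_state :: "nat \<times> nat \<Rightarrow> real \<Rightarrow> cell list \<Rightarrow> state" where
  "query_state e \<Delta> M =
     \<lparr>pc = 0,
      reg = (\<lambda>_. Idx 0)(0 := Idx (fst e), 1 := Idx (snd e), 2 := Val \<Delta>),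
      scratch = M, emitted = []\<rparr>"

text \<open>
  The data structure \<open>D\<close>, the query program \<open>P\<close> and \<open>S\<close> scratch cells answer the query \<open>(e, \<Delta>)\<close> such
  that the running time bound and the output satisfy \<open>Q\<close>. The scratch cells have arbitrary
  initial contents, for instance those left by earlier queries.
\<close>

definition answers ::
  "nat \<Rightarrow> cell list \<Rightarrow> nat \<Rightarrow> instr list \<Rightarrow> nat \<times> nat \<Rightarrow> real \<Rightarrow> (nat \<Rightarrow> cell list \<Rightarrow> bool) \<Rightarrow> bool" where
  "answers W D S P e \<Delta> Q \<longleftrightarrow>
     (\<forall>M. length M = S \<and> (\<forall>c\<in>set M. fits W c) \<longrightarrow>
        (\<exists>T os. run W D P T (query_state e \<Delta> M) = Some os \<and> Q T os))"


section \<open>Output formats\<close>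

definition lists_set :: "cell list \<Rightarrow> nat set \<Rightarrow> bool" where
  "lists_set os C \<longleftrightarrow> (\<exists>xs. distinct xs \<and> set xs = C \<and> os = map Idx xs)"

definition flat :: "(nat \<times> nat) list \<Rightarrow> nat list" where
  "flat ps = concat (map (\<lambda>(a, b). [a, b]) ps)"

text \<open>
  A DAG whose nodes partition \<open>V N\<close> is listed as pairs (vertex, label) and pairs of vertices, each
  list preceded by its length. Two vertices lie in the same node iff they have the same label, and a
  pair of vertices stands for an edge between their nodes. A vertex that is not listed has itself
  as its label. Isolated vertices, of which there may be far more than edges, can thus be omitted.
\<close>

definition label :: "(nat \<times> nat) list \<Rightarrow> nat \<Rightarrow> nat" where
  "label vs v = (case map_of vs v of None \<Rightarrow> v | Some l \<Rightarrow> l)"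

definition node_of :: "nat network \<Rightarrow> (nat \<times> nat) list \<Rightarrow> nat \<Rightarrow> nat set" where
  "node_of N vs v = {x \<in> V N. label vs x = label vs v}"

definition lists_dag :: "nat network \<Rightarrow> cell list \<Rightarrow> nat set pair_pre_digraph \<Rightarrow> bool" where
  "lists_dag N os D \<longleftrightarrow>
     (\<exists>vs es. os = map Idx (length vs # flat vs @ length es # flat es) \<and>
        pverts D = node_of N vs ` V N \<and>
        parcs D = (\<lambda>(x, y). (node_of N vs x, node_of N vs y)) ` set es)"

end

theory Submission
  imports Defs
begin

text \<open>
  Let \<open>c\<close> be the capacity of a minimum cut. For an arc \<open>e = (u, v)\<close> of capacity \<open>w\<close> let \<open>lam1\<close> be the least
  capacity of a cut that \<open>e\<close> leaves, and \<open>lam0\<close> that of the other cuts. After the change the minimum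
  is \<open>min lam0 (lam1 + \<Delta>)\<close>, attained by the minimisers of the one kind, of the other, or of both. The
  minimisers of the second kind avoid \<open>u\<close> or contain \<open>v\<close>, so they come from families that depend on a
  single vertex. The arcs with \<open>lam1 < c + w\<close> are vital: by uncrossing, none of them enters a minimiser
  of a vital arc of the same or a lower level \<open>lam1\<close>. Link the ends of vital arcs level by level,
  from above. In the component of \<open>u\<close> and \<open>v\<close>, the minimisers of \<open>e\<close> are described by two families, one for
  either side of the least vertex, and each of them is determined by a single vertex. Thus \<open>O(n)\<close>
  arrays of length \<open>n\<close>, a bounded number of which is referred to by each arc, suffice.

  A minimum cut is reported as a union or an intersection of such a family. For the DAG, a vertex gets a
  rank \<open>cl\<close> in a linear extension of the order in which minimum cuts contain the vertices, and a label
  \<open>jl\<close> of its strongly connected component if it lies on no path from source to sink. Together they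
  name its node, and \<open>cl\<close> says which way the residual arc of an arc between two nodes goes.

  Arcs with \<open>lam1 = c + w\<close> matter only when they are deleted. In a maximum flow obtained by
  lowering capacities to tight ones, at most \<open>n\<close> arcs are neither empty nor saturated, and a strongly
  connected component has fewer than twice as many bridges as vertices; apart from these \<open>O(n)\<close>
  exceptions, which have arrays of their own, deleting such an arc removes just that arc from the residual graph,
  or it counts as vital.
\<close>

section \<open>Minimum cuts\<close>

text \<open>There may be about \<open>n * n\<close> arcs, but only \<open>O(n)\<close> arrays of
  length \<open>n\<close> can be stored, so every array must be named by less than an arc: by a
  vertex, by a vertex that also determines a level, or by one of \<open>O(n)\<close> exceptional
  arcs. No flow of the changed network is stored or computed. The residual components are the same
  for every flow of the kind considered: on source-sink walks two vertices share a component iff no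
  minimum cut separates them, elsewhere reachability along positive arcs decides. Minimum cuts
  depend on \<open>\<Delta>\<close> only through the outcome of one comparison, and the positive
  arcs only through whether the arc is deleted; hence six sets of labels per arc. The tie
  \<open>lam1 = c + w\<close> is the obstacle: uncrossing needs the strict inequality, and at a tie
  an arc may enter foreign minimisers. A flow then decides how the arc is treated, and it has to be
  one with few fractional arcs. Time \<open>O(m)\<close> instead of \<open>O(n + m)\<close> means
  that vertices without arcs, other than source and sink, are never touched; each forms a node of
  its own and stays implicit.\<close>

locale st_net =
  fixes N :: "'a network"
  assumes finite_V: "finite (V N)"
    and arcs_wf: "E N \<subseteq> V N \<times> V N"
    and src_V: "src N \<in> V N" and snk_V: "snk N \<in> V N"
    and src_neq_snk: "src N \<noteq> snk N"
    and cap_nonneg: "e \<in> E N \<Longrightarrow> 0 \<le> cap N e"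
begin

lemma finite_E: "finite (E N)"
  using arcs_wf finite_V by (meson finite_SigmaI finite_subset)

lemma arc_ends: "(x, y) \<in> E N \<Longrightarrow> x \<in> V N \<and> y \<in> V N"
  using arcs_wf by auto

lemma cut_cap_eq: "cut_cap N C = (\<Sum>e\<in>E N. if fst e \<in> C \<and> snd e \<notin> C then cap N e else 0)"
  unfolding cut_cap_def using finite_E by (simp add: sum.inter_filter)

lemma finite_cuts: "finite {C. st_cut N C}"
  by (rule finite_subset[of _ "Pow (V N)"]) (auto simp: st_cut_def finite_V)

lemma st_cut_src: "st_cut N {src N}"
  using src_V src_neq_snk by (auto simp: st_cut_def)

lemma st_cut_Int: "st_cut N X \<Longrightarrow> st_cut N Y \<Longrightarrow> st_cut N (X \<inter> Y)"
  by (auto simp: st_cut_def)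

lemma st_cut_Un: "st_cut N X \<Longrightarrow> st_cut N Y \<Longrightarrow> st_cut N (X \<union> Y)"
  by (auto simp: st_cut_def)

lemma mincut_le: "st_cut N C \<Longrightarrow> mincut_cap N \<le> cut_cap N C"
  unfolding mincut_cap_def using finite_cuts by (auto intro: Min_le)

lemma st_mincut_iff: "st_mincut N C \<longleftrightarrow> st_cut N C \<and> cut_cap N C = mincut_cap N"
proof -
  have "mincut_cap N \<in> cut_cap N ` {C. st_cut N C}"
    unfolding mincut_cap_def using finite_cuts st_cut_src by (intro Min_in) auto
  then show ?thesis
    unfolding st_mincut_def using mincut_le by fastforce
qed

lemma ex_mincut: "\<exists>C. st_mincut N C"
proof -
  have "mincut_cap N \<in> cut_cap N ` {C. st_cut N C}"
    unfolding mincut_cap_def using finite_cuts st_cut_src by (intro Min_in) auto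
  then show ?thesis unfolding st_mincut_iff by auto
qed

text \<open>Compare arc by arc: only an arc joining the two differences is paid for on the left and
  lies in neither boundary on the right. This surplus drives all uncrossing arguments below.\<close>

lemma submodular_eq:
  "cut_cap N X + cut_cap N Y = cut_cap N (X \<inter> Y) + cut_cap N (X \<union> Y) +
    (\<Sum>e\<in>E N. if fst e \<in> X - Y \<and> snd e \<in> Y - X \<or> fst e \<in> Y - X \<and> snd e \<in> X - Y then cap N e else 0)"
  unfolding cut_cap_eq sum.distrib[symmetric] by (intro sum.cong) auto

lemma submodular_arcs:
  assumes "F \<subseteq> {e\<in>E N. fst e \<in> X - Y \<and> snd e \<in> Y - X \<or> fst e \<in> Y - X \<and> snd e \<in> X - Y}"
  shows "cut_cap N (X \<inter> Y) + cut_cap N (X \<union> Y) + sum (cap N) F \<le> cut_cap N X + cut_cap N Y"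
proof -
  let ?P = "\<lambda>e. fst e \<in> X - Y \<and> snd e \<in> Y - X \<or> fst e \<in> Y - X \<and> snd e \<in> X - Y"
  have "sum (cap N) F \<le> sum (cap N) {e\<in>E N. ?P e}"
    using assms cap_nonneg finite_E by (intro sum_mono2) auto
  also have "\<dots> = (\<Sum>e\<in>E N. if ?P e then cap N e else 0)"
    using finite_E by (simp add: sum.inter_filter)
  finally show ?thesis using submodular_eq[of X Y] by linarith
qed

lemma submodular: "cut_cap N (X \<inter> Y) + cut_cap N (X \<union> Y) \<le> cut_cap N X + cut_cap N Y"
  using submodular_arcs[of "{}" X Y] by simp

lemma submodular_arc:
  assumes "(a, b) \<in> E N" "a \<in> X - Y" "b \<in> Y - X"
  shows "cut_cap N (X \<inter> Y) + cut_cap N (X \<union> Y) + cap N (a, b) \<le> cut_cap N X + cut_cap N Y"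
  using submodular_arcs[of "{(a, b)}" X Y] assms by auto

lemma submodular_arc2:
  assumes "(a, b) \<in> E N" "a \<in> X - Y" "b \<in> Y - X" "(p, q) \<in> E N" "p \<in> Y - X" "q \<in> X - Y"
  shows "cut_cap N (X \<inter> Y) + cut_cap N (X \<union> Y) + cap N (a, b) + cap N (p, q) \<le> cut_cap N X + cut_cap N Y"
proof -
  have "(a, b) \<noteq> (p, q)" using assms by auto
  then show ?thesis using submodular_arcs[of "{(a, b), (p, q)}" X Y] assms by auto
qed

lemma st_mincut_lattice:
  assumes "st_mincut N X" "st_mincut N Y"
  shows st_mincut_Int: "st_mincut N (X \<inter> Y)" and st_mincut_Un: "st_mincut N (X \<union> Y)"
proof -
  have "mincut_cap N \<le> cut_cap N (X \<inter> Y)" "mincut_cap N \<le> cut_cap N (X \<union> Y)"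
    using assms by (auto intro!: mincut_le st_cut_Int st_cut_Un simp: st_mincut_iff)
  then have "cut_cap N (X \<inter> Y) = mincut_cap N" "cut_cap N (X \<union> Y) = mincut_cap N"
    using submodular[of X Y] assms by (auto simp: st_mincut_iff)
  then show "st_mincut N (X \<inter> Y)" "st_mincut N (X \<union> Y)"
    using assms by (auto intro!: st_cut_Int st_cut_Un simp: st_mincut_iff)
qed

lemma cut_cap_nonneg: "0 \<le> cut_cap N C"
  unfolding cut_cap_def by (intro sum_nonneg) (auto intro: cap_nonneg)

lemma mincut_cap_nonneg: "0 \<le> mincut_cap N"
  using ex_mincut cut_cap_nonneg unfolding st_mincut_iff by metis

text \<open>Such an arc would join \<open>X - Y\<close> to \<open>Y - X\<close>, and uncrossing
  would produce a cut below the minimum.\<close>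

lemma tight_not_entering:
  assumes "(a, b) \<in> E N" "0 < cap N (a, b)" "st_mincut N X" "a \<in> X" "b \<notin> X" "st_mincut N Y"
  shows "\<not> (a \<notin> Y \<and> b \<in> Y)"
proof
  assume "a \<notin> Y \<and> b \<in> Y"
  then have "cut_cap N (X \<inter> Y) + cut_cap N (X \<union> Y) + cap N (a, b) \<le> cut_cap N X + cut_cap N Y"
    using assms by (intro submodular_arc) auto
  moreover have "mincut_cap N \<le> cut_cap N (X \<inter> Y)" "mincut_cap N \<le> cut_cap N (X \<union> Y)"
    using assms by (auto intro!: mincut_le st_cut_Int st_cut_Un simp: st_mincut_iff)
  ultimately show False using assms by (auto simp: st_mincut_iff)
qed

end

subsection \<open>Signatures\<close>

text \<open>The number of signatures measures how finely a family of cuts splits the vertices. It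
  never exceeds the number of vertices and serves as a potential in counting arguments.\<close>

definition signature :: "'a set set \<Rightarrow> 'a \<Rightarrow> 'a set set" where
  "signature F x = {X\<in>F. x \<in> X}"

lemma card_signature_mono:
  assumes "finite A" "F \<subseteq> F'"
  shows "card (signature F ` A) \<le> card (signature F' ` A)"
proof -
  have "signature F ` A = (\<lambda>S. S \<inter> F) ` signature F' ` A"
    unfolding image_image signature_def using assms(2) by (intro image_cong) auto
  then show ?thesis using assms(1) by (simp add: card_image_le)
qed

text \<open>Restriction to \<open>F\<close> maps the finer signatures onto the coarser ones, and
  here it identifies two of them.\<close>

lemma card_signature_less:
  assumes "finite A" "F \<subseteq> F'" "x \<in> A" "y \<in> A"
    and "signature F x = signature F y" "signature F' x \<noteq> signature F' y"
  shows "card (signature F ` A) < card (signature F' ` A)"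
proof -
  have eq: "signature F z = signature F' z \<inter> F" for z
    unfolding signature_def using assms(2) by auto
  have "signature F ` A = (\<lambda>S. S \<inter> F) ` signature F' ` A"
    unfolding image_image using eq by (intro image_cong) auto
  moreover have "\<not> inj_on (\<lambda>S. S \<inter> F) (signature F' ` A)"
  proof
    assume "inj_on (\<lambda>S. S \<inter> F) (signature F' ` A)"
    then have "signature F' x = signature F' y"
      by (rule inj_onD) (use assms(3-5) eq in auto)
    then show False using assms(6) by simp
  qed
  then have "card ((\<lambda>S. S \<inter> F) ` signature F' ` A) \<noteq> card (signature F' ` A)"
    using assms(1) eq_card_imp_inj_on by blast
  ultimately show ?thesis
    using assms(1) card_image_le[of "signature F' ` A" "\<lambda>S. S \<inter> F"] by simp
qed

lemma card_signature_le: "finite A \<Longrightarrow> card (signature F ` A) \<le> card A"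
  by (rule card_image_le)

text \<open>A set of pairs that can be exhausted by cuts, each separating just one of the remaining pairs,
  is a forest.\<close>

lemma forest_card:
  assumes "finite A" "finite R" "R \<subseteq> A \<times> A"
    and "\<And>R'. R' \<subseteq> R \<Longrightarrow> R' \<noteq> {} \<Longrightarrow>
      \<exists>e\<in>R'. \<exists>Z. (fst e \<in> Z) \<noteq> (snd e \<in> Z) \<and> (\<forall>e'\<in>R' - {e}. (fst e' \<in> Z) = (snd e' \<in> Z))"
  shows "card R \<le> card A"
proof -
  \<comment> \<open>\<open>F\<close> collects the cuts used so far, none of which separates a
    remaining pair. Each further cut separates one, so it raises the number of signatures.\<close>
  have "card (signature F ` A) + card R \<le> card A" if "\<forall>Z\<in>F. \<forall>e\<in>R. (fst e \<in> Z) = (snd e \<in> Z)" for F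
    using assms(2-4) that
  proof (induction "card R" arbitrary: R F)
    case 0
    then show ?case using card_signature_le[OF assms(1)] by simp
  next
    case (Suc k)
    then have "R \<noteq> {}" by auto
    then obtain e Z where eZ: "e \<in> R" "(fst e \<in> Z) \<noteq> (snd e \<in> Z)"
      "\<forall>e'\<in>R - {e}. (fst e' \<in> Z) = (snd e' \<in> Z)"
      using Suc.prems(3)[OF subset_refl \<open>R \<noteq> {}\<close>] by (elim bexE exE conjE) (rule that)
    have "card (signature F ` A) < card (signature (insert Z F) ` A)"
      using Suc.prems(2,4) eZ assms(1)
      by (intro card_signature_less[of A F _ "fst e" "snd e"]) (auto simp: signature_def)
    moreover have "card (signature (insert Z F) ` A) + card (R - {e}) \<le> card A"
    proof (rule Suc.hyps(1))
      show "k = card (R - {e})" using Suc.hyps(2) eZ(1) Suc.prems(1) by simp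
      show "finite (R - {e})" "R - {e} \<subseteq> A \<times> A" using Suc.prems by auto
      show "\<forall>Z\<in>insert Z F. \<forall>e\<in>R - {e}. (fst e \<in> Z) = (snd e \<in> Z)"
        using Suc.prems(4) eZ(3) by auto
    next
      fix R' assume "R' \<subseteq> R - {e}" "R' \<noteq> {}"
      then show "\<exists>e\<in>R'. \<exists>Z. (fst e \<in> Z) \<noteq> (snd e \<in> Z) \<and> (\<forall>e'\<in>R' - {e}. (fst e' \<in> Z) = (snd e' \<in> Z))"
        by (intro Suc.prems(3)) auto
    qed
    moreover have "card R = Suc (card (R - {e}))" by (rule card.remove[OF Suc.prems(1) eZ(1)])
    ultimately show ?case by linarith
  qed
  from this[of "{}"] show ?thesis by simp
qed

section \<open>Maximum flows\<close>

lemma (in st_net) st_net_upd_cap: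
  assumes "\<forall>e\<in>E N. 0 \<le> g e"
  shows "st_net (N\<lparr>cap := g\<rparr>)"
  using assms finite_V arcs_wf src_V snk_V src_neq_snk by unfold_locales auto

lemma st_cut_upd_cap [simp]: "st_cut (N\<lparr>cap := g\<rparr>) C \<longleftrightarrow> st_cut N C"
  by (simp add: st_cut_def)

lemma (in st_net) cut_cap_upd:
  assumes "e \<in> E N"
  shows "cut_cap (N\<lparr>cap := (cap N)(e := k)\<rparr>) X =
    cut_cap N X + (if fst e \<in> X \<and> snd e \<notin> X then k - cap N e else 0)"
proof -
  let ?S = "{e \<in> E N. fst e \<in> X \<and> snd e \<notin> X}"
  have "cut_cap (N\<lparr>cap := (cap N)(e := k)\<rparr>) X = (\<Sum>a\<in>?S. cap N a + (if a = e then k - cap N e else 0))"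
    by (simp add: cut_cap_def, rule sum.cong) auto
  also have "\<dots> = cut_cap N X + (\<Sum>a\<in>?S. if a = e then k - cap N e else 0)"
    by (simp add: sum.distrib cut_cap_def)
  finally show ?thesis using assms finite_E by simp
qed

lemma (in st_net) st_mincut_Inter:
  assumes "F \<noteq> {}" "\<forall>X\<in>F. st_mincut N X"
  shows "st_mincut N (\<Inter>F)"
proof -
  have "finite F" by (rule finite_subset[OF _ finite_cuts]) (use assms(2) in \<open>auto simp: st_mincut_iff\<close>)
  then show ?thesis using assms
    by (induction rule: finite_ne_induct) (auto intro: st_mincut_Int)
qed

lemma (in st_net) st_mincut_Union:
  assumes "F \<noteq> {}" "\<forall>X\<in>F. st_mincut N X"
  shows "st_mincut N (\<Union>F)"
proof -
  have "finite F" by (rule finite_subset[OF _ finite_cuts]) (use assms(2) in \<open>auto simp: st_mincut_iff\<close>)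
  then show ?thesis using assms
    by (induction rule: finite_ne_induct) (auto intro: st_mincut_Un)
qed

text \<open>Lower the capacities one at a time, as far as the minimum cut capacity does not drop.
  An arc whose capacity ends up strictly between 0 and its old value splits a signature class.\<close>

lemma tight_reduction:
  assumes "st_net N"
  shows "\<exists>g. (\<forall>e\<in>E N. 0 \<le> g e \<and> g e \<le> cap N e) \<and> mincut_cap (N\<lparr>cap := g\<rparr>) = mincut_cap N \<and>
    (\<forall>e\<in>E N. 0 < g e \<longrightarrow> (\<exists>X. st_mincut (N\<lparr>cap := g\<rparr>) X \<and> fst e \<in> X \<and> snd e \<notin> X)) \<and>
    card {e\<in>E N. 0 < g e \<and> g e < cap N e} + card (signature {X. st_mincut N X} ` V N) \<le> card (V N)"
  using assms
proof (induction "card {e\<in>E N. 0 < cap N e \<and> \<not> (\<exists>X. st_mincut N X \<and> fst e \<in> X \<and> snd e \<notin> X)}"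
    arbitrary: N rule: less_induct)
  case less
  then interpret st_net N by simp
  let ?bad = "\<lambda>N. {e\<in>E N. 0 < cap N e \<and> \<not> (\<exists>X. st_mincut N X \<and> fst e \<in> X \<and> snd e \<notin> X)}"
  show ?case
  proof (cases "?bad N = {}")
    case True
    then have "\<forall>e\<in>E N. 0 < cap N e \<longrightarrow> (\<exists>X. st_mincut N X \<and> fst e \<in> X \<and> snd e \<notin> X)" by blast
    moreover have "N\<lparr>cap := cap N\<rparr> = N" by simp
    moreover have "{e\<in>E N. 0 < cap N e \<and> cap N e < cap N e} = {}" by simp
    ultimately show ?thesis
      using card_signature_le[OF finite_V, of "{X. st_mincut N X}"] cap_nonneg
      by (intro exI[of _ "cap N"]) simp
  next
    case False
    then obtain e where e: "e \<in> E N" "0 < cap N e"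
      and nt: "\<And>X. st_mincut N X \<Longrightarrow> fst e \<in> X \<Longrightarrow> snd e \<in> X" by blast
    let ?c = "mincut_cap N"
    define S where "S = cut_cap N ` {X. st_cut N X \<and> fst e \<in> X \<and> snd e \<notin> X}"
    \<comment> \<open>Lower \<open>e\<close> until the cheapest cut left by it becomes minimum, or
      until its capacity is used up; if \<open>e\<close> leaves no cut, it can drop to 0.\<close>
    define k where "k = (if S = {} then 0 else max 0 (cap N e - (Min S - ?c)))"
    have finS: "finite S" unfolding S_def by (rule finite_imageI, rule finite_subset[OF _ finite_cuts]) auto
    have Sgt: "?c < l" if l: "l \<in> S" for l
    proof -
      obtain X where X: "st_cut N X" "fst e \<in> X" "snd e \<notin> X" "l = cut_cap N X"
        using l by (auto simp: S_def)
      have "l \<noteq> ?c" using nt[of X] X by (auto simp: st_mincut_iff)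
      then show ?thesis using mincut_le[OF X(1)] X(4) by simp
    qed
    have k0: "0 \<le> k" and ke: "k < cap N e"
      using e(2) Sgt[of "Min S"] Min_in[OF finS] by (auto simp: k_def)
    define N1 where "N1 = N\<lparr>cap := (cap N)(e := k)\<rparr>"
    interpret N1: st_net N1
      unfolding N1_def by (rule st_net_upd_cap) (use k0 cap_nonneg in auto)
    have N1s [simp]: "V N1 = V N" "E N1 = E N" "st_cut N1 = st_cut N"
      "cap N1 = (cap N)(e := k)" "N1\<lparr>cap := g\<rparr> = N\<lparr>cap := g\<rparr>" for g
      by (auto simp: N1_def fun_eq_iff)
    have cc: "cut_cap N1 X = cut_cap N X + (if fst e \<in> X \<and> snd e \<notin> X then k - cap N e else 0)" for X
      unfolding N1_def by (rule cut_cap_upd[OF e(1)])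
    have ge: "?c \<le> cut_cap N1 X" if X: "st_cut N X" for X
    proof (cases "fst e \<in> X \<and> snd e \<notin> X")
      case True
      then have "cut_cap N X \<in> S" using X by (auto simp: S_def)
      then have "Min S \<le> cut_cap N X" "S \<noteq> {}" using finS by auto
      then show ?thesis using True cc[of X] by (auto simp: k_def)
    next
      case False
      then show ?thesis using cc[of X] mincut_le[OF X] by (simp only: if_False add_0_right)
    qed
    have sub: "st_mincut N1 X \<and> mincut_cap N1 = ?c" if "st_mincut N X" for X
    proof -
      have "cut_cap N1 X = ?c" using that nt[OF that] cc[of X] by (auto simp: st_mincut_iff)
      moreover obtain Y where "st_cut N Y" "cut_cap N1 Y = mincut_cap N1"
        using N1.ex_mincut unfolding N1.st_mincut_iff by auto
      moreover have "mincut_cap N1 \<le> cut_cap N1 X"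
        using that N1.mincut_le by (simp add: st_mincut_iff)
      ultimately show ?thesis using ge[of Y] that unfolding N1.st_mincut_iff st_mincut_iff by auto
    qed
    have c1: "mincut_cap N1 = ?c" using ex_mincut sub by blast
    have mono: "{X. st_mincut N X} \<subseteq> {X. st_mincut N1 X}" using sub by auto
    have e_ok: "k = 0 \<or> (\<exists>X. st_mincut N1 X \<and> fst e \<in> X \<and> snd e \<notin> X)"
    proof (cases "k = 0")
      case False
      then have ne: "S \<noteq> {}" by (auto simp: k_def)
      then obtain X where X: "st_cut N X" "fst e \<in> X" "snd e \<notin> X" "Min S = cut_cap N X"
        using Min_in[OF finS ne] by (auto simp: S_def)
      have "k = cap N e - (Min S - ?c)" using False ne by (auto simp: k_def max_def split: if_splits)
      then have "cut_cap N1 X = ?c" using cc[of X] X by simp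
      then show ?thesis using X c1 by (auto simp: N1.st_mincut_iff)
    qed simp
    have bad_less: "card (?bad N1) < card (?bad N)"
    proof (rule psubset_card_mono)
      have "?bad N1 \<subseteq> ?bad N - {e}" using e_ok mono by (auto split: if_splits)
      moreover have "e \<in> ?bad N" using e nt by auto
      ultimately show "?bad N1 \<subset> ?bad N" by blast
      show "finite (?bad N)" using finite_E by simp
    qed
    let ?Q = "\<lambda>g. (\<forall>e\<in>E N. 0 \<le> g e \<and> g e \<le> cap N1 e) \<and> mincut_cap (N\<lparr>cap := g\<rparr>) = ?c \<and>
      (\<forall>e\<in>E N. 0 < g e \<longrightarrow> (\<exists>X. st_mincut (N\<lparr>cap := g\<rparr>) X \<and> fst e \<in> X \<and> snd e \<notin> X)) \<and>
      card {e\<in>E N. 0 < g e \<and> g e < cap N1 e} + card (signature {X. st_mincut N1 X} ` V N) \<le> card (V N)"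
    have "\<exists>g. ?Q g"
      using less(1)[OF bad_less N1.st_net_axioms] unfolding c1 N1s(1,2,5) .
    then obtain g where g: "?Q g" by (rule exE)
    then have g4: "card {e\<in>E N. 0 < g e \<and> g e < cap N1 e} + card (signature {X. st_mincut N1 X} ` V N) \<le> card (V N)"
      by (elim conjE)
    have "card {a\<in>E N. 0 < g a \<and> g a < cap N a} + card (signature {X. st_mincut N X} ` V N) \<le> card (V N)"
    proof (cases "k = 0")
      case True
      have "{a\<in>E N. 0 < g a \<and> g a < cap N a} = {a\<in>E N. 0 < g a \<and> g a < cap N1 a}"
        using g e True by (auto split: if_splits)
      then show ?thesis using g4 card_signature_mono[OF finite_V mono] by simp
    next
      case False
      then obtain X where X: "st_mincut N1 X" "fst e \<in> X" "snd e \<notin> X" using e_ok by auto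
      \<comment> \<open>No old minimum cut is left by \<open>e\<close>; and none is entered by it,
        since \<open>e\<close> is now tight with positive capacity. The new tight cut therefore
        splits an old class, which pays for the fractional arc.\<close>
      have "signature {X. st_mincut N X} (fst e) = signature {X. st_mincut N X} (snd e)"
      proof -
        have "\<not> (fst e \<notin> Y \<and> snd e \<in> Y)" if "st_mincut N Y" for Y
          using N1.tight_not_entering[of "fst e" "snd e" X Y] e X sub[OF that] False k0 by simp
        then show ?thesis unfolding signature_def using nt by fast
      qed
      moreover have "signature {X. st_mincut N1 X} (fst e) \<noteq> signature {X. st_mincut N1 X} (snd e)"
        using X by (auto simp: signature_def)
      ultimately have "card (signature {X. st_mincut N X} ` V N) < card (signature {X. st_mincut N1 X} ` V N)"
        using e(1) arcs_wf by (intro card_signature_less[OF finite_V mono, of "fst e" "snd e"]) auto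
      moreover have "card {a\<in>E N. 0 < g a \<and> g a < cap N a} \<le> card (insert e {a\<in>E N. 0 < g a \<and> g a < cap N1 a})"
        using finite_E by (intro card_mono) auto
      moreover have "\<dots> \<le> Suc (card {a\<in>E N. 0 < g a \<and> g a < cap N1 a})"
        by (rule card_insert_le_m1) auto
      ultimately show ?thesis using g4 by linarith
    qed
    moreover have "\<forall>a\<in>E N. 0 \<le> g a \<and> g a \<le> cap N a"
      using g ke by (auto split: if_splits)
    ultimately show ?thesis using g by (intro exI[of _ g]) simp
  qed
qed

section \<open>Flow values across cuts, and tight capacities as a flow\<close>

context st_net
begin

lemma net_out_eq: "net_out N f v = (\<Sum>e\<in>E N. (if fst e = v then f e else 0) - (if snd e = v then f e else 0))"
  unfolding net_out_def sum_subtractf using finite_E by (simp add: sum.inter_filter)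

lemma sum_net_out:
  assumes "X \<subseteq> V N"
  shows "(\<Sum>v\<in>X. net_out N f v) =
    (\<Sum>e\<in>E N. (if fst e \<in> X \<and> snd e \<notin> X then f e else 0) - (if fst e \<notin> X \<and> snd e \<in> X then f e else 0))"
proof -
  have fX: "finite X" using assms finite_V finite_subset by auto
  have "(\<Sum>v\<in>X. net_out N f v) =
      (\<Sum>e\<in>E N. \<Sum>v\<in>X. (if fst e = v then f e else 0) - (if snd e = v then f e else 0))"
    unfolding net_out_eq by (rule sum.swap)
  also have "\<dots> = (\<Sum>e\<in>E N. (if fst e \<in> X then f e else 0) - (if snd e \<in> X then f e else 0))"
    unfolding sum_subtractf using fX by (simp add: sum.delta)
  also have "\<dots> = (\<Sum>e\<in>E N. (if fst e \<in> X \<and> snd e \<notin> X then f e else 0) - (if fst e \<notin> X \<and> snd e \<in> X then f e else 0))"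
    by (intro sum.cong) auto
  finally show ?thesis .
qed

lemma flow_value_cut:
  assumes "\<forall>v\<in>V N - {src N, snk N}. net_out N f v = 0" "st_cut N X"
  shows "net_out N f (src N) =
    (\<Sum>e\<in>E N. (if fst e \<in> X \<and> snd e \<notin> X then f e else 0) - (if fst e \<notin> X \<and> snd e \<in> X then f e else 0))"
proof -
  have X: "X \<subseteq> V N" "src N \<in> X" "snk N \<notin> X" using assms(2) by (auto simp: st_cut_def)
  then have "(\<Sum>v\<in>X. net_out N f v) = (\<Sum>v\<in>{src N}. net_out N f v)"
    using assms(1) finite_V finite_subset[OF X(1)] by (intro sum.mono_neutral_right) auto
  then show ?thesis using sum_net_out[OF X(1), of f] by simp
qed

text \<open>Every positive arc out of \<open>v\<close> leaves the smallest minimum cut containing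
  \<open>v\<close>. Taking \<open>v\<close> out of this cut saves the whole outflow and costs at
  most the inflow, so the outflow is not larger. The largest minimum cut avoiding \<open>v\<close>
  gives the reverse inequality.\<close>

lemma all_tight_conservation:
  assumes tight: "\<And>e. e \<in> E N \<Longrightarrow> 0 < cap N e \<Longrightarrow> \<exists>X. st_mincut N X \<and> fst e \<in> X \<and> snd e \<notin> X"
    and v: "v \<in> V N" "v \<noteq> src N" "v \<noteq> snk N"
  shows "net_out N (cap N) v = 0"
proof -
  let ?out = "\<Sum>e\<in>E N. if fst e = v then cap N e else 0"
  let ?in = "\<Sum>e\<in>E N. if snd e = v then cap N e else 0"
  have nn: "0 \<le> ?out" "0 \<le> ?in" by (auto intro!: sum_nonneg cap_nonneg)
  have A: "?out \<le> ?in" if pos: "0 < ?out"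
  proof -
    have "\<exists>e\<in>E N. fst e = v \<and> 0 < cap N e"
    proof (rule ccontr)
      assume "\<not> ?thesis"
      then have "?out \<le> 0" by (intro sum_nonpos) auto
      then show False using pos by simp
    qed
    then obtain X0 where X0: "st_mincut N X0" "v \<in> X0" using tight by blast
    define I where "I = \<Inter>{X. st_mincut N X \<and> v \<in> X}"
    have I: "st_mincut N I" unfolding I_def using X0 by (intro st_mincut_Inter) auto
    then have cut: "st_cut N (I - {v})" using v by (auto simp: st_mincut_iff st_cut_def)
    have "cut_cap N (I - {v}) + ?out \<le> cut_cap N I + ?in"
      unfolding cut_cap_eq sum.distrib[symmetric]
    proof (rule sum_mono)
      fix e assume e: "e \<in> E N"
      have "fst e = v \<longrightarrow> 0 < cap N e \<longrightarrow> snd e \<notin> I"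
        using tight[OF e] by (auto simp: I_def)
      moreover have "v \<in> I" by (auto simp: I_def)
      ultimately show "(if fst e \<in> I - {v} \<and> snd e \<notin> I - {v} then cap N e else 0) + (if fst e = v then cap N e else 0)
        \<le> (if fst e \<in> I \<and> snd e \<notin> I then cap N e else 0) + (if snd e = v then cap N e else 0)"
        using cap_nonneg[OF e] by (auto simp: not_less)
    qed
    then show ?thesis using mincut_le[OF cut] I by (simp add: st_mincut_iff)
  qed
  have B: "?in \<le> ?out" if pos: "0 < ?in"
  proof -
    have "\<exists>e\<in>E N. snd e = v \<and> 0 < cap N e"
    proof (rule ccontr)
      assume "\<not> ?thesis"
      then have "?in \<le> 0" by (intro sum_nonpos) auto
      then show False using pos by simp
    qed
    then obtain X0 where X0: "st_mincut N X0" "v \<notin> X0" using tight by blast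
    define J where "J = \<Union>{X. st_mincut N X \<and> v \<notin> X}"
    have J: "st_mincut N J" unfolding J_def using X0 by (intro st_mincut_Union) auto
    then have cut: "st_cut N (insert v J)" using v by (auto simp: st_mincut_iff st_cut_def)
    have "cut_cap N (insert v J) + ?in \<le> cut_cap N J + ?out"
      unfolding cut_cap_eq sum.distrib[symmetric]
    proof (rule sum_mono)
      fix e assume e: "e \<in> E N"
      have "snd e = v \<longrightarrow> 0 < cap N e \<longrightarrow> fst e \<in> J"
        using tight[OF e] by (auto simp: J_def)
      moreover have "v \<notin> J" by (auto simp: J_def)
      ultimately show "(if fst e \<in> insert v J \<and> snd e \<notin> insert v J then cap N e else 0) + (if snd e = v then cap N e else 0)
        \<le> (if fst e \<in> J \<and> snd e \<notin> J then cap N e else 0) + (if fst e = v then cap N e else 0)"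
        using cap_nonneg[OF e] by (auto simp: not_less)
    qed
    then show ?thesis using mincut_le[OF cut] J by (simp add: st_mincut_iff)
  qed
  have "?out = ?in" using A B nn by linarith
  then show ?thesis unfolding net_out_eq sum_subtractf by simp
qed

text \<open>If the source did not reach \<open>a\<close>, restricting a minimum cut left by the arc
  to the reachable vertices would drop the arc and cut nothing new. For \<open>b\<close>, the
  vertices that do not reach the sink are added to the cut instead.\<close>

lemma all_tight_support:
  assumes tight: "\<And>e. e \<in> E N \<Longrightarrow> 0 < cap N e \<Longrightarrow> \<exists>X. st_mincut N X \<and> fst e \<in> X \<and> snd e \<notin> X"
    and e: "(a, b) \<in> E N" "0 < cap N (a, b)"
  shows "(src N, a) \<in> {e\<in>E N. 0 < cap N e}\<^sup>*" and "(b, snk N) \<in> {e\<in>E N. 0 < cap N e}\<^sup>*"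
proof -
  let ?P = "{e\<in>E N. 0 < cap N e}"
  obtain X where X: "st_mincut N X" "a \<in> X" "b \<notin> X" using tight[OF e] by auto
  have fin: "finite (E N)" by (rule finite_E)
  have le: "cut_cap N Y + cap N (a, b) \<le> cut_cap N X"
    if "\<And>e. e \<in> E N \<Longrightarrow> 0 < cap N e \<Longrightarrow> fst e \<in> Y \<Longrightarrow> snd e \<notin> Y \<Longrightarrow> fst e \<in> X \<and> snd e \<notin> X \<and> e \<noteq> (a, b)" for Y
  proof -
    have eq: "cap N (a, b) = (\<Sum>e\<in>E N. if e = (a, b) then cap N e else 0)"
      using fin e(1) by (simp add: sum.delta)
    have "cut_cap N Y + (\<Sum>e\<in>E N. if e = (a, b) then cap N e else 0) \<le> cut_cap N X"
      unfolding cut_cap_eq sum.distrib[symmetric]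
    proof (rule sum_mono)
      fix e' assume e': "e' \<in> E N"
      show "(if fst e' \<in> Y \<and> snd e' \<notin> Y then cap N e' else 0) + (if e' = (a, b) then cap N e' else 0)
        \<le> (if fst e' \<in> X \<and> snd e' \<notin> X then cap N e' else 0)"
        using that[OF e'] cap_nonneg[OF e'] X(2,3) by (cases "0 < cap N e'") auto
    qed
    then show ?thesis using eq by simp
  qed
  show "(src N, a) \<in> ?P\<^sup>*"
  proof (rule ccontr)
    assume na: "(src N, a) \<notin> ?P\<^sup>*"
    let ?Y = "X \<inter> {v. (src N, v) \<in> ?P\<^sup>*}"
    have "st_cut N ?Y" using X by (auto simp: st_mincut_iff st_cut_def)
    moreover have "cut_cap N ?Y + cap N (a, b) \<le> cut_cap N X"
    proof (rule le)
      fix e' assume *: "e' \<in> E N" "0 < cap N e'" "fst e' \<in> ?Y" "snd e' \<notin> ?Y"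
      then have "(fst e', snd e') \<in> ?P" by simp
      then have "(src N, snd e') \<in> ?P\<^sup>*" using *(3) by (auto intro: rtrancl_into_rtrancl)
      then show "fst e' \<in> X \<and> snd e' \<notin> X \<and> e' \<noteq> (a, b)" using * na by auto
    qed
    ultimately show False using mincut_le[of ?Y] X(1) e(2) by (simp add: st_mincut_iff)
  qed
  show "(b, snk N) \<in> ?P\<^sup>*"
  proof (rule ccontr)
    assume nb: "(b, snk N) \<notin> ?P\<^sup>*"
    let ?Y = "X \<union> {v\<in>V N. (v, snk N) \<notin> ?P\<^sup>*}"
    have "st_cut N ?Y" using X by (auto simp: st_mincut_iff st_cut_def)
    moreover have "cut_cap N ?Y + cap N (a, b) \<le> cut_cap N X"
    proof (rule le)
      fix e' assume *: "e' \<in> E N" "0 < cap N e'" "fst e' \<in> ?Y" "snd e' \<notin> ?Y"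
      then have "(fst e', snd e') \<in> ?P" by simp
      moreover have "(snd e', snk N) \<in> ?P\<^sup>*" using *(1,4) arcs_wf by auto
      ultimately have "(fst e', snk N) \<in> ?P\<^sup>*" by (rule converse_rtrancl_into_rtrancl)
      moreover have "b \<in> V N" using e(1) arc_ends by simp
      ultimately show "fst e' \<in> X \<and> snd e' \<notin> X \<and> e' \<noteq> (a, b)" using * nb by auto
    qed
    ultimately show False using mincut_le[of ?Y] X(1) e(2) by (simp add: st_mincut_iff)
  qed
qed

end

text \<open>Beyond maximality, flow-carrying arcs extend to source-sink walks of such arcs, so no
  flow circulates elsewhere, and there are few arcs that are neither empty nor saturated.\<close>

locale tight_flow = st_net +
  fixes f :: "'a \<times> 'a \<Rightarrow> real"
  assumes f_bounds: "e \<in> E N \<Longrightarrow> 0 \<le> f e \<and> f e \<le> cap N e"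
    and f_conserv: "\<forall>v\<in>V N - {src N, snk N}. net_out N f v = 0"
    and f_leaving: "st_mincut N X \<Longrightarrow> e \<in> E N \<Longrightarrow> fst e \<in> X \<Longrightarrow> snd e \<notin> X \<Longrightarrow> f e = cap N e"
    and f_entering: "st_mincut N X \<Longrightarrow> e \<in> E N \<Longrightarrow> fst e \<notin> X \<Longrightarrow> snd e \<in> X \<Longrightarrow> f e = 0"
    and f_from_src: "(a, b) \<in> E N \<Longrightarrow> 0 < f (a, b) \<Longrightarrow> (src N, a) \<in> {e\<in>E N. 0 < f e}\<^sup>*"
    and f_to_snk: "(a, b) \<in> E N \<Longrightarrow> 0 < f (a, b) \<Longrightarrow> (b, snk N) \<in> {e\<in>E N. 0 < f e}\<^sup>*"
    and f_fractional: "card {e\<in>E N. 0 < f e \<and> f e < cap N e} \<le> card (V N)"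

text \<open>The lowered capacities \<open>g\<close> themselves are the flow. Minimum cuts of
  \<open>N\<close> stay minimum under \<open>g\<close>: hence \<open>g\<close> saturates the arcs
  leaving them, and by \<open>tight_not_entering\<close> it vanishes on those entering.\<close>

lemma (in st_net) ex_tight_flow: "\<exists>f. tight_flow N f"
proof -
  obtain g where g: "\<forall>e\<in>E N. 0 \<le> g e \<and> g e \<le> cap N e" "mincut_cap (N\<lparr>cap := g\<rparr>) = mincut_cap N"
    "\<forall>e\<in>E N. 0 < g e \<longrightarrow> (\<exists>X. st_mincut (N\<lparr>cap := g\<rparr>) X \<and> fst e \<in> X \<and> snd e \<notin> X)"
    "card {e\<in>E N. 0 < g e \<and> g e < cap N e} + card (signature {X. st_mincut N X} ` V N) \<le> card (V N)"
    using tight_reduction[OF st_net_axioms] by auto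
  interpret M: st_net "N\<lparr>cap := g\<rparr>" by (rule st_net_upd_cap) (use g(1) in auto)
  have tight: "\<And>e. e \<in> E N \<Longrightarrow> 0 < g e \<Longrightarrow> \<exists>X. st_mincut (N\<lparr>cap := g\<rparr>) X \<and> fst e \<in> X \<and> snd e \<notin> X"
    using g(3) by auto
  have le: "cut_cap (N\<lparr>cap := g\<rparr>) X \<le> cut_cap N X" for X
    unfolding cut_cap_def using g(1) by (auto intro!: sum_mono)
  have mc: "st_mincut (N\<lparr>cap := g\<rparr>) X" if "st_mincut N X" for X
    using that le[of X] M.mincut_le[of X] g(2) unfolding st_mincut_iff M.st_mincut_iff by auto
  have "tight_flow N g"
  proof
    fix e X assume *: "st_mincut N X" "e \<in> E N" "fst e \<in> X" "snd e \<notin> X"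
    have eq: "cut_cap (N\<lparr>cap := g\<rparr>) X = cut_cap N X"
      using mc[OF *(1)] *(1) g(2) by (simp add: st_mincut_iff M.st_mincut_iff)
    show "g e = cap N e"
    proof (rule ccontr)
      assume "g e \<noteq> cap N e"
      then have "cut_cap (N\<lparr>cap := g\<rparr>) X < cut_cap N X"
        unfolding cut_cap_def using * g(1) finite_E
        by simp (intro sum_strict_mono_ex1 bexI[of _ e], auto intro: order.not_eq_order_implies_strict)
      then show False using eq by simp
    qed
  next
    fix e X assume *: "st_mincut N X" "e \<in> E N" "fst e \<notin> X" "snd e \<in> X"
    show "g e = 0"
    proof (rule ccontr)
      assume "g e \<noteq> 0"
      then have pos: "0 < g e" using g(1) *(2) by (simp add: order.not_eq_order_implies_strict)
      then show False
        using tight[OF *(2) pos] M.tight_not_entering[of "fst e" "snd e" _ X] * mc by auto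
    qed
  next
    show "\<forall>v\<in>V N - {src N, snk N}. net_out N g v = 0"
      using M.all_tight_conservation[simplified, OF tight] by (simp add: net_out_def)
  next
    fix a b assume *: "(a, b) \<in> E N" "0 < g (a, b)"
    show "(src N, a) \<in> {e\<in>E N. 0 < g e}\<^sup>*" "(b, snk N) \<in> {e\<in>E N. 0 < g e}\<^sup>*"
      using M.all_tight_support[simplified, OF tight *] by simp_all
  next
    show "card {e\<in>E N. 0 < g e \<and> g e < cap N e} \<le> card (V N)" using g(4) by simp
  next
    fix e assume "e \<in> E N"
    then show "0 \<le> g e \<and> g e \<le> cap N e" using g(1) by simp
  qed
  then show ?thesis by blast
qed

context tight_flow
begin

lemma value_cut_le:
  assumes "st_flow N g" "st_cut N X"
  shows "net_out N g (src N) \<le> cut_cap N X"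
proof -
  have "net_out N g (src N) = (\<Sum>e\<in>E N. (if fst e \<in> X \<and> snd e \<notin> X then g e else 0) - (if fst e \<notin> X \<and> snd e \<in> X then g e else 0))"
    using assms by (intro flow_value_cut) (auto simp: st_flow_def)
  also have "\<dots> \<le> cut_cap N X"
    unfolding cut_cap_eq using assms(1) by (intro sum_mono) (auto simp: st_flow_def)
  finally show ?thesis .
qed

lemma value_eq_cut_iff:
  assumes "st_cut N X"
  shows "net_out N f (src N) = cut_cap N X \<longleftrightarrow>
    (\<forall>e\<in>E N. (fst e \<in> X \<and> snd e \<notin> X \<longrightarrow> f e = cap N e) \<and> (fst e \<notin> X \<and> snd e \<in> X \<longrightarrow> f e = 0))"
proof -
  have "cut_cap N X - net_out N f (src N) =
      (\<Sum>e\<in>E N. (if fst e \<in> X \<and> snd e \<notin> X then cap N e - f e else 0) + (if fst e \<notin> X \<and> snd e \<in> X then f e else 0))"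
    unfolding flow_value_cut[OF f_conserv assms] cut_cap_eq sum_subtractf[symmetric] by (intro sum.cong) auto
  moreover have "\<dots> = 0 \<longleftrightarrow> (\<forall>e\<in>E N. (if fst e \<in> X \<and> snd e \<notin> X then cap N e - f e else 0) + (if fst e \<notin> X \<and> snd e \<in> X then f e else 0) = 0)"
    using f_bounds finite_E by (intro sum_nonneg_eq_0_iff) auto
  ultimately have "net_out N f (src N) = cut_cap N X \<longleftrightarrow> (\<forall>e\<in>E N. (if fst e \<in> X \<and> snd e \<notin> X then cap N e - f e else 0) + (if fst e \<notin> X \<and> snd e \<in> X then f e else 0) = 0)"
    by linarith
  then show ?thesis by auto
qed

lemma value_eq: "net_out N f (src N) = mincut_cap N"
proof -
  obtain X where X: "st_mincut N X" using ex_mincut by auto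
  then have "net_out N f (src N) = cut_cap N X"
    using f_leaving[OF X] f_entering[OF X] by (subst value_eq_cut_iff) (auto simp: st_mincut_iff)
  then show ?thesis using X by (simp add: st_mincut_iff)
qed

lemma flow: "st_flow N f"
  using f_bounds f_conserv by (simp add: st_flow_def)

lemma max_flow: "max_flow N f"
proof -
  obtain X where X: "st_cut N X" "cut_cap N X = mincut_cap N"
    using ex_mincut unfolding st_mincut_iff by auto
  show ?thesis
    unfolding max_flow_def value_eq using flow value_cut_le[OF _ X(1)] X(2) by simp
qed

text \<open>The sum is the residual capacity leaving \<open>X\<close>, so residual arcs account for
  the whole excess of a cut over the minimum.\<close>

lemma residual_cut_cap:
  assumes "st_cut N X"
  shows "cut_cap N X = mincut_cap N +
    (\<Sum>e\<in>E N. (if fst e \<in> X \<and> snd e \<notin> X then cap N e - f e else 0) + (if fst e \<notin> X \<and> snd e \<in> X then f e else 0))"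
proof -
  have "cut_cap N X - net_out N f (src N) =
      (\<Sum>e\<in>E N. (if fst e \<in> X \<and> snd e \<notin> X then cap N e - f e else 0) + (if fst e \<notin> X \<and> snd e \<in> X then f e else 0))"
    unfolding flow_value_cut[OF f_conserv assms] cut_cap_eq sum_subtractf[symmetric] by (intro sum.cong) auto
  then show ?thesis by (simp add: value_eq)
qed

end

section \<open>The residual graph and the Picard--Queyranne DAG\<close>

definition pos_arcs :: "'a network \<Rightarrow> ('a \<times> 'a) set" where
  "pos_arcs N = {e\<in>E N. 0 < cap N e}"

text \<open>Off these walks minimum cuts do not determine the residual components: the source and a
  dead end behind it lie in the same minimum cuts but in different components.\<close>

definition on_path :: "'a network \<Rightarrow> 'a \<Rightarrow> bool" where
  "on_path N x \<longleftrightarrow> (src N, x) \<in> (pos_arcs N)\<^sup>* \<and> (x, snk N) \<in> (pos_arcs N)\<^sup>*"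

lemma rtrancl_closed:
  assumes "(x, y) \<in> r\<^sup>*" "x \<in> X" "\<And>a b. (a, b) \<in> r \<Longrightarrow> a \<in> X \<Longrightarrow> b \<in> X"
  shows "y \<in> X"
  using assms(1,2) by (induction rule: rtrancl_induct) (auto intro: assms(3))

section \<open>Reachability in the residual graph\<close>

context tight_flow
begin

abbreviation R :: "('a \<times> 'a) set" where "R \<equiv> parcs (residual N f)"

lemma R_iff: "(x, y) \<in> R \<longleftrightarrow> (x, y) \<in> E N \<and> f (x, y) < cap N (x, y) \<or> (y, x) \<in> E N \<and> 0 < f (y, x)"
  by (simp add: residual_def)

lemma R_V: "(x, y) \<in> R \<Longrightarrow> x \<in> V N \<and> y \<in> V N"
  using arc_ends by (auto simp: R_iff)

lemma R_star_V: "(x, y) \<in> R\<^sup>* \<Longrightarrow> x \<in> V N \<Longrightarrow> y \<in> V N"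
  by (erule rtrancl_closed) (auto dest: R_V)

lemma mincut_iff_closed:
  assumes "st_cut N X"
  shows "st_mincut N X \<longleftrightarrow> (\<forall>x y. (x, y) \<in> R \<longrightarrow> x \<in> X \<longrightarrow> y \<in> X)"
proof -
  have "st_mincut N X \<longleftrightarrow> net_out N f (src N) = cut_cap N X"
    using assms value_eq by (auto simp: st_mincut_iff)
  also have "\<dots> \<longleftrightarrow> (\<forall>e\<in>E N. (fst e \<in> X \<and> snd e \<notin> X \<longrightarrow> \<not> f e < cap N e) \<and> (fst e \<notin> X \<and> snd e \<in> X \<longrightarrow> \<not> 0 < f e))"
    unfolding value_eq_cut_iff[OF assms] using f_bounds by (intro ball_cong refl) force
  also have "\<dots> \<longleftrightarrow> (\<forall>x y. (x, y) \<in> R \<longrightarrow> x \<in> X \<longrightarrow> y \<in> X)"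
  proof
    assume *: "\<forall>e\<in>E N. (fst e \<in> X \<and> snd e \<notin> X \<longrightarrow> \<not> f e < cap N e) \<and> (fst e \<notin> X \<and> snd e \<in> X \<longrightarrow> \<not> 0 < f e)"
    show "\<forall>x y. (x, y) \<in> R \<longrightarrow> x \<in> X \<longrightarrow> y \<in> X"
      using bspec[OF *, of "(x, y)" for x y] unfolding R_iff by fastforce
  next
    assume *: "\<forall>x y. (x, y) \<in> R \<longrightarrow> x \<in> X \<longrightarrow> y \<in> X"
    show "\<forall>e\<in>E N. (fst e \<in> X \<and> snd e \<notin> X \<longrightarrow> \<not> f e < cap N e) \<and> (fst e \<notin> X \<and> snd e \<in> X \<longrightarrow> \<not> 0 < f e)"
    proof
      fix e assume "e \<in> E N"
      then show "(fst e \<in> X \<and> snd e \<notin> X \<longrightarrow> \<not> f e < cap N e) \<and> (fst e \<notin> X \<and> snd e \<in> X \<longrightarrow> \<not> 0 < f e)"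
        using *[rule_format, of "fst e" "snd e"] *[rule_format, of "snd e" "fst e"]
          R_iff[of "fst e" "snd e"] R_iff[of "snd e" "fst e"]
        unfolding prod.collapse by blast
    qed
  qed
  finally show ?thesis .
qed

lemma mincut_star: "st_mincut N X \<Longrightarrow> (x, y) \<in> R\<^sup>* \<Longrightarrow> x \<in> X \<Longrightarrow> y \<in> X"
  using mincut_iff_closed[of X] by (auto simp: st_mincut_iff intro: rtrancl_closed)

lemma src_not_snk: "(src N, snk N) \<notin> R\<^sup>*"
proof -
  obtain X where "st_mincut N X" using ex_mincut by auto
  then show ?thesis using mincut_star[of X "src N" "snk N"] by (auto simp: st_mincut_iff st_cut_def)
qed

lemma mincut_reach:
  assumes "a \<in> V N" "(a, snk N) \<notin> R\<^sup>*"
  shows "st_mincut N {y. (src N, y) \<in> R\<^sup>* \<or> (a, y) \<in> R\<^sup>*}"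
proof -
  have "st_cut N {y. (src N, y) \<in> R\<^sup>* \<or> (a, y) \<in> R\<^sup>*}"
    using assms src_not_snk R_star_V src_V by (auto simp: st_cut_def)
  then show ?thesis by (subst mincut_iff_closed) (auto intro: rtrancl_into_rtrancl)
qed

lemma mincut_src_reach: "st_mincut N {y. (src N, y) \<in> R\<^sup>*}"
  using mincut_reach[OF src_V src_not_snk] by simp

lemma in_mincut_iff: "a \<in> V N \<Longrightarrow> (\<exists>X. st_mincut N X \<and> a \<in> X) \<longleftrightarrow> (a, snk N) \<notin> R\<^sup>*"
  using mincut_reach[of a] mincut_star[of _ a "snk N"] by (auto simp: st_mincut_iff st_cut_def)

lemma in_all_mincuts_iff: "(\<forall>X. st_mincut N X \<longrightarrow> b \<in> X) \<longleftrightarrow> (src N, b) \<in> R\<^sup>*"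
  using mincut_src_reach mincut_star[of _ "src N" b] by (auto simp: st_mincut_iff st_cut_def)

lemma pos_flow: "e \<in> E N \<Longrightarrow> 0 < f e \<Longrightarrow> e \<in> pos_arcs N"
  using f_bounds[of e] by (auto simp: pos_arcs_def)

lemma support_star_pos: "(x, y) \<in> {e\<in>E N. 0 < f e}\<^sup>* \<Longrightarrow> (x, y) \<in> (pos_arcs N)\<^sup>*"
  by (erule rtrancl_mono[THEN subsetD, rotated]) (auto intro: pos_flow)

lemma support_star_R: "(x, y) \<in> {e\<in>E N. 0 < f e}\<^sup>* \<Longrightarrow> (y, x) \<in> R\<^sup>*"
  by (induction rule: rtrancl_induct) (auto simp: R_iff intro: converse_rtrancl_into_rtrancl)

lemma flow_on_path:
  assumes "(a, b) \<in> E N" "0 < f (a, b)"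
  shows "on_path N a" "on_path N b"
  using f_from_src[OF assms] f_to_snk[OF assms] pos_flow[OF assms(1)] assms(2)
  by (auto simp: on_path_def dest!: support_star_pos
      intro: rtrancl_into_rtrancl converse_rtrancl_into_rtrancl)

lemma mincut_pos:
  assumes "on_path N x"
  shows "0 < mincut_cap N"
proof (rule ccontr)
  assume "\<not> 0 < mincut_cap N"
  then have z: "mincut_cap N = 0" using mincut_cap_nonneg by simp
  obtain X where X: "st_mincut N X" using ex_mincut by auto
  then have "cut_cap N X = 0" using z by (simp add: st_mincut_iff)
  then have "\<forall>e\<in>{e\<in>E N. fst e \<in> X \<and> snd e \<notin> X}. cap N e = 0"
    unfolding cut_cap_def using finite_E cap_nonneg by (subst (asm) sum_nonneg_eq_0_iff) auto
  then have "\<And>a b. (a, b) \<in> pos_arcs N \<Longrightarrow> a \<in> X \<Longrightarrow> b \<in> X"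
    by (force simp: pos_arcs_def)
  moreover have "(src N, snk N) \<in> (pos_arcs N)\<^sup>*" using assms by (auto simp: on_path_def)
  ultimately have "snk N \<in> X" using X rtrancl_closed[of "src N" "snk N"] by (auto simp: st_mincut_iff st_cut_def)
  then show False using X by (auto simp: st_mincut_iff st_cut_def)
qed

text \<open>Positive value forces a flow-carrying arc out of the source. Its flow goes on to the
  sink, and flow-carrying arcs are residual backwards.\<close>

lemma snk_src:
  assumes "0 < mincut_cap N"
  shows "(snk N, src N) \<in> R\<^sup>*"
proof -
  have "\<exists>e\<in>E N. fst e = src N \<and> 0 < f e"
  proof (rule ccontr)
    assume "\<not> ?thesis"
    then have "net_out N f (src N) \<le> 0"
      unfolding net_out_eq using f_bounds by (intro sum_nonpos) auto
    then show False using assms value_eq by simp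
  qed
  then obtain b where "(src N, b) \<in> E N" "0 < f (src N, b)" by auto
  then show ?thesis
    using f_to_snk[of "src N" b] by (auto intro!: support_star_R intro: converse_rtrancl_into_rtrancl)
qed

text \<open>Follow positive arcs to the sink and return from there. If a saturated arc blocks the
  way, its tail receives flow from the source, or is the source, and can go back directly.\<close>

lemma reach_src:
  assumes "0 < mincut_cap N" "(y, snk N) \<in> (pos_arcs N)\<^sup>*"
  shows "(y, src N) \<in> R\<^sup>*"
  using assms(2)
proof (induction rule: converse_rtrancl_induct)
  case base
  then show ?case by (rule snk_src[OF assms(1)])
next
  case (step y z)
  then have e: "(y, z) \<in> E N" "0 < cap N (y, z)" by (auto simp: pos_arcs_def)
  show ?case
  proof (cases "f (y, z) < cap N (y, z)")
    case True
    then have "(y, z) \<in> R" using e by (auto simp: R_iff)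
    then show ?thesis using step.IH by (rule converse_rtrancl_into_rtrancl)
  next
    case False
    then have "0 < f (y, z)" using e(2) by simp
    then show ?thesis using f_from_src[OF e(1)] support_star_R by auto
  qed
qed

lemma snk_reach:
  assumes "0 < mincut_cap N" "(src N, x) \<in> (pos_arcs N)\<^sup>*"
  shows "(snk N, x) \<in> R\<^sup>*"
  using assms(2)
proof (induction rule: rtrancl_induct)
  case base
  then show ?case by (rule snk_src[OF assms(1)])
next
  case (step y z)
  then have e: "(y, z) \<in> E N" "0 < cap N (y, z)" by (auto simp: pos_arcs_def)
  show ?case
  proof (cases "f (y, z) < cap N (y, z)")
    case True
    then have "(y, z) \<in> R" using e by (auto simp: R_iff)
    then show ?thesis using step.IH by (rule rtrancl_into_rtrancl[rotated])
  next
    case False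
    then have "0 < f (y, z)" using e(2) by simp
    then show ?thesis using f_to_snk[OF e(1)] support_star_R by auto
  qed
qed

text \<open>What \<open>x\<close> and the source reach together is a minimum cut, unless
  \<open>x\<close> reaches the sink. As \<open>x\<close> reaches the source anyway, \<open>y\<close>
  lying in this cut means that \<open>x\<close> reaches \<open>y\<close>. In the other case the sink
  reaches \<open>y\<close>.\<close>

lemma unseparated_reach:
  assumes "on_path N x" "on_path N y" "x \<in> V N"
    and "\<And>X. st_mincut N X \<Longrightarrow> x \<in> X \<Longrightarrow> y \<in> X"
  shows "(x, y) \<in> R\<^sup>*"
proof (cases "(x, snk N) \<in> R\<^sup>*")
  case True
  moreover have "(snk N, y) \<in> R\<^sup>*"
    using snk_reach[OF mincut_pos[OF assms(1)]] assms(2) by (auto simp: on_path_def)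
  ultimately show ?thesis by (rule rtrancl_trans)
next
  case False
  have "(x, src N) \<in> R\<^sup>*"
    using reach_src[OF mincut_pos[OF assms(1)]] assms(1) by (auto simp: on_path_def)
  then show ?thesis using assms(4)[OF mincut_reach[OF assms(3) False]] by auto
qed

text \<open>Flow-carrying arcs have both ends on source-sink walks. From a vertex that cannot reach
  the sink, a residual walk therefore uses only positive arcs, and its vertices still cannot reach
  the sink. If the source does not reach the vertex, the same argument runs backwards.\<close>

lemma junk_scc:
  assumes "\<not> on_path N x"
  shows "(x, y) \<in> R\<^sup>* \<and> (y, x) \<in> R\<^sup>* \<longleftrightarrow> (x, y) \<in> (pos_arcs N)\<^sup>* \<and> (y, x) \<in> (pos_arcs N)\<^sup>*"
proof
  assume xy: "(x, y) \<in> R\<^sup>* \<and> (y, x) \<in> R\<^sup>*"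
  let ?P = "pos_arcs N"
  have fwd: "(a, z) \<in> ?P\<^sup>* \<and> (z, snk N) \<notin> ?P\<^sup>*" if "(a, z) \<in> R\<^sup>*" "(a, snk N) \<notin> ?P\<^sup>*" for a z
    using that(1)
  proof (induction rule: rtrancl_induct)
    case (step p q)
    then have "\<not> on_path N p" by (auto simp: on_path_def)
    then have "(p, q) \<in> E N" "f (p, q) < cap N (p, q)"
      using step.hyps(2) flow_on_path[of q p] by (auto simp: R_iff)
    then have "(p, q) \<in> ?P" using f_bounds[of "(p, q)"] by (auto simp: pos_arcs_def)
    then show ?case using step.IH by (auto intro: rtrancl_into_rtrancl converse_rtrancl_into_rtrancl)
  qed (use that in auto)
  have bwd: "(z, a) \<in> ?P\<^sup>* \<and> (src N, z) \<notin> ?P\<^sup>*" if "(z, a) \<in> R\<^sup>*" "(src N, a) \<notin> ?P\<^sup>*" for a z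
    using that(1)
  proof (induction rule: converse_rtrancl_induct)
    case (step p q)
    then have "\<not> on_path N q" by (auto simp: on_path_def)
    then have "(p, q) \<in> E N" "f (p, q) < cap N (p, q)"
      using step.hyps(1) flow_on_path[of q p] by (auto simp: R_iff)
    then have "(p, q) \<in> ?P" using f_bounds[of "(p, q)"] by (auto simp: pos_arcs_def)
    then show ?case using step.IH by (auto intro: rtrancl_into_rtrancl converse_rtrancl_into_rtrancl)
  qed (use that in auto)
  show "(x, y) \<in> ?P\<^sup>* \<and> (y, x) \<in> ?P\<^sup>*"
  proof (cases "(x, snk N) \<in> ?P\<^sup>*")
    case True
    then have "(src N, x) \<notin> ?P\<^sup>*" using assms by (auto simp: on_path_def)
    then show ?thesis using bwd[of y x] bwd[of x y] xy by auto
  next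
    case False
    then show ?thesis using fwd[of x y] fwd[of y x] xy by auto
  qed
next
  assume xy: "(x, y) \<in> (pos_arcs N)\<^sup>* \<and> (y, x) \<in> (pos_arcs N)\<^sup>*"
  have imp: "(x', z) \<in> R\<^sup>*" if "(x', z) \<in> (pos_arcs N)\<^sup>*" "(z, x') \<in> (pos_arcs N)\<^sup>*" "\<not> on_path N x'" for x' z
    using that(1,2)
  proof (induction rule: rtrancl_induct)
    case (step p q)
    have px: "(p, x') \<in> (pos_arcs N)\<^sup>*"
      using step.hyps(2) step.prems by (rule converse_rtrancl_into_rtrancl)
    have "\<not> on_path N p"
      using that(3) px step.hyps(1) by (auto simp: on_path_def intro: rtrancl_trans)
    then have "\<not> 0 < f (p, q)" "(p, q) \<in> E N" "0 < cap N (p, q)"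
      using step.hyps(2) flow_on_path(1)[of p q] by (auto simp: pos_arcs_def)
    then have "(p, q) \<in> R" by (auto simp: R_iff)
    then show ?case using step.IH[OF px] by (rule rtrancl_into_rtrancl[rotated])
  qed auto
  have "\<not> on_path N y" using assms xy by (auto simp: on_path_def intro: rtrancl_trans)
  then show "(x, y) \<in> R\<^sup>* \<and> (y, x) \<in> R\<^sup>*" using imp[of x y] imp[of y x] xy assms by auto
qed

end

subsection \<open>Labellings that describe the DAG\<close>

text \<open>\<open>cl\<close> orders the classes of vertices that no minimum cut separates; \<open>jl\<close> tells apart the
  strongly connected components among the vertices that lie on no path from source to sink.\<close>

definition good_labels :: "'a network \<Rightarrow> ('a \<Rightarrow> nat) \<Rightarrow> ('a \<Rightarrow> nat) \<Rightarrow> bool" where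
  "good_labels N cl jl \<longleftrightarrow>
     (\<forall>x\<in>V N. \<forall>y\<in>V N. cl x < cl y \<longrightarrow> (\<exists>X. st_mincut N X \<and> x \<in> X \<and> y \<notin> X)) \<and>
     (\<forall>x\<in>V N. \<forall>y\<in>V N. on_path N x \<longrightarrow> on_path N y \<longrightarrow> cl x = cl y \<longrightarrow>
        (\<forall>X. st_mincut N X \<longrightarrow> (x \<in> X \<longleftrightarrow> y \<in> X))) \<and>
     (\<forall>x\<in>V N. \<forall>y\<in>V N. jl x = jl y \<longleftrightarrow> on_path N x \<and> on_path N y \<or>
        \<not> on_path N x \<and> \<not> on_path N y \<and> (x, y) \<in> (pos_arcs N)\<^sup>* \<and> (y, x) \<in> (pos_arcs N)\<^sup>*) \<and>
     ((\<forall>a\<in>V N. cl a = cl (snk N) \<longrightarrow> (\<forall>X. st_mincut N X \<longrightarrow> a \<notin> X)) \<or>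
      (\<forall>b\<in>V N. cl b = cl (src N) \<longrightarrow> (\<forall>X. st_mincut N X \<longrightarrow> b \<in> X)))"

text \<open>A tail ranked below the head means that the arc leaves some minimum cut; it is then
  saturated, and only its reverse is residual.\<close>

definition orient :: "('a \<Rightarrow> nat) \<Rightarrow> 'a \<times> 'a \<Rightarrow> 'a \<times> 'a" where
  "orient cl e = (if cl (fst e) < cl (snd e) then (snd e, fst e) else e)"

text \<open>There are always three pairs, so that their total number can be written before them; the
  filler \<open>(snk N, src N)\<close> stands for an edge that the DAG has anyway. The second and
  third pair attach the tail to the sink's node and the head to the source's node, so that a set of
  nodes left by the arc is not 1-transversal.\<close>

definition emitted_arcs :: "'a network \<Rightarrow> ('a \<Rightarrow> nat) \<Rightarrow> ('a \<Rightarrow> nat) \<Rightarrow> 'a \<times> 'a \<Rightarrow> ('a \<times> 'a) list" where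
  "emitted_arcs N cl jl e = (let (a, b) = orient cl e in
     [if cl a = cl b \<and> jl a = jl b then (snk N, src N) else (a, b),
      if cl a < cl (snk N) then (snk N, a) else (snk N, src N),
      if cl (src N) < cl b then (b, src N) else (snk N, src N)])"

definition label_node :: "'a network \<Rightarrow> ('a \<Rightarrow> nat) \<Rightarrow> ('a \<Rightarrow> nat) \<Rightarrow> 'a \<Rightarrow> 'a set" where
  "label_node N cl jl x = {y\<in>V N. cl y = cl x \<and> jl y = jl x}"

text \<open>A cycle through a new arc would have to leave \<open>Z\<close> again, and no arc
  does.\<close>

lemma acyclic_add_entering:
  assumes "acyclic r" "r `` Z \<subseteq> Z" "r' \<subseteq> (- Z) \<times> Z"
  shows "acyclic (r \<union> r')"
proof (rule acyclicI, rule allI, rule notI)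
  fix x assume "(x, x) \<in> (r \<union> r')\<^sup>+"
  moreover have "(x, y) \<in> r\<^sup>+ \<and> (x \<in> Z \<longrightarrow> y \<in> Z)" if "(x, y) \<in> (r \<union> r')\<^sup>+" "x \<in> Z \<or> y \<notin> Z" for x y
    using that
  proof (induction rule: trancl_induct)
    case (base y)
    then show ?case using assms(2,3) by auto
  next
    case (step y z)
    then have "(y, z) \<in> r" using assms(3) by auto
    then show ?case using step assms(2) by (auto intro: trancl_into_trancl)
  qed
  ultimately show False using assms(1) by (auto simp: acyclic_def)
qed

lemma (in pair_wf_digraph) reachable_iff_rtrancl:
  assumes "u \<in> pverts G"
  shows "u \<rightarrow>\<^sup>*\<^bsub>with_proj G\<^esub> v \<longleftrightarrow> (u, v) \<in> (parcs G)\<^sup>*"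
proof
  show "u \<rightarrow>\<^sup>*\<^bsub>with_proj G\<^esub> v \<Longrightarrow> (u, v) \<in> (parcs G)\<^sup>*"
    by (drule reachable_rtranclI) simp
  assume "(u, v) \<in> (parcs G)\<^sup>*"
  then show "u \<rightarrow>\<^sup>*\<^bsub>with_proj G\<^esub> v"
  proof (induction rule: rtrancl_induct)
    case base
    then show ?case using assms by simp
  next
    case (step y z)
    then show ?case using reachable_adj_trans by simp
  qed
qed

section \<open>Walks in acyclic graphs and 1-transversal sets of nodes\<close>

context pair_wf_digraph
begin

lemma awalk_arc_reach: "awalk X p Y \<Longrightarrow> a \<in> set p \<Longrightarrow> (X, fst a) \<in> (parcs G)\<^sup>* \<and> (snd a, Y) \<in> (parcs G)\<^sup>*"
proof (induction p arbitrary: X)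
  case (Cons b p)
  then have b: "b \<in> parcs G" "X = fst b" "awalk (snd b) p Y" by (auto simp: awalk_Cons_iff)
  have "snd b \<rightarrow>\<^sup>*\<^bsub>with_proj G\<^esub> Y" using b(3) unfolding reachable_awalk by (rule exI)
  from reachable_rtranclI[OF this] have bY: "(snd b, Y) \<in> (parcs G)\<^sup>*" by simp
  have Xb: "(X, snd b) \<in> parcs G" using b(1,2) by simp
  show ?case
  proof (cases "a = b")
    case True
    then show ?thesis using b(2) bY by simp
  next
    case False
    then have "(snd b, fst a) \<in> (parcs G)\<^sup>*" "(snd a, Y) \<in> (parcs G)\<^sup>*"
      using Cons.IH[OF b(3)] Cons.prems(2) by auto
    then show ?thesis using converse_rtrancl_into_rtrancl[OF Xb] by simp
  qed
qed simp

lemma acyclic_awalk_apath: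
  assumes "acyclic (parcs G)" "awalk X p Y"
  shows "apath X p Y"
  using assms(2)
proof (induction p arbitrary: X)
  case Nil
  then show ?case by (auto simp: awalk_Nil_iff apath_Nil_iff)
next
  case (Cons b p)
  then have b: "b \<in> parcs G" "X = fst b" "awalk (snd b) p Y" by (auto simp: awalk_Cons_iff)
  have "fst b \<notin> set (pawalk_verts (snd b) p)"
  proof
    assume "fst b \<in> set (pawalk_verts (snd b) p)"
    then have "snd b \<rightarrow>\<^sup>*\<^bsub>with_proj G\<^esub> fst b" using b(3) awalk_verts_reachable_from by simp
    from reachable_rtranclI[OF this] have "(snd b, fst b) \<in> (parcs G)\<^sup>*" by simp
    moreover have "(fst b, snd b) \<in> parcs G" using b(1) by simp
    ultimately have "(fst b, fst b) \<in> (parcs G)\<^sup>+" by (meson rtrancl_into_trancl2)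
    then show False using assms(1) by (auto simp: acyclic_def)
  qed
  then show ?case using Cons.IH[OF b(3)] b by (simp add: apath_Cons_iff)
qed

lemma awalk_cut_edge:
  "awalk X p Y \<Longrightarrow> (X \<in> U) \<noteq> (Y \<in> U) \<Longrightarrow> \<exists>a\<in>set p. a \<in> cut_edges G U"
proof (induction p arbitrary: X)
  case (Cons b p)
  then have b: "b \<in> parcs G" "X = fst b" "awalk (snd b) p Y" by (auto simp: awalk_Cons_iff)
  then show ?case using Cons.IH[OF b(3)] Cons.prems(2) by (cases "(snd b \<in> U) = (X \<in> U)") (auto simp: cut_edges_def)
qed (auto simp: awalk_Nil_iff)

text \<open>Each half of the walk contains a cut edge, and a common one would close a cycle. In an
  acyclic graph the whole walk is a simple path, so it meets the cut twice.\<close>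

lemma one_transversal_not_back:
  assumes "acyclic (parcs G)" "one_transversal G U"
    and "X \<in> pverts G" "(X, Y) \<in> (parcs G)\<^sup>*" "(Y, Z) \<in> (parcs G)\<^sup>*"
    and "(X \<in> U) \<noteq> (Y \<in> U)" "(Y \<in> U) \<noteq> (Z \<in> U)"
  shows False
proof -
  have XY: "X \<rightarrow>\<^sup>*\<^bsub>with_proj G\<^esub> Y" using assms(3,4) reachable_iff_rtrancl by simp
  then have "Y \<in> pverts G" using reachable_in_verts by simp
  then have YZ: "Y \<rightarrow>\<^sup>*\<^bsub>with_proj G\<^esub> Z" using assms(5) reachable_iff_rtrancl by simp
  obtain p where p: "awalk X p Y" using XY unfolding reachable_awalk by (rule exE)
  obtain q where q: "awalk Y q Z" using YZ unfolding reachable_awalk by (rule exE)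
  note pq = p q
  obtain a b where ab: "a \<in> set p" "a \<in> cut_edges G U" "b \<in> set q" "b \<in> cut_edges G U"
    using awalk_cut_edge[OF pq(1) assms(6)] awalk_cut_edge[OF pq(2) assms(7)] by (elim bexE) (rule that)
  have "a \<noteq> b"
  proof
    assume "a = b"
    then have "(snd a, fst a) \<in> (parcs G)\<^sup>*"
      using awalk_arc_reach[OF pq(1) ab(1)] awalk_arc_reach[OF pq(2) ab(3)] by (auto intro: rtrancl_trans)
    moreover have "(fst a, snd a) \<in> parcs G" using ab(2) by (auto simp: cut_edges_def)
    ultimately have "(fst a, fst a) \<in> (parcs G)\<^sup>+" by (meson rtrancl_into_trancl2)
    then show False using assms(1) by (auto simp: acyclic_def)
  qed
  moreover have "apath X (p @ q) Z"
    using acyclic_awalk_apath[OF assms(1) awalk_appendI[OF pq]] .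
  then have "card (set (p @ q) \<inter> cut_edges G U) \<le> 1"
    using assms(2) unfolding one_transversal_def by blast
  moreover have "card {a, b} \<le> card (set (p @ q) \<inter> cut_edges G U)"
    using ab by (intro card_mono) auto
  ultimately show False by simp
qed

text \<open>A path that has entered a closed set never leaves it.\<close>

lemma one_transversal_closed:
  assumes "\<And>X Y. (X, Y) \<in> parcs G \<Longrightarrow> X \<in> U \<Longrightarrow> Y \<in> U"
  shows "one_transversal G U"
proof -
  have "card (set p \<inter> cut_edges G U) \<le> 1 \<and> (X \<in> U \<longrightarrow> set p \<inter> cut_edges G U = {})" if "awalk X p Y" for X p Y
    using that
  proof (induction p arbitrary: X)
    case (Cons b p)
    then have b: "b \<in> parcs G" "X = fst b" "awalk (snd b) p Y" by (auto simp: awalk_Cons_iff)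
    note IH = Cons.IH[OF b(3)]
    show ?case
    proof (cases "b \<in> cut_edges G U")
      case True
      then have "fst b \<notin> U" "snd b \<in> U" using assms[of "fst b" "snd b"] b(1) by (auto simp: cut_edges_def)
      then have "set (b # p) \<inter> cut_edges G U = {b}" using IH True by auto
      then show ?thesis using \<open>fst b \<notin> U\<close> b(2) by simp
    next
      case False
      then have "set (b # p) \<inter> cut_edges G U = set p \<inter> cut_edges G U" by auto
      then show ?thesis using IH assms[of "fst b" "snd b"] b(1,2) by simp
    qed
  qed simp
  then show ?thesis unfolding one_transversal_def by (auto dest: awalkI_apath)
qed

end

definition label_dag :: "'a network \<Rightarrow> ('a \<Rightarrow> nat) \<Rightarrow> ('a \<Rightarrow> nat) \<Rightarrow> 'a set pair_pre_digraph" where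
  "label_dag N cl jl =
     \<lparr>pverts = label_node N cl jl ` V N,
      parcs = (\<lambda>(x, y). (label_node N cl jl x, label_node N cl jl y)) `
        (insert (snk N, src N) (\<Union>e\<in>pos_arcs N. set (emitted_arcs N cl jl e)))\<rparr>"

section \<open>The labelled graph is a Picard--Queyranne DAG\<close>

locale good_tight_flow = tight_flow +
  fixes cl jl :: "'a \<Rightarrow> nat"
  assumes good: "good_labels N cl jl"
begin

abbreviation "node \<equiv> label_node N cl jl"

lemma cl_less: "x \<in> V N \<Longrightarrow> y \<in> V N \<Longrightarrow> cl x < cl y \<Longrightarrow> \<exists>X. st_mincut N X \<and> x \<in> X \<and> y \<notin> X"
  using good unfolding good_labels_def by simp

lemma jl_eq_iff: "x \<in> V N \<Longrightarrow> y \<in> V N \<Longrightarrow> jl x = jl y \<longleftrightarrow> on_path N x \<and> on_path N y \<or>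
    \<not> on_path N x \<and> \<not> on_path N y \<and> (x, y) \<in> (pos_arcs N)\<^sup>* \<and> (y, x) \<in> (pos_arcs N)\<^sup>*"
  using good unfolding good_labels_def by simp

lemma cl_eqD: "x \<in> V N \<Longrightarrow> y \<in> V N \<Longrightarrow> on_path N x \<Longrightarrow> on_path N y \<Longrightarrow> cl x = cl y \<Longrightarrow>
    st_mincut N X \<Longrightarrow> x \<in> X \<longleftrightarrow> y \<in> X"
  using good[unfolded good_labels_def, THEN conjunct2, THEN conjunct1] by blast

text \<open>Minimum cuts are closed under residual arcs, so they do not separate a component, and a
  difference of ranks would mean separation. Conversely, equal labels give mutual reachability by
  \<open>unseparated_reach\<close> on source-sink walks and by \<open>junk_scc\<close> off
  them.\<close>

lemma scc_iff:
  assumes "x \<in> V N" "y \<in> V N"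
  shows "(x, y) \<in> R\<^sup>* \<and> (y, x) \<in> R\<^sup>* \<longleftrightarrow> cl x = cl y \<and> jl x = jl y"
proof
  assume xy: "(x, y) \<in> R\<^sup>* \<and> (y, x) \<in> R\<^sup>*"
  then have "x \<in> X \<longleftrightarrow> y \<in> X" if "st_mincut N X" for X using mincut_star[OF that] by auto
  then have "cl x = cl y" using cl_less assms by (meson linorder_neqE_nat)
  moreover have "jl x = jl y"
  proof (cases "on_path N x \<and> on_path N y")
    case False
    have J: "\<not> on_path N y" if "\<not> on_path N x" "(x, y) \<in> R\<^sup>*" "(y, x) \<in> R\<^sup>*" for x y
    proof
      assume y: "on_path N y"
      have xy: "(x, y) \<in> (pos_arcs N)\<^sup>*" "(y, x) \<in> (pos_arcs N)\<^sup>*" using junk_scc[OF that(1), of y] that(2,3) by auto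
      have "on_path N x"
        unfolding on_path_def using rtrancl_trans[OF conjunct1[OF y[unfolded on_path_def]] xy(2)]
          rtrancl_trans[OF xy(1) conjunct2[OF y[unfolded on_path_def]]] by (rule conjI)
      then show False using that(1) by simp
    qed
    then have "\<not> on_path N x" "\<not> on_path N y" using False xy by auto
    then show ?thesis using junk_scc[of x y] xy jl_eq_iff[OF assms] by simp
  qed (use jl_eq_iff[OF assms] in simp)
  ultimately show "cl x = cl y \<and> jl x = jl y" by simp
next
  assume eq: "cl x = cl y \<and> jl x = jl y"
  then have "on_path N x \<and> on_path N y \<or>
    \<not> on_path N x \<and> \<not> on_path N y \<and> (x, y) \<in> (pos_arcs N)\<^sup>* \<and> (y, x) \<in> (pos_arcs N)\<^sup>*"
    using jl_eq_iff[OF assms] by simp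
  then show "(x, y) \<in> R\<^sup>* \<and> (y, x) \<in> R\<^sup>*"
  proof
    assume *: "on_path N x \<and> on_path N y"
    have sep: "x \<in> X \<longleftrightarrow> y \<in> X" if "st_mincut N X" for X
      using cl_eqD[OF assms _ _ _ that] * eq by blast
    have "(x, y) \<in> R\<^sup>*" by (rule unseparated_reach) (use * assms sep in blast)+
    moreover have "(y, x) \<in> R\<^sup>*" by (rule unseparated_reach) (use * assms sep in blast)+
    ultimately show ?thesis ..
  next
    assume "\<not> on_path N x \<and> \<not> on_path N y \<and> (x, y) \<in> (pos_arcs N)\<^sup>* \<and> (y, x) \<in> (pos_arcs N)\<^sup>*"
    then show ?thesis using junk_scc[of x y] by simp
  qed
qed

lemma node_eq_iff: "x \<in> V N \<Longrightarrow> node x = node y \<longleftrightarrow> cl x = cl y \<and> jl x = jl y"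
  unfolding label_node_def by auto

lemma node_eq_iff_scc: "x \<in> V N \<Longrightarrow> y \<in> V N \<Longrightarrow> node x = node y \<longleftrightarrow> (x, y) \<in> R\<^sup>* \<and> (y, x) \<in> R\<^sup>*"
  using scc_iff node_eq_iff by simp

lemma in_node_iff: "y \<in> node x \<longleftrightarrow> y \<in> V N \<and> node y = node x"
  unfolding label_node_def by auto

lemma residual_wf: "pair_wf_digraph (residual N f)"
  by unfold_locales (auto simp: residual_def dest: arc_ends)

lemma sccs_residual: "pre_digraph.sccs_verts (with_proj (residual N f)) = node ` V N"
proof -
  interpret RG: pair_wf_digraph "residual N f" by (rule residual_wf)
  have vV [simp]: "pverts (residual N f) = V N" by (simp add: residual_def)
  have reach: "u \<rightarrow>\<^sup>*\<^bsub>with_proj (residual N f)\<^esub> v \<longleftrightarrow> u \<in> V N \<and> (u, v) \<in> R\<^sup>*" for u v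
  proof (cases "u \<in> V N")
    case True
    then show ?thesis using RG.reachable_iff_rtrancl[of u v] by simp
  next
    case False
    then show ?thesis using RG.reachable_in_verts(1)[of u v] by auto
  qed
  show ?thesis
  proof (intro set_eqI iffI)
    fix S assume "S \<in> pre_digraph.sccs_verts (with_proj (residual N f))"
    then have S: "S \<noteq> {}" "\<And>u v. u \<in> S \<Longrightarrow> v \<in> S \<Longrightarrow> u \<in> V N \<and> (u, v) \<in> R\<^sup>*"
      "\<And>u v. u \<in> S \<Longrightarrow> v \<notin> S \<Longrightarrow> \<not> (u \<in> V N \<and> (u, v) \<in> R\<^sup>*) \<or> \<not> (v \<in> V N \<and> (v, u) \<in> R\<^sup>*)"
      unfolding pre_digraph.sccs_verts_def reach by auto
    then obtain u where u: "u \<in> S" by auto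
    then have uV: "u \<in> V N" using S(2) by auto
    have "S = node u"
    proof (intro set_eqI iffI)
      fix v assume "v \<in> S"
      then show "v \<in> node u" using S(2)[OF u, of v] S(2)[of v u] u uV node_eq_iff_scc[of u v]
        by (auto simp: in_node_iff)
    next
      fix v assume "v \<in> node u"
      then have "v \<in> V N" "(u, v) \<in> R\<^sup>*" "(v, u) \<in> R\<^sup>*"
        using node_eq_iff_scc[of v u] uV by (auto simp: in_node_iff)
      then show "v \<in> S" using S(3)[OF u, of v] uV by auto
    qed
    then show "S \<in> node ` V N" using uV by auto
  next
    fix S assume "S \<in> node ` V N"
    then obtain u where u: "u \<in> V N" "S = node u" by auto
    have mem: "v \<in> S \<longleftrightarrow> v \<in> V N \<and> (u, v) \<in> R\<^sup>* \<and> (v, u) \<in> R\<^sup>*" for v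
      using u node_eq_iff_scc[of v u] by (auto simp: in_node_iff)
    show "S \<in> pre_digraph.sccs_verts (with_proj (residual N f))"
      unfolding pre_digraph.sccs_verts_def reach mem_Collect_eq
    proof (intro conjI ballI allI impI)
      show "S \<noteq> {}" using mem[of u] u(1) by auto
      fix x assume x: "x \<in> S"
      show "x \<in> V N" using x mem by simp
      show "(x, y) \<in> R\<^sup>*" if "y \<in> S" for y using x that unfolding mem by (meson rtrancl_trans)
      show "\<not> (x \<in> V N \<and> (x, y) \<in> R\<^sup>*) \<or> \<not> (y \<in> V N \<and> (y, x) \<in> R\<^sup>*)" if "y \<notin> S" for y
        using x that unfolding mem by (meson rtrancl_trans)
    qed
  qed
qed

text \<open>A reversed arc is saturated because it leaves a minimum cut. An arc kept in its
  direction cannot be saturated: it would carry flow, so its ends would have equal \<open>jl\<close>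
  and different ranks, and it would enter a minimum cut, which forbids flow.\<close>

lemma orient_R:
  assumes "(x, y) \<in> pos_arcs N" "orient cl (x, y) = (a, b)" "node a \<noteq> node b"
  shows "(a, b) \<in> R"
proof -
  have xy: "(x, y) \<in> E N" "0 < cap N (x, y)" "x \<in> V N" "y \<in> V N"
    using assms(1) arc_ends by (auto simp: pos_arcs_def)
  show ?thesis
  proof (cases "cl x < cl y")
    case True
    then obtain X where "st_mincut N X" "x \<in> X" "y \<notin> X" using cl_less xy by blast
    then have "f (x, y) = cap N (x, y)" using f_leaving[of X "(x, y)"] xy by simp
    then show ?thesis using True assms(2) xy by (auto simp: orient_def R_iff)
  next
    case False
    then have ab: "a = x" "b = y" using assms(2) by (auto simp: orient_def)
    show ?thesis
    proof (rule ccontr)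
      assume "(a, b) \<notin> R"
      then have "f (x, y) = cap N (x, y)" using xy f_bounds[of "(x, y)"] ab by (auto simp: R_iff)
      then have pos: "0 < f (x, y)" using xy by simp
      then have "jl x = jl y" using flow_on_path[OF xy(1)] jl_eq_iff xy by simp
      then have "cl y < cl x" using assms(3) False ab node_eq_iff[of x y] xy by auto
      then obtain X where "st_mincut N X" "y \<in> X" "x \<notin> X" using cl_less xy by blast
      then have "f (x, y) = 0" using f_entering[of X "(x, y)"] xy by simp
      then show False using pos by simp
    qed
  qed
qed

lemma R_orient:
  assumes "(p, q) \<in> R" "node p \<noteq> node q"
  shows "\<exists>e\<in>pos_arcs N. orient cl e = (p, q)"
proof -
  have pq: "p \<in> V N" "q \<in> V N" using R_V[OF assms(1)] by auto
  consider (fwd) "(p, q) \<in> E N" "f (p, q) < cap N (p, q)" | (bwd) "(q, p) \<in> E N" "0 < f (q, p)"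
    using assms(1) by (auto simp: R_iff)
  then show ?thesis
  proof cases
    case fwd
    have "\<not> cl p < cl q"
    proof
      assume "cl p < cl q"
      then obtain X where "st_mincut N X" "p \<in> X" "q \<notin> X" using cl_less pq by blast
      then show False using f_leaving[of X "(p, q)"] fwd by simp
    qed
    then show ?thesis using fwd f_bounds[of "(p, q)"]
      by (intro bexI[of _ "(p, q)"]) (auto simp: orient_def pos_arcs_def)
  next
    case bwd
    have "\<not> cl p < cl q"
    proof
      assume "cl p < cl q"
      then obtain X where "st_mincut N X" "p \<in> X" "q \<notin> X" using cl_less pq by blast
      then show False using f_entering[of X "(q, p)"] bwd by simp
    qed
    moreover have "jl p = jl q" using flow_on_path[OF bwd] jl_eq_iff pq by simp
    ultimately have "cl q < cl p" using assms(2) node_eq_iff[of p q] pq by auto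
    then show ?thesis using bwd pos_flow
      by (intro bexI[of _ "(q, p)"]) (auto simp: orient_def)
  qed
qed

abbreviation "H \<equiv> label_dag N cl jl"

definition res_arcs :: "('a set \<times> 'a set) set" where
  "res_arcs = {(node p, node q) | p q. (p, q) \<in> R \<and> node p \<noteq> node q}"

text \<open>The comparison of ranks ensures that some minimum cut contains \<open>a\<close>, so that
  an edge from the sink's node to that of \<open>a\<close> closes no cycle. Dually for
  \<open>heads\<close>.\<close>

definition tails :: "'a set" where
  "tails = {a. \<exists>e\<in>pos_arcs N. fst (orient cl e) = a \<and> cl a < cl (snk N)}"

definition heads :: "'a set" where
  "heads = {b. \<exists>e\<in>pos_arcs N. snd (orient cl e) = b \<and> cl (src N) < cl b}"

lemma contract_arcs: "parcs (contract_sccs (residual N f)) = res_arcs"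
proof -
  have "(X, Y) \<in> parcs (contract_sccs (residual N f)) \<longleftrightarrow> (X, Y) \<in> res_arcs" for X Y
  proof
    assume "(X, Y) \<in> parcs (contract_sccs (residual N f))"
    then obtain u v x y where "u \<in> V N" "v \<in> V N" "X = node u" "Y = node v" "X \<noteq> Y" "x \<in> X" "y \<in> Y" "(x, y) \<in> R"
      unfolding contract_sccs_def sccs_residual by (simp, blast)
    moreover from this have "X = node x" "Y = node y" by (simp_all add: in_node_iff)
    ultimately show "(X, Y) \<in> res_arcs" unfolding res_arcs_def by blast
  next
    assume "(X, Y) \<in> res_arcs"
    then obtain p q where "(p, q) \<in> R" "node p \<noteq> node q" "X = node p" "Y = node q" unfolding res_arcs_def by auto
    moreover from this have "p \<in> V N" "q \<in> V N" using R_V by auto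
    ultimately show "(X, Y) \<in> parcs (contract_sccs (residual N f))"
      unfolding contract_sccs_def sccs_residual by (auto simp: in_node_iff)
  qed
  then show ?thesis by auto
qed

lemma orient_V:
  assumes "e \<in> pos_arcs N" "orient cl e = (a, b)"
  shows "a \<in> V N" "b \<in> V N"
proof -
  have "fst e \<in> V N" "snd e \<in> V N" using assms(1) arcs_wf by (auto simp: pos_arcs_def)
  then show "a \<in> V N" "b \<in> V N" using assms(2) by (cases e; auto simp: orient_def split: if_splits)+
qed

lemma dag_arcs: "parcs H = insert (node (snk N), node (src N))
    (res_arcs \<union> {(node (snk N), node a) | a. a \<in> tails} \<union> {(node b, node (src N)) | b. b \<in> heads})"
    (is "_ = insert ?ts (_ \<union> ?T \<union> ?S)")
proof (intro equalityI subsetI)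
  fix A assume "A \<in> parcs H"
  then consider "A = ?ts" | e z where "e \<in> pos_arcs N" "z \<in> set (emitted_arcs N cl jl e)" "A = (node (fst z), node (snd z))"
    unfolding label_dag_def by (auto simp: case_prod_beta)
  then show "A \<in> insert ?ts (res_arcs \<union> ?T \<union> ?S)"
  proof cases
    case (2 e z)
    obtain a b where ab: "orient cl e = (a, b)" by (cases "orient cl e")
    note abV = orient_V[OF 2(1) ab]
    consider "z = (snk N, src N)" | "z = (a, b)" "\<not> (cl a = cl b \<and> jl a = jl b)"
      | "z = (snk N, a)" "cl a < cl (snk N)" | "z = (b, src N)" "cl (src N) < cl b"
      using 2(2) unfolding emitted_arcs_def ab by (auto split: if_splits)
    then show ?thesis
    proof cases
      case b: 2
      then have "node a \<noteq> node b" using node_eq_iff abV by simp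
      then have "(a, b) \<in> R" using orient_R[of "fst e" "snd e" a b] 2(1) ab by simp
      then show ?thesis using b \<open>node a \<noteq> node b\<close> 2(3) unfolding res_arcs_def by auto
    next
      case b: 3
      then show ?thesis using 2 ab unfolding tails_def by force
    next
      case b: 4
      then show ?thesis using 2 ab unfolding heads_def by force
    qed (use 2 in simp)
  qed simp
next
  fix A assume A: "A \<in> insert ?ts (res_arcs \<union> ?T \<union> ?S)"
  have I: "(node a, node b) \<in> parcs H" if "e \<in> pos_arcs N" "(a, b) \<in> set (emitted_arcs N cl jl e)" for e a b
    using that unfolding label_dag_def by force
  consider "A = ?ts" | "A \<in> res_arcs" | a where "A = (node (snk N), node a)" "a \<in> tails"
    | b where "A = (node b, node (src N))" "b \<in> heads" using A by auto
  then show "A \<in> parcs H"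
  proof cases
    case 1
    then show ?thesis unfolding label_dag_def by simp
  next
    case 2
    then obtain p q where pq: "(p, q) \<in> R" "node p \<noteq> node q" "A = (node p, node q)" unfolding res_arcs_def by auto
    obtain e where e: "e \<in> pos_arcs N" "orient cl e = (p, q)" using R_orient[OF pq(1,2)] by auto
    have "\<not> (cl p = cl q \<and> jl p = jl q)" using pq(2) node_eq_iff orient_V[OF e] by simp
    then have "(p, q) \<in> set (emitted_arcs N cl jl e)"
      unfolding emitted_arcs_def e(2) Let_def prod.case by (simp only: if_not_P list.set insert_iff simp_thms)
    then show ?thesis using I[OF e(1)] pq(3) by simp
  next
    case (3 a)
    then obtain e where e: "e \<in> pos_arcs N" "fst (orient cl e) = a" "cl a < cl (snk N)" unfolding tails_def by auto
    then have "(snk N, a) \<in> set (emitted_arcs N cl jl e)" unfolding emitted_arcs_def by (simp add: case_prod_beta)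
    then show ?thesis using I[OF e(1)] 3(1) by simp
  next
    case (4 b)
    then obtain e where e: "e \<in> pos_arcs N" "snd (orient cl e) = b" "cl (src N) < cl b" unfolding heads_def by auto
    then have "(b, src N) \<in> set (emitted_arcs N cl jl e)" unfolding emitted_arcs_def by (simp add: case_prod_beta)
    then show ?thesis using I[OF e(1)] 4(1) by simp
  qed
qed

lemma tailsD: "a \<in> tails \<Longrightarrow> a \<in> V N \<and> (a, snk N) \<notin> R\<^sup>*"
proof -
  assume "a \<in> tails"
  then obtain e where e: "e \<in> pos_arcs N" "fst (orient cl e) = a" "cl a < cl (snk N)" unfolding tails_def by auto
  then have aV: "a \<in> V N" using orient_V[OF e(1), of a "snd (orient cl e)"] by auto
  then show ?thesis using cl_less[OF aV snk_V e(3)] in_mincut_iff[OF aV] by auto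
qed

lemma headsD: "b \<in> heads \<Longrightarrow> b \<in> V N \<and> (src N, b) \<notin> R\<^sup>*"
proof -
  assume "b \<in> heads"
  then obtain e where e: "e \<in> pos_arcs N" "snd (orient cl e) = b" "cl (src N) < cl b" unfolding heads_def by auto
  then have bV: "b \<in> V N" using orient_V[OF e(1), of "fst (orient cl e)" b] by auto
  then show ?thesis using cl_less[OF src_V bV e(3)] in_all_mincuts_iff[of b] by auto
qed

lemma res_arcs_star:
  assumes "(P, Q) \<in> res_arcs\<^sup>*" "P = node x" "x \<in> V N" "y \<in> V N" "Q = node y"
  shows "(x, y) \<in> R\<^sup>*"
  using assms(1,4,5)
proof (induction arbitrary: y rule: rtrancl_induct)
  case base
  then show ?case using assms(2,3) node_eq_iff_scc[of x y] by auto
next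
  case (step Q Q')
  then obtain p q where pq: "(p, q) \<in> R" "Q = node p" "Q' = node q" unfolding res_arcs_def by auto
  then have V: "p \<in> V N" "q \<in> V N" using R_V by auto
  have "(x, p) \<in> R\<^sup>*" using step.IH[OF V(1) pq(2)] .
  moreover have "(q, y) \<in> R\<^sup>*" using node_eq_iff_scc[OF V(2) step.prems(1)] step.prems(2) pq(3) by simp
  ultimately show ?case using pq(1) by (meson rtrancl.rtrancl_into_rtrancl rtrancl_trans)
qed

text \<open>The extra edges are added in two rounds: those into the source's node enter the closed
  set of nodes that the source reaches, those out of the sink's node enter the closed set of nodes
  that do not reach the sink.\<close>

lemma acyclic_dag: "acyclic (parcs H)"
proof -
  have 1: "acyclic res_arcs"
  proof (rule acyclicI, rule allI, rule notI)
    fix P assume "(P, P) \<in> res_arcs\<^sup>+"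
    then obtain Q where Q: "(P, Q) \<in> res_arcs" "(Q, P) \<in> res_arcs\<^sup>*" by (meson tranclD)
    then obtain p q where pq: "(p, q) \<in> R" "node p \<noteq> node q" "P = node p" "Q = node q" unfolding res_arcs_def by auto
    then have V: "p \<in> V N" "q \<in> V N" using R_V by auto
    have "(q, p) \<in> R\<^sup>*" using res_arcs_star[OF Q(2) pq(4) V(2) V(1) pq(3)] .
    then show False using node_eq_iff_scc[OF V] pq(1,2) by auto
  qed
  have out: "node x \<in> node ` {y. (src N, y) \<in> R\<^sup>*} \<Longrightarrow> x \<in> V N \<Longrightarrow> (src N, x) \<in> R\<^sup>*" for x
    using node_eq_iff_scc[of x] R_star_V[OF _ src_V] by (auto intro: rtrancl_trans)
  have 2: "acyclic (res_arcs \<union> {(node b, node (src N)) | b. b \<in> heads})"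
  proof (rule acyclic_add_entering[OF 1, of "node ` {y. (src N, y) \<in> R\<^sup>*}"])
    show "res_arcs `` (node ` {y. (src N, y) \<in> R\<^sup>*}) \<subseteq> node ` {y. (src N, y) \<in> R\<^sup>*}"
    proof
      fix Y assume "Y \<in> res_arcs `` (node ` {y. (src N, y) \<in> R\<^sup>*})"
      then obtain p q where pq: "(p, q) \<in> R" "Y = node q" "node p \<in> node ` {y. (src N, y) \<in> R\<^sup>*}"
        unfolding res_arcs_def by blast
      then have "(src N, p) \<in> R\<^sup>*" using out R_V by blast
      then have "(src N, q) \<in> R\<^sup>*" using pq(1) by (rule rtrancl_into_rtrancl)
      then show "Y \<in> node ` {y. (src N, y) \<in> R\<^sup>*}" using pq(2) by simp
    qed
    show "{(node b, node (src N)) | b. b \<in> heads} \<subseteq> (- (node ` {y. (src N, y) \<in> R\<^sup>*})) \<times> node ` {y. (src N, y) \<in> R\<^sup>*}"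
      using out headsD by blast
  qed
  let ?Z = "node ` {y\<in>V N. (y, snk N) \<notin> R\<^sup>*}"
  have inZ: "node x \<in> ?Z \<Longrightarrow> x \<in> V N \<Longrightarrow> (x, snk N) \<notin> R\<^sup>*" for x
    using node_eq_iff_scc[of x] by (auto intro: rtrancl_trans)
  have "acyclic ((res_arcs \<union> {(node b, node (src N)) | b. b \<in> heads}) \<union> ({(node (snk N), node a) | a. a \<in> tails} \<union> {(node (snk N), node (src N))}))"
  proof (rule acyclic_add_entering[OF 2, of ?Z])
    have "(node p, node q) \<in> res_arcs \<Longrightarrow> node p \<in> ?Z \<Longrightarrow> node q \<in> ?Z" for p q
    proof -
      assume "(node p, node q) \<in> res_arcs" "node p \<in> ?Z"
      then obtain p' q' where *: "(p', q') \<in> R" "node p = node p'" "node q = node q'" unfolding res_arcs_def by auto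
      then have V: "p' \<in> V N" "q' \<in> V N" using R_V by auto
      have "(p', snk N) \<notin> R\<^sup>*" using inZ[of p'] \<open>node p \<in> ?Z\<close> * V by simp
      then have "(q', snk N) \<notin> R\<^sup>*" using *(1) by (meson converse_rtrancl_into_rtrancl)
      then show "node q \<in> ?Z" using * V by auto
    qed
    moreover have "node (src N) \<in> ?Z" using src_V src_not_snk by auto
    ultimately show "(res_arcs \<union> {(node b, node (src N)) | b. b \<in> heads}) `` ?Z \<subseteq> ?Z"
      unfolding res_arcs_def by blast
    have "node (snk N) \<notin> ?Z" using inZ[of "snk N"] snk_V by auto
    then show "{(node (snk N), node a) | a. a \<in> tails} \<union> {(node (snk N), node (src N))} \<subseteq> (- ?Z) \<times> ?Z"
      using tailsD \<open>node (src N) \<in> ?Z\<close> by blast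
  qed
  moreover have "parcs H = (res_arcs \<union> {(node b, node (src N)) | b. b \<in> heads}) \<union> ({(node (snk N), node a) | a. a \<in> tails} \<union> {(node (snk N), node (src N))})"
    unfolding dag_arcs by blast
  ultimately show ?thesis by simp
qed

lemma dag_fin: "pair_fin_digraph H"
proof
  have pV: "pverts H = node ` V N" by (simp add: label_dag_def)
  have "(X, Y) \<in> parcs H \<Longrightarrow> X \<in> pverts H \<and> Y \<in> pverts H" for X Y
    unfolding dag_arcs pV res_arcs_def using snk_V src_V tailsD headsD R_V by blast
  then show "e \<in> parcs H \<Longrightarrow> fst e \<in> pverts H" "e \<in> parcs H \<Longrightarrow> snd e \<in> pverts H" for e by (cases e; auto)+
  then have "parcs H \<subseteq> pverts H \<times> pverts H" by (auto simp: mem_Times_iff)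
  moreover show "finite (pverts H)" unfolding pV using finite_V by simp
  ultimately show "finite (parcs H)" by (meson finite_SigmaI finite_subset)
qed

lemma res_arcs_H: "(x, y) \<in> R\<^sup>* \<Longrightarrow> (node x, node y) \<in> (parcs H)\<^sup>*"
proof (induction rule: rtrancl_induct)
  case (step y z)
  show ?case
  proof (cases "node y = node z")
    case False
    then have "(node y, node z) \<in> parcs H" using step(2) unfolding dag_arcs res_arcs_def by auto
    then show ?thesis using step.IH by (rule rtrancl_into_rtrancl[rotated])
  qed (use step in simp)
qed simp

text \<open>Minimum cuts are closed, hence 1-transversal. Conversely, an edge from \<open>x\<close>
  to \<open>y\<close> that leaves a set of nodes is completed by an extra edge: either the sink's
  node comes before \<open>x\<close>, or the source's node after \<open>y\<close>, and the path
  changes sides twice.\<close>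

lemma mincut_iff_dag:
  assumes C: "st_cut N C"
  shows "st_mincut N C \<longleftrightarrow> (\<exists>U. C = \<Union>U \<and> dag_cut N H U \<and> one_transversal H U)"
proof
  interpret G: pair_fin_digraph H by (rule dag_fin)
  assume mc: "st_mincut N C"
  have CV: "C \<subseteq> V N" "src N \<in> C" "snk N \<notin> C" using C by (auto simp: st_cut_def)
  have mem: "node x \<in> node ` C \<longleftrightarrow> x \<in> C" if "x \<in> V N" for x
    using that CV(1) mincut_star[OF mc] node_eq_iff_scc by (auto; blast)
  have "C = \<Union>(node ` C)"
  proof
    show "C \<subseteq> \<Union>(node ` C)" using CV(1) by (auto simp: in_node_iff)
    show "\<Union>(node ` C) \<subseteq> C"
    proof
      fix y assume "y \<in> \<Union>(node ` C)"
      then obtain x where "x \<in> C" "y \<in> V N" "node y = node x" by (auto simp: in_node_iff)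
      then show "y \<in> C" using mem[of y] by auto
    qed
  qed
  moreover from this have "dag_cut N H (node ` C)"
    using CV by (auto simp: dag_cut_def label_dag_def)
  moreover have "one_transversal H (node ` C)"
  proof (rule G.one_transversal_closed)
    fix X Y assume XY: "(X, Y) \<in> parcs H" "X \<in> node ` C"
    then consider "(X, Y) \<in> res_arcs" | "X = node (snk N)" | "Y = node (src N)" unfolding dag_arcs by auto
    then show "Y \<in> node ` C"
    proof cases
      case 1
      then obtain p q where pq: "(p, q) \<in> R" "X = node p" "Y = node q" unfolding res_arcs_def by auto
      then have "p \<in> C" using XY(2) mem R_V[OF pq(1)] by auto
      then have "q \<in> C" using mincut_star[OF mc, of p q] pq(1) by auto
      then show ?thesis using pq(3) by auto
    qed (use XY(2) mem[OF snk_V] CV in auto)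
  qed
  ultimately show "\<exists>U. C = \<Union>U \<and> dag_cut N H U \<and> one_transversal H U" by (intro exI[of _ "node ` C"]) simp
next
  interpret G: pair_fin_digraph H by (rule dag_fin)
  assume "\<exists>U. C = \<Union>U \<and> dag_cut N H U \<and> one_transversal H U"
  then obtain U where U: "C = \<Union>U" "U \<subseteq> pverts H" "one_transversal H U" by (auto simp: dag_cut_def)
  have pV: "pverts H = node ` V N" by (simp add: label_dag_def)
  have mem: "node x \<in> U \<longleftrightarrow> x \<in> C" if "x \<in> V N" for x
  proof
    assume "node x \<in> U"
    moreover have "x \<in> node x" using that by (simp add: in_node_iff)
    ultimately show "x \<in> C" using U(1) by blast
  next
    assume "x \<in> C"
    then obtain Y where Y: "Y \<in> U" "x \<in> Y" using U(1) by auto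
    then obtain y where "y \<in> V N" "Y = node y" using U(2) unfolding pV by blast
    then show "node x \<in> U" using Y by (auto simp: in_node_iff)
  qed
  have sC: "node (src N) \<in> U" "node (snk N) \<notin> U" using mem src_V snk_V C by (auto simp: st_cut_def)
  have ts: "(node (snk N), node (src N)) \<in> parcs H" unfolding dag_arcs by simp
  note not_back = G.one_transversal_not_back[OF acyclic_dag U(3)]
  have "y \<in> C" if xy: "(x, y) \<in> R" "x \<in> C" for x y
  proof (rule ccontr)
    assume "y \<notin> C"
    have V: "x \<in> V N" "y \<in> V N" using R_V[OF xy(1)] by auto
    have xU: "node x \<in> U" and yU: "node y \<notin> U" using mem V xy(2) \<open>y \<notin> C\<close> by auto
    have ne: "node x \<noteq> node y" using xU yU by auto
    have arc: "(node x, node y) \<in> parcs H" using xy(1) ne unfolding dag_arcs res_arcs_def by auto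
    obtain e where e: "e \<in> pos_arcs N" "orient cl e = (x, y)" using R_orient[OF xy(1) ne] by auto
    have pin: "node (snk N) \<in> pverts H" "node x \<in> pverts H" using snk_V V unfolding pV by auto
    consider "cl x < cl (snk N)" | "cl (src N) < cl y" | "\<not> cl x < cl (snk N)" "\<not> cl (src N) < cl y" by auto
    then show False
    proof cases
      case 1
      then have "x \<in> tails" using e unfolding tails_def by force
      then have "(node (snk N), node x) \<in> parcs H" unfolding dag_arcs by auto
      then show False using not_back[OF pin(1), of "node x" "node y"] arc xU yU sC by auto
    next
      case 2
      then have "y \<in> heads" using e unfolding heads_def by force
      then have "(node y, node (src N)) \<in> parcs H" unfolding dag_arcs by auto
      then show False using not_back[OF pin(2), of "node y" "node (src N)"] arc xU yU sC by auto
    next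
      \<comment> \<open>Neither extra edge is present: \<open>x\<close> has the rank of the sink and
        \<open>y\<close> that of the source. The last clause of \<open>good_labels\<close> gives a
        residual walk from \<open>x\<close> to the sink or from the source to \<open>y\<close>
        instead, which the edge from the sink's to the source's node completes.\<close>
      case 3
      have "cl x = cl (snk N)"
        using 3(1) cl_less[OF snk_V V(1)] by (metis linorder_neqE_nat st_cut_def st_mincut_def)
      moreover have "cl y = cl (src N)"
        using 3(2) cl_less[OF V(2) src_V] by (metis linorder_neqE_nat st_cut_def st_mincut_def)
      ultimately have "(\<forall>X. st_mincut N X \<longrightarrow> x \<notin> X) \<or> (\<forall>X. st_mincut N X \<longrightarrow> y \<in> X)"
        using good V unfolding good_labels_def by meson
      then show False
      proof
        assume "\<forall>X. st_mincut N X \<longrightarrow> x \<notin> X"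
        then have "(x, snk N) \<in> R\<^sup>*" using in_mincut_iff[OF V(1)] by auto
        then have "(node x, node (snk N)) \<in> (parcs H)\<^sup>*" by (rule res_arcs_H)
        then show False using not_back[OF pin(2), of "node (snk N)" "node (src N)"] ts xU sC by auto
      next
        assume "\<forall>X. st_mincut N X \<longrightarrow> y \<in> X"
        then have "(src N, y) \<in> R\<^sup>*" using in_all_mincuts_iff by auto
        then have "(node (src N), node y) \<in> (parcs H)\<^sup>*" by (rule res_arcs_H)
        then show False using not_back[OF pin(1), of "node (src N)" "node y"] ts yU sC by auto
      qed
    qed
  qed
  then show "st_mincut N C" using mincut_iff_closed[OF C] by auto
qed

theorem PQ_label_dag: "PQ_dag N H"
proof -
  have "parcs H \<subseteq> res_arcs \<union> {(X, Y). snk N \<in> X \<or> src N \<in> Y}"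
    unfolding dag_arcs using snk_V src_V by (auto simp: in_node_iff)
  moreover have "res_arcs \<subseteq> parcs H" unfolding dag_arcs by auto
  moreover have "pverts H = pverts (contract_sccs (residual N f))"
    by (simp add: label_dag_def contract_sccs_def sccs_residual)
  ultimately show ?thesis
    unfolding PQ_dag_def contract_arcs using dag_fin acyclic_dag max_flow contract_arcs mincut_iff_dag by blast
qed

end

theorem (in st_net) PQ_dag_of_good_labels:
  assumes "good_labels N cl jl"
  shows "PQ_dag N (label_dag N cl jl)"
proof -
  obtain f where "tight_flow N f" using ex_tight_flow by auto
  then interpret good_tight_flow N f cl jl
    using assms by (simp add: good_tight_flow_def good_tight_flow_axioms_def)
  show ?thesis by (rule PQ_label_dag)
qed

section \<open>Labels from families of cuts\<close>

text \<open>The smallest member containing \<open>x\<close>. In an intersection-closed family,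
  vertices covered by no member get the whole ground set and thus rank after all the others.\<close>

definition hull_in :: "nat \<Rightarrow> nat set set \<Rightarrow> nat \<Rightarrow> nat set" where
  "hull_in n F x = (if \<exists>X\<in>F. x \<in> X then \<Inter>{X\<in>F. x \<in> X} else {..<n})"

text \<open>Linear extension of the closure preorder of a family closed under intersection. The second
  summand makes the rank constant on the classes of vertices with equal closure, and only there.\<close>

definition rank :: "nat \<Rightarrow> nat set set \<Rightarrow> nat \<Rightarrow> nat" where
  "rank n F x = (if x < n then card (hull_in n F x) * n + Min {y. y < n \<and> hull_in n F y = hull_in n F x} else 0)"

locale cut_family =
  fixes n :: nat and F :: "nat set set"
  assumes sub: "X \<in> F \<Longrightarrow> X \<subseteq> {..<n}" and Int: "X \<in> F \<Longrightarrow> Y \<in> F \<Longrightarrow> X \<inter> Y \<in> F"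
begin

lemma Inter: "G \<subseteq> F \<Longrightarrow> G \<noteq> {} \<Longrightarrow> \<Inter>G \<in> F"
proof -
  assume G: "G \<subseteq> F" "G \<noteq> {}"
  have "finite F" by (rule finite_subset[of _ "Pow {..<n}"]) (use sub in auto)
  then have "finite G" using G(1) finite_subset by auto
  then show ?thesis using G(2,1) by (induction rule: finite_ne_induct) (auto intro: Int)
qed

lemma hull_refl: "x < n \<Longrightarrow> x \<in> hull_in n F x"
  by (auto simp: hull_in_def)

lemma hull_sub: "hull_in n F x \<subseteq> {..<n}"
  using sub by (auto simp: hull_in_def)

lemma hull_in_F: "\<exists>X\<in>F. x \<in> X \<Longrightarrow> hull_in n F x \<in> F"
  using Inter[of "{X\<in>F. x \<in> X}"] by (auto simp: hull_in_def)

lemma hull_least: "X \<in> F \<Longrightarrow> x \<in> X \<Longrightarrow> hull_in n F x \<subseteq> X"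
  by (auto simp: hull_in_def)

lemma hull_card: "card (hull_in n F x) \<le> n"
  using card_mono[OF _ hull_sub] by simp

lemma rep:
  assumes "x < n"
  defines "m \<equiv> Min {y. y < n \<and> hull_in n F y = hull_in n F x}"
  shows "m < n" "hull_in n F m = hull_in n F x"
proof -
  have "m \<in> {y. y < n \<and> hull_in n F y = hull_in n F x}"
    unfolding m_def using assms(1) by (intro Min_in) auto
  then show "m < n" "hull_in n F m = hull_in n F x" by auto
qed

lemma rank_less_bound: "rank n F x < n * n + n + 1"
proof (cases "x < n")
  case True
  then show ?thesis
    using rep(1)[OF True] mult_le_mono1[OF hull_card[of x], of n] unfolding rank_def by (simp only: if_True)
qed (simp add: rank_def)

lemma rank_eqD:
  assumes "x < n" "y < n" "rank n F x = rank n F y" "X \<in> F"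
  shows "x \<in> X \<longleftrightarrow> y \<in> X"
proof -
  have "Min {z. z < n \<and> hull_in n F z = hull_in n F x} = Min {z. z < n \<and> hull_in n F z = hull_in n F y}"
    using arg_cong[OF assms(3), of "\<lambda>k. k mod n"] rep(1)[OF assms(1)] rep(1)[OF assms(2)]
    unfolding rank_def if_P[OF assms(1)] if_P[OF assms(2)] by (simp only: mod_mult_self3 mod_less)
  then have "hull_in n F x = hull_in n F y" using rep(2)[OF assms(1)] rep(2)[OF assms(2)] by metis
  then have "y \<in> hull_in n F x" "x \<in> hull_in n F y"
    using hull_refl[OF assms(1)] hull_refl[OF assms(2)] by auto
  then show ?thesis using hull_least[OF assms(4)] by (meson subsetD)
qed

text \<open>If every member containing \<open>x\<close> contained \<open>y\<close>, the hull of
  \<open>y\<close> would lie in that of \<open>x\<close>. Equal hulls have equal ranks, and a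
  smaller hull outweighs the second summand, which is below \<open>n\<close>.\<close>

lemma rank_lessD:
  assumes "x < n" "y < n" "rank n F x < rank n F y"
  shows "\<exists>X\<in>F. x \<in> X \<and> y \<notin> X"
proof (rule ccontr)
  assume no: "\<not> ?thesis"
  have sub': "hull_in n F y \<subseteq> hull_in n F x"
  proof (cases "\<exists>X\<in>F. x \<in> X")
    case True
    then have "hull_in n F x \<in> F" by (rule hull_in_F)
    moreover from this have "y \<in> hull_in n F x" using no hull_refl[OF assms(1)] by auto
    ultimately show ?thesis by (rule hull_least)
  next
    case False
    then have "hull_in n F x = {..<n}" by (auto simp: hull_in_def)
    then show ?thesis using hull_sub by simp
  qed
  have "hull_in n F x \<noteq> hull_in n F y"
    using assms by (auto simp: rank_def)
  then have "hull_in n F y \<subset> hull_in n F x" using sub' by auto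
  then have "card (hull_in n F y) < card (hull_in n F x)"
    using finite_subset[OF hull_sub[of x]] by (intro psubset_card_mono) auto
  then have "Suc (card (hull_in n F y)) * n \<le> card (hull_in n F x) * n" by (intro mult_le_mono1) simp
  then have "rank n F y < rank n F x" using rep(1)[OF assms(2)] assms(1,2) by (simp add: rank_def)
  then show False using assms(3) by simp
qed

end

definition indic :: "nat set \<Rightarrow> nat \<Rightarrow> nat" where
  "indic Z x = (if x \<in> Z then 1 else 0)"

text \<open>The label of \<open>x\<close> is determined by the first set that contains \<open>x\<close>, and then by the rank that
  goes with this set. The stride 2 is the one of the array of pairs in which the tests are stored.\<close>

fun test_label :: "nat \<Rightarrow> nat \<Rightarrow> (nat set \<times> (nat \<Rightarrow> nat)) list \<Rightarrow> nat \<Rightarrow> nat" where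
  "test_label Q b [] x = b * Q"
| "test_label Q b ((Z, r) # ts) x = (if x \<in> Z then b * Q + r x else test_label Q (b + 2) ts x)"

text \<open>\<open>U\<close> is what earlier tests have caught, so the ranks only have to be right
  on the rest of \<open>Z\<close>. The base case says that vertices missed by all tests lie in no
  member.\<close>

fun layered :: "nat \<Rightarrow> 'a set set \<Rightarrow> 'a set \<Rightarrow> ('a set \<times> ('a \<Rightarrow> nat)) list \<Rightarrow> bool" where
  "layered Q F U [] \<longleftrightarrow> (\<forall>X\<in>F. X \<subseteq> U)"
| "layered Q F U ((Z, r) # ts) \<longleftrightarrow> Z \<in> F \<and> (\<forall>x. r x < Q) \<and>
     (\<forall>x\<in>Z - U. \<forall>y\<in>Z - U. (r x < r y \<longrightarrow> (\<exists>X\<in>F. x \<in> X \<and> y \<notin> X)) \<and>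
        (r x = r y \<longrightarrow> (\<forall>X\<in>F. x \<in> X \<longleftrightarrow> y \<in> X))) \<and>
     layered Q F (U \<union> Z) ts"

lemma layeredI:
  assumes "Z \<in> F" "\<And>x. r x < Q"
    and "\<And>x y. x \<in> Z - U \<Longrightarrow> y \<in> Z - U \<Longrightarrow>
      (r x < r y \<longrightarrow> (\<exists>X\<in>F. x \<in> X \<and> y \<notin> X)) \<and> (r x = r y \<longrightarrow> (\<forall>X\<in>F. x \<in> X \<longleftrightarrow> y \<in> X))"
    and "layered Q F (U \<union> Z) ts"
  shows "layered Q F U ((Z, r) # ts)"
  unfolding layered.simps using assms(1,2,4)
  by (intro conjI[OF assms(1)] conjI[OF allI[OF assms(2)]] conjI[OF ballI[OF ballI[OF assms(3)]]])

lemma test_label_ge: "b * Q \<le> test_label Q b ts x"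
proof (induction ts arbitrary: b)
  case (Cons t ts)
  obtain Z r where "t = (Z, r)" by (cases t)
  moreover have "b * Q \<le> (b + 2) * Q" by (intro mult_le_mono1) simp
  ultimately show ?case using Cons[of "b + 2"] by auto
qed simp

text \<open>Ranks stay below \<open>Q\<close>, so the labels given by different tests lie in
  disjoint ranges; and \<open>Z\<close>, being a member itself, separates what it catches from what
  is left.\<close>

lemma test_label_layered:
  assumes "layered Q F U ts" "x \<notin> U" "y \<notin> U"
  shows "(test_label Q b ts x < test_label Q b ts y \<longrightarrow> (\<exists>X\<in>F. x \<in> X \<and> y \<notin> X)) \<and>
    (test_label Q b ts x = test_label Q b ts y \<longrightarrow> (\<forall>X\<in>F. x \<in> X \<longleftrightarrow> y \<in> X))"
  using assms
proof (induction ts arbitrary: U b)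
  case Nil
  then show ?case by auto
next
  case (Cons t ts)
  obtain Z r where t: "t = (Z, r)" by (cases t)
  have Z: "Z \<in> F" "\<forall>x. r x < Q" "layered Q F (U \<union> Z) ts"
    "\<forall>x\<in>Z - U. \<forall>y\<in>Z - U. (r x < r y \<longrightarrow> (\<exists>X\<in>F. x \<in> X \<and> y \<notin> X)) \<and>
        (r x = r y \<longrightarrow> (\<forall>X\<in>F. x \<in> X \<longleftrightarrow> y \<in> X))"
    using Cons.prems(1)[unfolded t layered.simps] by - (elim conjE, assumption)+
  have far: "b * Q + r v < test_label Q (b + 2) ts w" for v w
  proof -
    have "b * Q + r v < (b + 2) * Q" using spec[OF Z(2), of v] by (simp add: distrib_right)
    then show ?thesis using test_label_ge[of "b + 2" Q ts w] by simp
  qed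
  show ?case
  proof (cases "x \<in> Z"; cases "y \<in> Z")
    assume *: "x \<in> Z" "y \<in> Z"
    have "(r x < r y \<longrightarrow> (\<exists>X\<in>F. x \<in> X \<and> y \<notin> X)) \<and> (r x = r y \<longrightarrow> (\<forall>X\<in>F. x \<in> X \<longleftrightarrow> y \<in> X))"
      by (rule bspec[OF bspec[OF Z(4)]]) (use * Cons.prems(2,3) in auto)
    moreover have "test_label Q b (t # ts) x = b * Q + r x" "test_label Q b (t # ts) y = b * Q + r y"
      using * t by auto
    ultimately show ?thesis by (simp only: add_less_cancel_left add_left_cancel)
  next
    assume "x \<in> Z" "y \<notin> Z"
    then show ?thesis using far[of x y] Z(1) t by auto
  next
    assume "x \<notin> Z" "y \<in> Z"
    then show ?thesis using far[of y x] t by auto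
  next
    assume "x \<notin> Z" "y \<notin> Z"
    then show ?thesis using Cons.IH[OF Z(3), of "b + 2"] Cons.prems(2,3) t by simp
  qed
qed

section \<open>Bridges\<close>

lemma rtrancl_first_arrival:
  assumes "(z, y) \<in> r\<^sup>*"
  shows "(z, y) \<in> {(a, b)\<in>r. b \<noteq> q}\<^sup>* \<or> (\<exists>p. (z, p) \<in> {(a, b)\<in>r. b \<noteq> q}\<^sup>* \<and> (p, q) \<in> r)"
  using assms
proof (induction rule: rtrancl_induct)
  case (step y y')
  then show ?case
  proof (cases "y' = q")
    case False
    then have "(y, y') \<in> {(a, b)\<in>r. b \<noteq> q}" using step(2) by auto
    then show ?thesis using step.IH by (auto intro: rtrancl_into_rtrancl)
  qed auto
qed simp

text \<open>A walk from \<open>z\<close> to its first arrival at \<open>q\<close> uses a single arc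
  into \<open>q\<close>, and any arc into \<open>q\<close> whose deletion disconnects
  \<open>q\<close> from \<open>z\<close> must be this one.\<close>

lemma bridge_unique:
  assumes "(z, q) \<in> r\<^sup>*" "(z, q) \<notin> (r - {(p, q)})\<^sup>*" "(z, q) \<notin> (r - {(p', q)})\<^sup>*"
  shows "p = p'"
proof -
  let ?rq = "{(a, b)\<in>r. b \<noteq> q}"
  have zq: "z \<noteq> q" using assms(2) by auto
  have "(z, q) \<notin> ?rq\<^sup>*"
  proof
    assume "(z, q) \<in> ?rq\<^sup>*"
    then show False using zq by (cases rule: rtranclE) auto
  qed
  then obtain a where a: "(z, a) \<in> ?rq\<^sup>*" "(a, q) \<in> r" using rtrancl_first_arrival[OF assms(1), of q] by auto
  have "a = b" if "(z, q) \<notin> (r - {(b, q)})\<^sup>*" for b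
  proof (rule ccontr)
    assume "a \<noteq> b"
    have "(z, a) \<in> (r - {(b, q)})\<^sup>*" using a(1) by (rule rtrancl_mono[THEN subsetD, rotated]) auto
    moreover have "(a, q) \<in> r - {(b, q)}" using a(2) \<open>a \<noteq> b\<close> by auto
    ultimately show False using that by (meson rtrancl_into_rtrancl)
  qed
  then show ?thesis using assms(2,3) by auto
qed

text \<open>One bridge per head, by \<open>bridge_unique\<close>; the starting vertex
  \<open>z q\<close> may vary with the head.\<close>

lemma card_bridges_from:
  assumes "finite A" "r \<subseteq> A \<times> A"
  shows "finite {(p, q). (p, q) \<in> r \<and> (z q, q) \<in> r\<^sup>* \<and> (z q, q) \<notin> (r - {(p, q)})\<^sup>*}" (is "finite ?B")
    and "card {(p, q). (p, q) \<in> r \<and> (z q, q) \<in> r\<^sup>* \<and> (z q, q) \<notin> (r - {(p, q)})\<^sup>*} \<le> card A"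
proof -
  have "?B \<subseteq> r" by auto
  moreover have "finite r" using assms by (meson finite_SigmaI finite_subset)
  ultimately show "finite ?B" by (rule finite_subset)
  have "inj_on snd ?B" by (rule inj_onI) (auto dest: bridge_unique)
  moreover have "snd ` ?B \<subseteq> A" using assms(2) by auto
  ultimately show "card ?B \<le> card A" using card_inj_on_le assms(1) by blast
qed

lemma converse_minus: "(r - {(p, q)})\<inverse> = r\<inverse> - {(q, p)}"
  by auto

lemma card_bridges_to:
  assumes "finite A" "r \<subseteq> A \<times> A"
  shows "finite {(p, q). (p, q) \<in> r \<and> (p, z p) \<in> r\<^sup>* \<and> (p, z p) \<notin> (r - {(p, q)})\<^sup>*}" (is "finite ?B")
    and "card {(p, q). (p, q) \<in> r \<and> (p, z p) \<in> r\<^sup>* \<and> (p, z p) \<notin> (r - {(p, q)})\<^sup>*} \<le> card A"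
proof -
  have eq: "?B = {(p, q). (p, q) \<in> r\<inverse> \<and> (z q, q) \<in> (r\<inverse>)\<^sup>* \<and> (z q, q) \<notin> (r\<inverse> - {(p, q)})\<^sup>*}\<inverse>"
    unfolding converse_minus[symmetric] by (auto simp: rtrancl_converse)
  have r: "r\<inverse> \<subseteq> A \<times> A" using assms(2) by auto
  show "finite ?B" unfolding eq using card_bridges_from(1)[OF assms(1) r, of z] by simp
  show "card ?B \<le> card A" unfolding eq card_inverse using card_bridges_from(2)[OF assms(1) r, of z] .
qed

definition strong_bridges :: "('a \<times> 'a) set \<Rightarrow> ('a \<times> 'a) set" where
  "strong_bridges r = {(p, q). (p, q) \<in> r \<and> (q, p) \<in> r\<^sup>* \<and> (p, q) \<notin> (r - {(p, q)})\<^sup>*}"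

text \<open>Fix a representative in each component. A bridge is needed either to get from its tail
  to the representative or from the representative to its head, as otherwise the detour over the
  representative avoids it. Each alternative allows one arc per vertex.\<close>

lemma card_strong_bridges:
  assumes "finite A" "r \<subseteq> A \<times> A"
  shows "finite (strong_bridges r)" "card (strong_bridges r) \<le> 2 * card A"
proof -
  define z where "z x = (SOME y. (x, y) \<in> r\<^sup>* \<and> (y, x) \<in> r\<^sup>*)" for x
  have z: "(x, z x) \<in> r\<^sup>* \<and> (z x, x) \<in> r\<^sup>*" for x
    unfolding z_def by (rule someI[of _ x]) simp
  let ?B1 = "{(p, q). (p, q) \<in> r \<and> (z q, q) \<in> r\<^sup>* \<and> (z q, q) \<notin> (r - {(p, q)})\<^sup>*}"
  let ?B2 = "{(p, q). (p, q) \<in> r \<and> (p, z p) \<in> r\<^sup>* \<and> (p, z p) \<notin> (r - {(p, q)})\<^sup>*}"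
  have sub: "strong_bridges r \<subseteq> ?B1 \<union> ?B2"
  proof
    fix e assume "e \<in> strong_bridges r"
    then obtain p q where e: "e = (p, q)" and mem: "(p, q) \<in> strong_bridges r" by (cases e) auto
    show "e \<in> ?B1 \<union> ?B2"
    proof (cases "(p, q) \<in> ?B2")
    case False
    note pq = mem False
    then have *: "(p, q) \<in> r" "(q, p) \<in> r\<^sup>*" "(p, q) \<notin> (r - {(p, q)})\<^sup>*" by (auto simp: strong_bridges_def)
    \<comment> \<open>Vertices of one component have equal predicates, so the choice in
      \<open>z\<close> is constant on components.\<close>
    have "(\<lambda>y. (p, y) \<in> r\<^sup>* \<and> (y, p) \<in> r\<^sup>*) = (\<lambda>y. (q, y) \<in> r\<^sup>* \<and> (y, q) \<in> r\<^sup>*)"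
    proof
      fix y
      have pq': "(p, q) \<in> r\<^sup>*" using *(1) by auto
      show "((p, y) \<in> r\<^sup>* \<and> (y, p) \<in> r\<^sup>*) = ((q, y) \<in> r\<^sup>* \<and> (y, q) \<in> r\<^sup>*)"
        using rtrancl_trans[OF pq', of y] rtrancl_trans[OF *(2), of y]
          rtrancl_trans[OF _ pq', of y] rtrancl_trans[OF _ *(2), of y] by blast
    qed
    then have zz: "z p = z q" by (simp add: z_def)
    have "(p, z p) \<in> (r - {(p, q)})\<^sup>*" using pq(2) *(1) z by auto
    then have "(z q, q) \<notin> (r - {(p, q)})\<^sup>*" using *(3) zz by (metis rtrancl_trans)
    then show ?thesis unfolding e using *(1) z by auto
    qed (simp add: e)
  qed
  then show "finite (strong_bridges r)"
    using card_bridges_from(1)[OF assms] card_bridges_to(1)[OF assms] by (meson finite_UnI finite_subset)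
  have "card (strong_bridges r) \<le> card (?B1 \<union> ?B2)"
    using sub card_bridges_from(1)[OF assms] card_bridges_to(1)[OF assms] by (intro card_mono finite_UnI)
  also have "\<dots> \<le> card ?B1 + card ?B2" by (rule card_Un_le)
  finally show "card (strong_bridges r) \<le> 2 * card A"
    using card_bridges_from(2)[OF assms, of z] card_bridges_to(2)[OF assms, of z] by linarith
qed

lemma rtrancl_delete:
  assumes "(x, y) \<in> r\<^sup>*"
  shows "(x, y) \<in> (r - {(p, q)})\<^sup>* \<or> (x, p) \<in> (r - {(p, q)})\<^sup>* \<and> (q, y) \<in> (r - {(p, q)})\<^sup>*"
  using assms
proof (induction rule: rtrancl_induct)
  case (step y z)
  then show ?case
    by (cases "(y, z) = (p, q)") (auto intro: rtrancl_into_rtrancl)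
qed simp

section \<open>Labels of vertices that lie on no path\<close>

text \<open>\<open>Suc\<close> frees 0 as the common label of all vertices on walks from
  \<open>s\<close> to \<open>t\<close>; any other vertex is named by the least vertex of its
  component.\<close>

definition junk_label :: "nat \<Rightarrow> nat \<Rightarrow> nat \<Rightarrow> (nat \<times> nat) set \<Rightarrow> nat \<Rightarrow> nat" where
  "junk_label n s t r x =
     (if x < n \<and> \<not> ((s, x) \<in> r\<^sup>* \<and> (x, t) \<in> r\<^sup>*)
      then Suc (Min {y. y < n \<and> (x, y) \<in> r\<^sup>* \<and> (y, x) \<in> r\<^sup>*}) else 0)"

lemma junk_label_rep:
  fixes x :: nat and r :: "(nat \<times> nat) set"
  assumes "x < n"
  defines "m \<equiv> Min {y. y < n \<and> (x, y) \<in> r\<^sup>* \<and> (y, x) \<in> r\<^sup>*}"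
  shows "m < n" "(x, m) \<in> r\<^sup>*" "(m, x) \<in> r\<^sup>*"
proof -
  have "m \<in> {y. y < n \<and> (x, y) \<in> r\<^sup>* \<and> (y, x) \<in> r\<^sup>*}"
    unfolding m_def using assms(1) by (intro Min_in) auto
  then show "m < n" "(x, m) \<in> r\<^sup>*" "(m, x) \<in> r\<^sup>*" by auto
qed

lemma junk_label_le: "junk_label n s t r x \<le> n"
  using junk_label_rep(1)[of x n r] by (auto simp: junk_label_def Suc_le_eq)

lemma scc_set_eq:
  assumes "(x, y) \<in> r\<^sup>*" "(y, x) \<in> r\<^sup>*"
  shows "{z. z < n \<and> (x, z) \<in> r\<^sup>* \<and> (z, x) \<in> r\<^sup>*} = {z. z < n \<and> (y, z) \<in> r\<^sup>* \<and> (z, y) \<in> r\<^sup>*}"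
proof -
  have "(x, z) \<in> r\<^sup>* \<and> (z, x) \<in> r\<^sup>* \<longleftrightarrow> (y, z) \<in> r\<^sup>* \<and> (z, y) \<in> r\<^sup>*" for z
    using rtrancl_trans[OF assms(1), of z] rtrancl_trans[OF assms(2), of z]
      rtrancl_trans[OF _ assms(1), of z] rtrancl_trans[OF _ assms(2), of z] by blast
  then show ?thesis by simp
qed

lemma junk_label_eq_iff:
  fixes s t :: nat and r :: "(nat \<times> nat) set"
  defines "P \<equiv> \<lambda>x. (s, x) \<in> r\<^sup>* \<and> (x, t) \<in> r\<^sup>*"
  assumes "x < n" "y < n"
  shows "junk_label n s t r x = junk_label n s t r y \<longleftrightarrow>
    P x \<and> P y \<or> \<not> P x \<and> \<not> P y \<and> (x, y) \<in> r\<^sup>* \<and> (y, x) \<in> r\<^sup>*"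
proof (cases "P x \<or> P y")
  case True
  then show ?thesis using assms(2,3) unfolding junk_label_def P_def by auto
next
  case False
  then have "junk_label n s t r x = junk_label n s t r y \<longleftrightarrow>
      Min {z. z < n \<and> (x, z) \<in> r\<^sup>* \<and> (z, x) \<in> r\<^sup>*} = Min {z. z < n \<and> (y, z) \<in> r\<^sup>* \<and> (z, y) \<in> r\<^sup>*}"
    using assms(2,3) unfolding junk_label_def P_def by simp
  also have "\<dots> \<longleftrightarrow> (x, y) \<in> r\<^sup>* \<and> (y, x) \<in> r\<^sup>*"
  proof
    assume e: "Min {z. z < n \<and> (x, z) \<in> r\<^sup>* \<and> (z, x) \<in> r\<^sup>*} = Min {z. z < n \<and> (y, z) \<in> r\<^sup>* \<and> (z, y) \<in> r\<^sup>*}"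
    note x = junk_label_rep(2,3)[OF assms(2), of r, unfolded e] and y = junk_label_rep(2,3)[OF assms(3), of r]
    show "(x, y) \<in> r\<^sup>* \<and> (y, x) \<in> r\<^sup>*"
      using rtrancl_trans[OF x(1) y(2)] rtrancl_trans[OF y(1) x(2)] ..
  next
    assume "(x, y) \<in> r\<^sup>* \<and> (y, x) \<in> r\<^sup>*"
    then show "Min {z. z < n \<and> (x, z) \<in> r\<^sup>* \<and> (z, x) \<in> r\<^sup>*} = Min {z. z < n \<and> (y, z) \<in> r\<^sup>* \<and> (z, y) \<in> r\<^sup>*}"
      using scc_set_eq[of x y r n] by simp
  qed
  finally show ?thesis using False by auto
qed

text \<open>The label depends on three relations: reachability from \<open>s\<close>, reachability
  of \<open>t\<close>, and mutual reachability. A walk through the deleted arc is repaired in each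
  of them by one of the assumptions.\<close>

lemma junk_label_delete:
  assumes sb: "(p, q) \<in> r" "(p, q) \<notin> strong_bridges r"
    and s: "(s, q) \<in> r\<^sup>* \<Longrightarrow> (s, q) \<in> (r - {(p, q)})\<^sup>*"
    and t: "(p, t) \<in> r\<^sup>* \<Longrightarrow> (p, t) \<in> (r - {(p, q)})\<^sup>*"
  shows "junk_label n s t (r - {(p, q)}) = junk_label n s t r"
proof -
  let ?d = "r - {(p, q)}"
  have up: "(x, y) \<in> ?d\<^sup>* \<Longrightarrow> (x, y) \<in> r\<^sup>*" for x y
    by (erule rtrancl_mono[THEN subsetD, rotated]) auto
  have src: "(s, x) \<in> ?d\<^sup>* \<longleftrightarrow> (s, x) \<in> r\<^sup>*" for x
  proof
    assume "(s, x) \<in> r\<^sup>*"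
    from rtrancl_delete[OF this, of p q] show "(s, x) \<in> ?d\<^sup>*"
    proof
      assume *: "(s, p) \<in> ?d\<^sup>* \<and> (q, x) \<in> ?d\<^sup>*"
      then have "(s, p) \<in> r\<^sup>*" using up by auto
      then have "(s, q) \<in> ?d\<^sup>*" using s sb(1) by (meson rtrancl.rtrancl_into_rtrancl)
      then show "(s, x) \<in> ?d\<^sup>*" using * by (meson rtrancl_trans)
    qed
  qed (rule up)
  have tgt: "(x, t) \<in> ?d\<^sup>* \<longleftrightarrow> (x, t) \<in> r\<^sup>*" for x
  proof
    assume "(x, t) \<in> r\<^sup>*"
    from rtrancl_delete[OF this, of p q] show "(x, t) \<in> ?d\<^sup>*"
    proof
      assume *: "(x, p) \<in> ?d\<^sup>* \<and> (q, t) \<in> ?d\<^sup>*"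
      then have "(q, t) \<in> r\<^sup>*" using up by auto
      then have "(p, t) \<in> ?d\<^sup>*" using t sb(1) by (meson converse_rtrancl_into_rtrancl)
      then show "(x, t) \<in> ?d\<^sup>*" using * by (meson rtrancl_trans)
    qed
  qed (rule up)
  have scc: "(x, y) \<in> ?d\<^sup>* \<and> (y, x) \<in> ?d\<^sup>* \<longleftrightarrow> (x, y) \<in> r\<^sup>* \<and> (y, x) \<in> r\<^sup>*" for x y
  proof
    assume xy: "(x, y) \<in> r\<^sup>* \<and> (y, x) \<in> r\<^sup>*"
    have key: "(a, b) \<in> ?d\<^sup>*" if ab: "(a, b) \<in> r\<^sup>*" "(b, a) \<in> r\<^sup>*" for a b
      using rtrancl_delete[OF ab(1), of p q]
    proof (elim disjE)
      assume *: "(a, p) \<in> ?d\<^sup>* \<and> (q, b) \<in> ?d\<^sup>*"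
      then have "(q, b) \<in> r\<^sup>*" "(a, p) \<in> r\<^sup>*" using up by auto
      then have "(q, p) \<in> r\<^sup>*" using ab(2) by (meson rtrancl_trans)
      then have "(p, q) \<in> ?d\<^sup>*" using sb by (auto simp: strong_bridges_def)
      then show "(a, b) \<in> ?d\<^sup>*" using * by (meson rtrancl_trans)
    qed
    show "(x, y) \<in> ?d\<^sup>* \<and> (y, x) \<in> ?d\<^sup>*" using key[of x y] key[of y x] xy by simp
  qed (use up in blast)
  show ?thesis by (rule ext) (simp only: junk_label_def src tgt scc)
qed

text \<open>Only bridges change the labels: at most \<open>n\<close> arcs needed from
  \<open>s\<close>, at most \<open>n\<close> needed to reach \<open>t\<close>, and at most
  \<open>2 * n\<close> strong bridges. All other deletions share the labels of
  \<open>r\<close>.\<close>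

lemma card_junk_labels:
  assumes "r \<subseteq> {..<n} \<times> {..<n}"
  shows "finite ((\<lambda>e. junk_label n s t (r - {e})) ` r)" "card ((\<lambda>e. junk_label n s t (r - {e})) ` r) \<le> 4 * n + 1"
proof -
  let ?B1 = "{(p, q). (p, q) \<in> r \<and> (s, q) \<in> r\<^sup>* \<and> (s, q) \<notin> (r - {(p, q)})\<^sup>*}"
  let ?B2 = "{(p, q). (p, q) \<in> r \<and> (p, t) \<in> r\<^sup>* \<and> (p, t) \<notin> (r - {(p, q)})\<^sup>*}"
  let ?f = "\<lambda>e. junk_label n s t (r - {e})"
  have fin: "finite r" using assms by (meson finite_SigmaI finite_lessThan finite_subset)
  then show "finite (?f ` r)" by simp
  note B1 = card_bridges_from[OF finite_lessThan assms, of "\<lambda>_. s"]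
  note B2 = card_bridges_to[OF finite_lessThan assms, of "\<lambda>_. t"]
  note SB = card_strong_bridges[OF finite_lessThan assms]
  have "?f ` r \<subseteq> insert (junk_label n s t r) (?f ` (strong_bridges r \<union> ?B1 \<union> ?B2))"
  proof
    fix g assume "g \<in> ?f ` r"
    then obtain p q where pq: "(p, q) \<in> r" "g = ?f (p, q)" by auto
    show "g \<in> insert (junk_label n s t r) (?f ` (strong_bridges r \<union> ?B1 \<union> ?B2))"
    proof (cases "(p, q) \<in> strong_bridges r \<union> ?B1 \<union> ?B2")
      case True
      then show ?thesis using pq(2) by blast
    next
      case False
      then have "?f (p, q) = junk_label n s t r" using pq(1) by (intro junk_label_delete) auto
      then show ?thesis using pq(2) by simp
    qed
  qed
  then have "card (?f ` r) \<le> card (insert (junk_label n s t r) (?f ` (strong_bridges r \<union> ?B1 \<union> ?B2)))"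
    using B1(1) B2(1) SB(1) by (intro card_mono) auto
  also have "\<dots> \<le> Suc (card (?f ` (strong_bridges r \<union> ?B1 \<union> ?B2)))"
    by (rule card_insert_le_m1) auto
  also have "card (?f ` (strong_bridges r \<union> ?B1 \<union> ?B2)) \<le> card (strong_bridges r \<union> ?B1 \<union> ?B2)"
    using B1(1) B2(1) SB(1) by (intro card_image_le) auto
  also have "card (strong_bridges r \<union> ?B1 \<union> ?B2) \<le> card (strong_bridges r) + card ?B1 + card ?B2"
    using card_Un_le[of "strong_bridges r \<union> ?B1" ?B2] card_Un_le[of "strong_bridges r" ?B1] by linarith
  finally show "card (?f ` r) \<le> 4 * n + 1" using B1(2) B2(2) SB(2) by simp
qed

section \<open>Layers\<close>

text \<open>The family \<open>L\<close> is the union of the sets without \<open>u\<close>, the sets with \<open>u\<close> but without \<open>v\<close>, and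
  the sets with \<open>v\<close>; the middle part is split further by a pivot \<open>r\<close>, and its two halves extend
  to families \<open>Dlo\<close> and \<open>Dhi\<close> that depend on less than \<open>u\<close> and \<open>v\<close> together.\<close>

locale layering =
  fixes n :: nat and L :: "nat set set" and u v r :: nat and Dlo Dhi :: "nat set set"
  assumes L_sub: "X \<in> L \<Longrightarrow> X \<subseteq> {..<n}"
    and L_Int: "X \<in> L \<Longrightarrow> Y \<in> L \<Longrightarrow> X \<inter> Y \<in> L" and L_Un: "X \<in> L \<Longrightarrow> Y \<in> L \<Longrightarrow> X \<union> Y \<in> L"
    and Dlo: "cut_family n Dlo" and Dhi: "cut_family n Dhi"
    and Dhi_Un: "X \<in> Dhi \<Longrightarrow> Y \<in> Dhi \<Longrightarrow> X \<union> Y \<in> Dhi"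
    and Mlo_eq: "X \<in> L \<Longrightarrow> u \<in> X \<Longrightarrow> v \<notin> X \<Longrightarrow> {X\<in>L. u \<in> X \<and> v \<notin> X \<and> r \<notin> X} = {X\<in>Dlo. v \<notin> X}"
    and Mhi_eq: "X \<in> L \<Longrightarrow> u \<in> X \<Longrightarrow> v \<notin> X \<Longrightarrow> {X\<in>L. u \<in> X \<and> v \<notin> X \<and> r \<in> X} = {X\<in>Dhi. u \<in> X}"
begin

abbreviation "Q \<equiv> n * n + n + 1"
definition "L1 = {X\<in>L. u \<notin> X}"
definition "Mlo = {X\<in>L. u \<in> X \<and> v \<notin> X \<and> r \<notin> X}"
definition "Mhi = {X\<in>L. u \<in> X \<and> v \<notin> X \<and> r \<in> X}"
definition "L3 = {X\<in>L. v \<in> X}"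
definition "t1 = (if L1 = {} then [] else [(\<Union>L1, rank n L1)])"
definition "t2 = (if Mlo = {} then [] else [(\<Union>Mlo, rank n Dlo)])"
text \<open>Inside the smallest cut of \<open>Mhi\<close>, vertices not caught before are separated
  by no member, so rank 0 serves there. Only beyond it do the ranks of \<open>Dhi\<close> describe
  \<open>L\<close>.\<close>

definition "t3 = (if Mhi = {} then [] else [(\<Inter>Mhi, \<lambda>_. 0), (\<Union>Dhi, rank n Dhi)])"
definition "t4 = (if L3 = {} then [] else [(\<Union>L3, rank n L3)])"

lemma Union_L:
  assumes "G \<subseteq> L" "G \<noteq> {}"
  shows "\<Union>G \<in> L"
proof -
  have "finite L" by (rule finite_subset[of _ "Pow {..<n}"]) (use L_sub in auto)
  then have "finite G" using assms(1) finite_subset by auto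
  then show ?thesis using assms(2,1) by (induction rule: finite_ne_induct) (auto intro: L_Un)
qed

lemma Inter_L:
  assumes "G \<subseteq> L" "G \<noteq> {}"
  shows "\<Inter>G \<in> L"
proof -
  interpret cut_family n L by unfold_locales (use L_sub L_Int in auto)
  show ?thesis using assms by (rule Inter)
qed

lemma cf1: "cut_family n L1"
  by unfold_locales (use L_sub L_Int in \<open>auto simp: L1_def\<close>)

lemma cf3: "cut_family n L3"
  by unfold_locales (use L_sub L_Int in \<open>auto simp: L3_def\<close>)

lemma layered4:
  assumes U: "\<And>X. X \<in> L \<Longrightarrow> v \<notin> X \<Longrightarrow> X \<subseteq> U"
  shows "layered Q L U t4"
proof (cases "L3 = {}")
  case True
  then show ?thesis using U by (auto simp: t4_def L3_def)
next
  case False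
  interpret cut_family n L3 by (rule cf3)
  have ZL: "\<Union>L3 \<in> L" using Union_L[of L3] False by (auto simp: L3_def)
  have D: "(rank n L3 x < rank n L3 y \<longrightarrow> (\<exists>X\<in>L. x \<in> X \<and> y \<notin> X)) \<and> (rank n L3 x = rank n L3 y \<longrightarrow> (\<forall>X\<in>L. x \<in> X \<longleftrightarrow> y \<in> X))"
    if xy: "x \<in> \<Union>L3 - U" "y \<in> \<Union>L3 - U" for x y
  proof (intro conjI impI ballI)
    have n: "x < n" "y < n" using xy L_sub[OF ZL] by auto
    show "\<exists>X\<in>L. x \<in> X \<and> y \<notin> X" if "rank n L3 x < rank n L3 y"
      using rank_lessD[OF n that] by (auto simp: L3_def)
    show "x \<in> X \<longleftrightarrow> y \<in> X" if eq: "rank n L3 x = rank n L3 y" and X: "X \<in> L" for X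
    proof (cases "v \<in> X")
      case True
      then show ?thesis using rank_eqD[OF n eq, of X] X by (auto simp: L3_def)
    next
      case False
      then show ?thesis using U[OF X] xy by auto
    qed
  qed
  have "X \<subseteq> U \<union> \<Union>L3" if "X \<in> L" for X
    using U[OF that] that by (cases "v \<in> X") (auto simp: L3_def)
  then have "layered Q L (U \<union> \<Union>L3) []" by simp
  then show ?thesis unfolding t4_def if_not_P[OF False] by (intro layeredI ZL rank_less_bound D)
qed

lemma layered3:
  assumes U1: "\<And>X. X \<in> L \<Longrightarrow> u \<notin> X \<Longrightarrow> X \<subseteq> U" and U2: "\<And>X. X \<in> Mlo \<Longrightarrow> X \<subseteq> U"
  shows "layered Q L U (t3 @ t4)"
proof (cases "Mhi = {}")
  case True
  have "layered Q L U t4"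
  proof (rule layered4)
    fix X assume "X \<in> L" "v \<notin> X"
    then show "X \<subseteq> U" using U1[of X] U2[of X] True by (auto simp: Mlo_def Mhi_def)
  qed
  then show ?thesis using True by (simp add: t3_def)
next
  case False
  interpret cut_family n Dhi by (rule Dhi)
  let ?H = "\<Inter>Mhi" and ?Z = "\<Union>Dhi"
  have eqM: "Mhi = {X\<in>Dhi. u \<in> X}" using Mhi_eq False by (auto simp: Mhi_def)
  have HM: "?H \<in> Mhi" using Inter_L[of Mhi] False by (auto simp: Mhi_def)
  have HL: "?H \<in> L" "u \<in> ?H" "v \<notin> ?H" "r \<in> ?H" using HM by (auto simp: Mhi_def)
  have finD: "finite Dhi" by (rule finite_subset[of _ "Pow {..<n}"]) (use sub in auto)
  have "Dhi \<noteq> {}" using HM eqM by auto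
  with finD have "?Z \<in> Dhi"
  proof -
    have "\<Union>G \<in> Dhi" if "finite G" "G \<noteq> {}" "G \<subseteq> Dhi" for G
      using that by (induction rule: finite_ne_induct) (auto intro: Dhi_Un)
    then show ?thesis using finD \<open>Dhi \<noteq> {}\<close> by simp
  qed
  moreover have "u \<in> ?Z" using HM eqM by auto
  ultimately have ZM: "?Z \<in> Mhi" using eqM by simp
  then have ZL: "?Z \<in> L" "v \<notin> ?Z" "r \<in> ?Z" by (auto simp: Mhi_def)
  \<comment> \<open>For a member \<open>X\<close> with \<open>u\<close>, the set
    \<open>X \<inter> ?H\<close> avoids \<open>v\<close>. If it contains \<open>r\<close>, it is in
    \<open>Mhi\<close> and \<open>?H\<close> is contained in \<open>X\<close>; otherwise it is in
    \<open>Mlo\<close> and lies in \<open>U\<close>.\<close>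
  have H: "x \<in> X \<longleftrightarrow> y \<in> X" if "x \<in> ?H - U" "y \<in> ?H - U" "X \<in> L" for x y X
  proof (cases "u \<in> X")
    case False
    then show ?thesis using U1[OF that(3)] that by auto
  next
    case True
    have XH: "X \<inter> ?H \<in> L" using L_Int[OF that(3) HL(1)] .
    show ?thesis
    proof (cases "r \<in> X")
      case r: True
      then have "X \<inter> ?H \<in> Mhi" using XH True HL by (auto simp: Mhi_def)
      then have "?H \<subseteq> X" by auto
      then show ?thesis using that by auto
    next
      case r: False
      then have "X \<inter> ?H \<in> Mlo" using XH True HL by (auto simp: Mlo_def)
      then have "X \<inter> ?H \<subseteq> U" by (rule U2)
      then show ?thesis using that by auto
    qed
  qed
  have D: "(rank n Dhi x < rank n Dhi y \<longrightarrow> (\<exists>X\<in>L. x \<in> X \<and> y \<notin> X)) \<and> (rank n Dhi x = rank n Dhi y \<longrightarrow> (\<forall>X\<in>L. x \<in> X \<longleftrightarrow> y \<in> X))"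
    if xy: "x \<in> ?Z - (U \<union> ?H)" "y \<in> ?Z - (U \<union> ?H)" for x y
  proof (intro conjI impI ballI)
    have n: "x < n" "y < n" using xy L_sub[OF ZL(1)] by auto
    show "\<exists>X\<in>L. x \<in> X \<and> y \<notin> X" if lt: "rank n Dhi x < rank n Dhi y"
    proof -
      obtain X where X: "X \<in> Dhi" "x \<in> X" "y \<notin> X" using rank_lessD[OF n lt] by auto
      \<comment> \<open>The separating member may miss \<open>u\<close>. Joining \<open>?H\<close>
        repairs this and does not affect \<open>x\<close> and \<open>y\<close>, which lie outside
        \<open>?H\<close>.\<close>
      have "X \<union> ?H \<in> Dhi" using Dhi_Un X(1) HM eqM by auto
      then have "X \<union> ?H \<in> Mhi" unfolding eqM using HL(2) by auto
      then have "X \<union> ?H \<in> L" by (auto simp: Mhi_def)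
      then show ?thesis by (intro bexI[of _ "X \<union> ?H"]) (use X xy in auto)
    qed
    show "x \<in> X \<longleftrightarrow> y \<in> X" if eq: "rank n Dhi x = rank n Dhi y" and X: "X \<in> L" for X
    proof (cases "u \<in> X")
      case False
      then show ?thesis using U1[OF X] xy by auto
    next
      case True
      \<comment> \<open>Clipped between \<open>?H\<close> and \<open>?Z\<close>, an arbitrary member
        becomes one of \<open>Mhi\<close>, and its trace on \<open>?Z - ?H\<close> stays the
        same.\<close>
      have "(X \<union> ?H) \<inter> ?Z \<in> L" by (rule L_Int[OF L_Un[OF X HL(1)] ZL(1)])
      moreover have "u \<in> (X \<union> ?H) \<inter> ?Z" "v \<notin> (X \<union> ?H) \<inter> ?Z" "r \<in> (X \<union> ?H) \<inter> ?Z"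
        using True ZL HL ZM by (auto simp: Mhi_def)
      ultimately have "(X \<union> ?H) \<inter> ?Z \<in> Mhi" unfolding Mhi_def by blast
      then have "(X \<union> ?H) \<inter> ?Z \<in> Dhi" unfolding eqM by blast
      then have "x \<in> (X \<union> ?H) \<inter> ?Z \<longleftrightarrow> y \<in> (X \<union> ?H) \<inter> ?Z" by (rule rank_eqD[OF n eq])
      then show ?thesis using xy by blast
    qed
  qed
  have E: "layered Q L (U \<union> ?H \<union> ?Z) t4"
  proof (rule layered4)
    fix X assume X: "X \<in> L" "v \<notin> X"
    show "X \<subseteq> U \<union> ?H \<union> ?Z"
    proof (cases "u \<in> X")
      case False
      then show ?thesis using U1 X by blast
    next
      case True
      then have "X \<in> Mlo \<or> X \<in> Mhi" using X by (auto simp: Mlo_def Mhi_def)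
      then show ?thesis using U2 unfolding eqM by blast
    qed
  qed
  have C: "(0 < (0::nat) \<longrightarrow> (\<exists>X\<in>L. x \<in> X \<and> y \<notin> X)) \<and> ((0::nat) = 0 \<longrightarrow> (\<forall>X\<in>L. x \<in> X \<longleftrightarrow> y \<in> X))"
    if "x \<in> ?H - U" "y \<in> ?H - U" for x y
    using H[OF that] by blast
  have "layered Q L (U \<union> ?H) ((?Z, rank n Dhi) # t4)"
    by (rule layeredI[OF ZL(1) rank_less_bound D E])
  then have "layered Q L U ((?H, \<lambda>_. 0) # (?Z, rank n Dhi) # t4)"
    by (rule layeredI[OF HL(1) _ C, rotated -1]) simp
  then show ?thesis unfolding t3_def if_not_P[OF False] append.simps .
qed

lemma layered2:
  assumes U1: "\<And>X. X \<in> L \<Longrightarrow> u \<notin> X \<Longrightarrow> X \<subseteq> U"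
  shows "layered Q L U (t2 @ t3 @ t4)"
proof (cases "Mlo = {}")
  case True
  then show ?thesis using layered3[OF U1] by (simp add: t2_def)
next
  case False
  interpret cut_family n Dlo by (rule Dlo)
  let ?G = "\<Union>Mlo"
  have eqM: "Mlo = {X\<in>Dlo. v \<notin> X}" using Mlo_eq False by (auto simp: Mlo_def)
  have GL: "?G \<in> L" using Union_L[of Mlo] False by (auto simp: Mlo_def)
  then have GM: "?G \<in> Mlo" using False by (auto simp: Mlo_def)
  have D: "(rank n Dlo x < rank n Dlo y \<longrightarrow> (\<exists>X\<in>L. x \<in> X \<and> y \<notin> X)) \<and> (rank n Dlo x = rank n Dlo y \<longrightarrow> (\<forall>X\<in>L. x \<in> X \<longleftrightarrow> y \<in> X))"
    if xy: "x \<in> ?G - U" "y \<in> ?G - U" for x y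
  proof (intro conjI impI ballI)
    have n: "x < n" "y < n" using xy L_sub[OF GL] by auto
    show "\<exists>X\<in>L. x \<in> X \<and> y \<notin> X" if lt: "rank n Dlo x < rank n Dlo y"
    proof -
      obtain X where X: "X \<in> Dlo" "x \<in> X" "y \<notin> X" using rank_lessD[OF n lt] by auto
      \<comment> \<open>The separating member may contain \<open>v\<close>; cutting it down to the
        largest cut of \<open>Mlo\<close> repairs this and does not affect \<open>x\<close> and
        \<open>y\<close>.\<close>
      have "X \<inter> ?G \<in> Dlo" using Int X(1) GM eqM by auto
      then have "X \<inter> ?G \<in> Mlo" unfolding eqM using GM eqM by auto
      then have "X \<inter> ?G \<in> L" by (auto simp: Mlo_def)
      then show ?thesis by (intro bexI[of _ "X \<inter> ?G"]) (use X xy in auto)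
    qed
    show "x \<in> X \<longleftrightarrow> y \<in> X" if eq: "rank n Dlo x = rank n Dlo y" and X: "X \<in> L" for X
    proof (cases "u \<in> X")
      case False
      then show ?thesis using U1[OF X] xy by auto
    next
      case True
      have "X \<inter> ?G \<in> Mlo" using L_Int[OF X GL] True GM by (auto simp: Mlo_def)
      then have "X \<inter> ?G \<in> Dlo" unfolding eqM by blast
      then have "x \<in> X \<inter> ?G \<longleftrightarrow> y \<in> X \<inter> ?G" by (rule rank_eqD[OF n eq])
      then show ?thesis using xy by blast
    qed
  qed
  have "layered Q L (U \<union> ?G) (t3 @ t4)"
    by (rule layered3) (use U1 in blast)+
  then show ?thesis unfolding t2_def if_not_P[OF False] append.simps by (intro layeredI GL rank_less_bound D)
qed

lemma layered1: "layered Q L {} (t1 @ t2 @ t3 @ t4)"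
proof (cases "L1 = {}")
  case True
  have "layered Q L {} (t2 @ t3 @ t4)" by (rule layered2) (use True in \<open>auto simp: L1_def\<close>)
  then show ?thesis using True by (simp add: t1_def)
next
  case False
  interpret cut_family n L1 by (rule cf1)
  have ZL: "\<Union>L1 \<in> L" using Union_L[of L1] False by (auto simp: L1_def)
  have D: "(rank n L1 x < rank n L1 y \<longrightarrow> (\<exists>X\<in>L. x \<in> X \<and> y \<notin> X)) \<and> (rank n L1 x = rank n L1 y \<longrightarrow> (\<forall>X\<in>L. x \<in> X \<longleftrightarrow> y \<in> X))"
    if xy: "x \<in> \<Union>L1" "y \<in> \<Union>L1" for x y
  proof (intro conjI impI ballI)
    have n: "x < n" "y < n" using xy L_sub[OF ZL] by auto
    show "\<exists>X\<in>L. x \<in> X \<and> y \<notin> X" if "rank n L1 x < rank n L1 y"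
      using rank_lessD[OF n that] by (auto simp: L1_def)
    show "x \<in> X \<longleftrightarrow> y \<in> X" if eq: "rank n L1 x = rank n L1 y" and X: "X \<in> L" for X
    proof -
      have "X \<inter> \<Union>L1 \<in> L1" using L_Int[OF X ZL] unfolding L1_def by blast
      then have "x \<in> X \<inter> \<Union>L1 \<longleftrightarrow> y \<in> X \<inter> \<Union>L1" by (rule rank_eqD[OF n eq])
      then show ?thesis using xy by blast
    qed
  qed
  have "layered Q L ({} \<union> \<Union>L1) (t2 @ t3 @ t4)"
    by (rule layered2) (auto simp: L1_def)
  then show ?thesis unfolding t1_def if_not_P[OF False] append.simps
    by (intro layeredI ZL rank_less_bound D) auto
qed

end

section \<open>Vital arcs\<close>

definition crossing_cuts :: "'a network \<Rightarrow> 'a \<times> 'a \<Rightarrow> 'a set set" where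
  "crossing_cuts N e = {X. st_cut N X \<and> fst e \<in> X \<and> snd e \<notin> X}"

definition lam1 :: "'a network \<Rightarrow> 'a \<times> 'a \<Rightarrow> real" where
  "lam1 N e = Min (cut_cap N ` crossing_cuts N e)"

definition min_crossing :: "'a network \<Rightarrow> 'a \<times> 'a \<Rightarrow> 'a set set" where
  "min_crossing N e = {X\<in>crossing_cuts N e. cut_cap N X = lam1 N e}"

context st_net
begin

lemma finite_crossing: "finite (crossing_cuts N e)"
  by (rule finite_subset[OF _ finite_cuts]) (auto simp: crossing_cuts_def)

lemma lam1_le: "X \<in> crossing_cuts N e \<Longrightarrow> lam1 N e \<le> cut_cap N X"
  unfolding lam1_def using finite_crossing by (intro Min_le) auto

lemma min_crossing_nonempty: "crossing_cuts N e \<noteq> {} \<Longrightarrow> min_crossing N e \<noteq> {}"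
proof -
  assume "crossing_cuts N e \<noteq> {}"
  then have "lam1 N e \<in> cut_cap N ` crossing_cuts N e"
    unfolding lam1_def using finite_crossing by (intro Min_in) simp_all
  then obtain X where "X \<in> crossing_cuts N e" "cut_cap N X = lam1 N e" by force
  then show ?thesis unfolding min_crossing_def by blast
qed

lemma min_crossing_lattice:
  assumes "X \<in> min_crossing N e" "Y \<in> min_crossing N e"
  shows "X \<inter> Y \<in> min_crossing N e" "X \<union> Y \<in> min_crossing N e"
proof -
  have c: "X \<inter> Y \<in> crossing_cuts N e" "X \<union> Y \<in> crossing_cuts N e"
    using assms by (auto simp: min_crossing_def crossing_cuts_def st_cut_def)
  have "cut_cap N (X \<inter> Y) + cut_cap N (X \<union> Y) \<le> 2 * lam1 N e"
    using submodular[of X Y] assms by (simp add: min_crossing_def)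
  then have "cut_cap N (X \<inter> Y) = lam1 N e" "cut_cap N (X \<union> Y) = lam1 N e"
    using lam1_le[OF c(1)] lam1_le[OF c(2)] by auto
  then show "X \<inter> Y \<in> min_crossing N e" "X \<union> Y \<in> min_crossing N e" using c by (auto simp: min_crossing_def)
qed

text \<open>Uncross \<open>X\<close> with a minimiser \<open>Y\<close> of \<open>e'\<close>. If
  \<open>e\<close> also joins the differences, both arcs are saved and the two cuts obtained cannot
  both reach the minimum. Otherwise \<open>e\<close> leaves one of these two cuts, which then costs
  at least \<open>lam1 N e\<close>; saving \<open>e'\<close> makes the other one cheaper than the
  minimum.\<close>

lemma vital_not_entering:
  assumes e: "e \<in> E N" "lam1 N e \<le> mincut_cap N + cap N e" and X: "X \<in> min_crossing N e"
    and e': "e' \<in> E N" "crossing_cuts N e' \<noteq> {}" "lam1 N e' < mincut_cap N + cap N e'"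
  shows "\<not> (fst e' \<notin> X \<and> snd e' \<in> X)"
proof
  assume ent: "fst e' \<notin> X \<and> snd e' \<in> X"
  obtain Y where Y: "Y \<in> min_crossing N e'" using min_crossing_nonempty[OF e'(2)] by auto
  have cuts: "st_cut N (X \<inter> Y)" "st_cut N (X \<union> Y)" "fst e \<in> X" "snd e \<notin> X" "fst e' \<in> Y" "snd e' \<notin> Y"
    and caps: "cut_cap N X = lam1 N e" "cut_cap N Y = lam1 N e'"
    using X Y by (auto simp: min_crossing_def crossing_cuts_def intro: st_cut_Int st_cut_Un)
  note ge = mincut_le[OF cuts(1)] mincut_le[OF cuts(2)]
  show False
  proof (cases "fst e \<in> X - Y \<and> snd e \<in> Y - X")
    case True
    have "cut_cap N (X \<inter> Y) + cut_cap N (X \<union> Y) + cap N (fst e, snd e) + cap N (fst e', snd e') \<le> cut_cap N X + cut_cap N Y"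
      using e(1) e'(1) True cuts ent by (intro submodular_arc2) auto
    then show False using ge caps e(2) e'(3) by simp
  next
    case False
    have "cut_cap N (Y \<inter> X) + cut_cap N (Y \<union> X) + cap N (fst e', snd e') \<le> cut_cap N Y + cut_cap N X"
      using e'(1) cuts ent by (intro submodular_arc) auto
    moreover have "X \<inter> Y \<in> crossing_cuts N e \<or> X \<union> Y \<in> crossing_cuts N e"
      using False cuts by (auto simp: crossing_cuts_def)
    then have "lam1 N e \<le> cut_cap N (X \<inter> Y) \<or> lam1 N e \<le> cut_cap N (X \<union> Y)"
      using lam1_le[of "X \<inter> Y" e] lam1_le[of "X \<union> Y" e] by blast
    ultimately show False using ge caps e'(3) by (auto simp: Int_commute Un_commute)
  qed
qed

end

text \<open>\<open>VV\<close> is kept abstract because it will also contain arcs on the verge of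
  being vital, for which \<open>not_entering\<close> has another proof.\<close>

locale laminar_arcs = st_net N for N :: "nat network" +
  fixes n :: nat and VV :: "(nat \<times> nat) set"
  assumes V_eq: "V N = {..<n}"
    and VV_E: "VV \<subseteq> E N" and VV_cross: "e \<in> VV \<Longrightarrow> crossing_cuts N e \<noteq> {}"
    and not_entering: "e \<in> VV \<Longrightarrow> e' \<in> VV \<Longrightarrow> lam1 N e \<le> lam1 N e' \<Longrightarrow> X \<in> min_crossing N e \<Longrightarrow>
      \<not> (fst e' \<notin> X \<and> snd e' \<in> X)"
begin

abbreviation lam :: "nat \<times> nat \<Rightarrow> real" where "lam \<equiv> lam1 N"

text \<open>Undirected connectivity by the arcs whose level lies in \<open>S\<close>, applied to
  rays \<open>{l..}\<close> and \<open>{l<..}\<close>: as \<open>l\<close> falls, classes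
  merge.\<close>

definition links :: "real set \<Rightarrow> (nat \<times> nat) set" where
  "links S = ({e\<in>VV. lam e \<in> S} \<union> {e\<in>VV. lam e \<in> S}\<inverse>)\<^sup>*"

lemma links_sym: "(x, y) \<in> links S \<Longrightarrow> (y, x) \<in> links S"
proof -
  have "sym (({e\<in>VV. lam e \<in> S} \<union> {e\<in>VV. lam e \<in> S}\<inverse>)\<^sup>*)"
    by (rule sym_rtrancl) (rule sym_Un_converse)
  then show "(x, y) \<in> links S \<Longrightarrow> (y, x) \<in> links S" unfolding links_def by (rule symD)
qed

lemma links_trans: "(x, y) \<in> links S \<Longrightarrow> (y, z) \<in> links S \<Longrightarrow> (x, z) \<in> links S"
  unfolding links_def by (rule rtrancl_trans)

lemma links_refl [simp]: "(x, x) \<in> links S"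
  unfolding links_def by simp

lemma links_mono: "S \<subseteq> T \<Longrightarrow> (x, y) \<in> links S \<Longrightarrow> (x, y) \<in> links T"
  unfolding links_def by (erule rtrancl_mono[THEN subsetD, rotated]) auto

lemma links_arc: "e \<in> VV \<Longrightarrow> lam e \<in> S \<Longrightarrow> (fst e, snd e) \<in> links S"
  unfolding links_def by (auto intro!: r_into_rtrancl)

lemma links_separated:
  assumes "(x, y) \<in> links S" "(x \<in> X) \<noteq> (y \<in> X)"
  shows "\<exists>e\<in>VV. lam e \<in> S \<and> (fst e \<in> X) \<noteq> (snd e \<in> X)"
  using assms unfolding links_def
  by (induction rule: rtrancl_induct) force+

definition least :: "real set \<Rightarrow> nat \<Rightarrow> nat" where
  "least S x = (LEAST y. (x, y) \<in> links S)"

lemma least_link: "(x, least S x) \<in> links S"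
  unfolding least_def by (rule LeastI[of _ x]) simp

lemma least_le: "(x, y) \<in> links S \<Longrightarrow> least S x \<le> y"
  unfolding least_def by (rule Least_le)

lemma least_eq: "(x, y) \<in> links S \<Longrightarrow> least S x = least S y"
  unfolding least_def by (metis links_sym links_trans)

lemma least_less: "x < n \<Longrightarrow> least S x < n"
  using least_le[of x x S] by simp

definition F :: "real \<Rightarrow> nat set set" where
  "F l = {X. st_cut N X \<and> (\<forall>e\<in>VV. l \<le> lam e \<longrightarrow> \<not> (fst e \<notin> X \<and> snd e \<in> X))}"

text \<open>A chain of links that \<open>X\<close> separates contains an arc with just one end in
  \<open>X\<close>. It may not enter \<open>X\<close>, so it leaves it, and its level is a lower
  bound for the capacity of \<open>X\<close>.\<close>

lemma F_sep:
  assumes "X \<in> F l" "(x, y) \<in> links S" "S \<subseteq> {l..}" "(x \<in> X) \<noteq> (y \<in> X)"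
  shows "\<exists>e\<in>VV. lam e \<in> S \<and> fst e \<in> X \<and> snd e \<notin> X \<and> lam e \<le> cut_cap N X"
proof -
  obtain e where e: "e \<in> VV" "lam e \<in> S" "(fst e \<in> X) \<noteq> (snd e \<in> X)"
    using links_separated[OF assms(2,4)] by auto
  then have "fst e \<in> X \<and> snd e \<notin> X" using assms(1,3) by (auto simp: F_def)
  then show ?thesis using e lam1_le[of X e] assms(1) by (auto simp: crossing_cuts_def F_def)
qed

definition D :: "nat \<Rightarrow> nat \<Rightarrow> real \<Rightarrow> nat set set" where
  "D x r l = {X\<in>F l. cut_cap N X = l \<and> x \<in> X \<and> r \<notin> X}"

text \<open>As \<open>x\<close> and \<open>r\<close> are linked, \<open>F_sep\<close> bounds the
  capacities of intersection and union from below by \<open>l\<close>, and submodularity leaves no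
  slack.\<close>

lemma D_lattice:
  assumes "(x, r) \<in> links {l..}" "X \<in> D x r l" "Y \<in> D x r l"
  shows "X \<inter> Y \<in> D x r l" "X \<union> Y \<in> D x r l"
proof -
  have FF: "X \<inter> Y \<in> F l" "X \<union> Y \<in> F l"
    using assms(2,3) by (auto simp: D_def F_def st_cut_def)
  have xr: "x \<in> X \<inter> Y" "r \<notin> X \<inter> Y" "x \<in> X \<union> Y" "r \<notin> X \<union> Y" using assms(2,3) by (auto simp: D_def)
  have "l \<le> cut_cap N (X \<inter> Y)" "l \<le> cut_cap N (X \<union> Y)"
    using F_sep[OF FF(1) assms(1)] F_sep[OF FF(2) assms(1)] xr by fastforce+
  moreover have "cut_cap N (X \<inter> Y) + cut_cap N (X \<union> Y) \<le> 2 * l"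
    using submodular[of X Y] assms(2,3) by (simp add: D_def)
  ultimately show "X \<inter> Y \<in> D x r l" "X \<union> Y \<in> D x r l" using FF xr by (auto simp: D_def)
qed

lemma D_family: "(x, r) \<in> links {l..} \<Longrightarrow> cut_family n (D x r l)"
proof
  show "X \<subseteq> {..<n}" if "X \<in> D x r l" for X using that by (auto simp: D_def F_def st_cut_def V_eq)
qed (rule D_lattice(1))

text \<open>A minimiser of \<open>e\<close> has capacity \<open>lam e\<close>, so by
  \<open>F_sep\<close> it separates nothing that is linked above this level, and \<open>lo e\<close>
  and \<open>hi e\<close> can stand for the ends of \<open>e\<close>. On its own level both ends
  have the same representative \<open>root e\<close>, the pivot that divides the minimisers.\<close>

definition root :: "nat \<times> nat \<Rightarrow> nat" where "root e = least {lam e..} (fst e)"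
definition lo :: "nat \<times> nat \<Rightarrow> nat" where "lo e = least {lam e<..} (fst e)"
definition hi :: "nat \<times> nat \<Rightarrow> nat" where "hi e = least {lam e<..} (snd e)"
definition Dlo :: "nat \<times> nat \<Rightarrow> nat set set" where "Dlo e = D (lo e) (root e) (lam e)"
definition Dhi :: "nat \<times> nat \<Rightarrow> nat set set" where "Dhi e = D (root e) (hi e) (lam e)"
definition Mlo :: "nat \<times> nat \<Rightarrow> nat set set" where "Mlo e = {X\<in>min_crossing N e. root e \<notin> X}"
definition Mhi :: "nat \<times> nat \<Rightarrow> nat set set" where "Mhi e = {X\<in>min_crossing N e. root e \<in> X}"

lemma gt_ge: "(x, y) \<in> links {l<..} \<Longrightarrow> (x, y) \<in> links {l..}"
  by (rule links_mono) auto

lemma root_links: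
  assumes "e \<in> VV"
  shows "(lo e, root e) \<in> links {lam e..}" "(root e, hi e) \<in> links {lam e..}"
proof -
  have r: "(fst e, root e) \<in> links {lam e..}" unfolding root_def by (rule least_link)
  have "(fst e, lo e) \<in> links {lam e..}" "(snd e, hi e) \<in> links {lam e..}"
    unfolding lo_def hi_def using least_link gt_ge by auto
  moreover have "(fst e, snd e) \<in> links {lam e..}" using links_arc[OF assms] by simp
  ultimately show "(lo e, root e) \<in> links {lam e..}" "(root e, hi e) \<in> links {lam e..}"
    using r links_sym links_trans by blast+
qed

lemma tight_not_sep:
  assumes "X \<in> F l" "cut_cap N X = l" "(x, y) \<in> links {l<..}"
  shows "x \<in> X \<longleftrightarrow> y \<in> X"
proof (rule ccontr)
  assume "\<not> ?thesis"
  then show False using F_sep[OF assms(1,3)] assms(2) by fastforce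
qed

lemma min_crossing_F: "e \<in> VV \<Longrightarrow> X \<in> min_crossing N e \<Longrightarrow> X \<in> F (lam e)"
  using not_entering by (auto simp: F_def min_crossing_def crossing_cuts_def)

lemma lo_hi:
  assumes "X \<in> F (lam e)" "cut_cap N X = lam e"
  shows "lo e \<in> X \<longleftrightarrow> fst e \<in> X" "hi e \<in> X \<longleftrightarrow> snd e \<in> X"
  using tight_not_sep[OF assms] least_link unfolding lo_def hi_def by blast+

lemma Mlo_eq:
  assumes "e \<in> VV"
  shows "Mlo e = {X\<in>Dlo e. snd e \<notin> X}"
proof (intro set_eqI iffI)
  fix X assume X: "X \<in> Mlo e"
  then have "X \<in> F (lam e)" "cut_cap N X = lam e" "fst e \<in> X" "snd e \<notin> X" "root e \<notin> X"
    using min_crossing_F[OF assms] by (auto simp: Mlo_def min_crossing_def crossing_cuts_def)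
  then show "X \<in> {X\<in>Dlo e. snd e \<notin> X}" using lo_hi[of X e] by (auto simp: Dlo_def D_def)
next
  fix X assume "X \<in> {X\<in>Dlo e. snd e \<notin> X}"
  then show "X \<in> Mlo e" using lo_hi[of X e] by (auto simp: Mlo_def min_crossing_def crossing_cuts_def Dlo_def D_def F_def)
qed

lemma Mhi_eq:
  assumes "e \<in> VV"
  shows "Mhi e = {X\<in>Dhi e. fst e \<in> X}"
proof (intro set_eqI iffI)
  fix X assume X: "X \<in> Mhi e"
  then have "X \<in> F (lam e)" "cut_cap N X = lam e" "fst e \<in> X" "snd e \<notin> X" "root e \<in> X"
    using min_crossing_F[OF assms] by (auto simp: Mhi_def min_crossing_def crossing_cuts_def)
  then show "X \<in> {X\<in>Dhi e. fst e \<in> X}" using lo_hi[of X e] by (auto simp: Dhi_def D_def)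
next
  fix X assume "X \<in> {X\<in>Dhi e. fst e \<in> X}"
  then show "X \<in> Mhi e" using lo_hi[of X e] by (auto simp: Mhi_def min_crossing_def crossing_cuts_def Dhi_def D_def F_def)
qed

text \<open>Classes only grow as the level falls, so a vertex ceases to be the least of its class at
  one level only. A vertex that does so at \<open>l\<close> determines \<open>l\<close>.\<close>

lemma level_unique:
  assumes "least {l<..} x = x" "least {l..} x \<noteq> x" "least {l'<..} x = x" "least {l'..} x \<noteq> x"
  shows "l = l'"
proof -
  have "False" if "l < l'" "least {l<..} x = x" "least {l'..} x \<noteq> x" for l l'
  proof -
    have "(x, least {l'..} x) \<in> links {l<..}"
      by (rule links_mono[OF _ least_link]) (use that(1) in auto)
    then have "x \<le> least {l'..} x" using least_le that(2) by metis
    moreover have "least {l'..} x \<le> x" by (rule least_le) simp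
    ultimately show False using that(3) by simp
  qed
  then show ?thesis using assms by (meson linorder_neqE_linordered_idom)
qed

lemma lo_props: "least {lam e<..} (lo e) = lo e" "least {lam e..} (lo e) = root e"
proof -
  have l: "(fst e, lo e) \<in> links {lam e<..}" unfolding lo_def by (rule least_link)
  show "least {lam e<..} (lo e) = lo e" using least_eq[OF l] by (simp add: lo_def)
  show "least {lam e..} (lo e) = root e" using least_eq[OF gt_ge[OF l]] by (simp add: root_def)
qed

lemma hi_props:
  assumes "e \<in> VV"
  shows "least {lam e<..} (hi e) = hi e" "least {lam e..} (hi e) = root e"
proof -
  have l: "(snd e, hi e) \<in> links {lam e<..}" unfolding hi_def by (rule least_link)
  show "least {lam e<..} (hi e) = hi e" using least_eq[OF l] by (simp add: hi_def)
  show "least {lam e..} (hi e) = root e"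
    using least_eq[OF gt_ge[OF l]] least_eq[OF links_arc[OF assms, of "{lam e..}"]] by (simp add: root_def)
qed

section \<open>Counting families and selected cuts by vertices\<close>

lemma VV_less: "e \<in> VV \<Longrightarrow> fst e < n \<and> snd e < n"
  using VV_E arcs_wf V_eq by auto

lemma finite_VV: "finite VV"
  using VV_E finite_E finite_subset by auto

lemma card_image_key:
  assumes "finite A" "\<And>a b. a \<in> A \<Longrightarrow> b \<in> A \<Longrightarrow> k a = k b \<Longrightarrow> f a = f b" "\<And>a. a \<in> A \<Longrightarrow> k a < n"
  shows "card (f ` A) \<le> n"
proof -
  have "f ` A = (\<lambda>i. f (SOME a. a \<in> A \<and> k a = i)) ` k ` A"
    unfolding image_image
  proof (rule image_cong[OF refl])
    fix a assume a: "a \<in> A"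
    have "(SOME b. b \<in> A \<and> k b = k a) \<in> A \<and> k (SOME b. b \<in> A \<and> k b = k a) = k a"
      by (rule someI[of _ a]) (use a in simp)
    then show "f a = f (SOME b. b \<in> A \<and> k b = k a)" using assms(2)[OF a] by simp
  qed
  then have "card (f ` A) \<le> card (k ` A)"
    using card_image_le[OF finite_imageI[OF assms(1)], of "\<lambda>i. f (SOME a. a \<in> A \<and> k a = i)" k] by (simp only:)
  also have "\<dots> \<le> card {..<n}" using assms(3) by (intro card_mono) auto
  finally show ?thesis by simp
qed

text \<open>A cut of \<open>Mlo e\<close> separates \<open>lo e\<close> from \<open>root e\<close>,
  so these differ. Hence \<open>lo e\<close> ceases to be least at level \<open>lam e\<close>; it
  determines this level, then the root, and with them the family.\<close>

lemma card_Dlo: "card (Dlo ` {e\<in>VV. Mlo e \<noteq> {}}) \<le> n"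
proof (rule card_image_key[of _ lo])
  have ne: "lo e \<noteq> root e" if e: "e \<in> VV" "Mlo e \<noteq> {}" for e
  proof -
    obtain X where "X \<in> Mlo e" using e(2) by auto
    then have "lo e \<in> X" "root e \<notin> X" unfolding Mlo_eq[OF e(1)] by (simp_all add: Dlo_def D_def)
    then show ?thesis by auto
  qed
  fix a b assume *: "a \<in> {e\<in>VV. Mlo e \<noteq> {}}" "b \<in> {e\<in>VV. Mlo e \<noteq> {}}" "lo a = lo b"
  then have "lam a = lam b"
    using level_unique[of "lam a" "lo a" "lam b"] lo_props[of a] lo_props[of b] ne[of a] ne[of b] by simp
  then show "Dlo a = Dlo b" using lo_props(2)[of a] lo_props(2)[of b] *(3) by (simp add: Dlo_def)
next
  show "finite {e\<in>VV. Mlo e \<noteq> {}}" using finite_VV by simp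
  show "lo a < n" if "a \<in> {e\<in>VV. Mlo e \<noteq> {}}" for a
    unfolding lo_def using VV_less[of a] that by (intro least_less) simp
qed

lemma card_Dhi: "card (Dhi ` {e\<in>VV. Mhi e \<noteq> {}}) \<le> n"
proof (rule card_image_key[of _ hi])
  have ne: "hi e \<noteq> root e" if e: "e \<in> VV" "Mhi e \<noteq> {}" for e
  proof -
    obtain X where "X \<in> Mhi e" using e(2) by auto
    then have "root e \<in> X" "hi e \<notin> X" unfolding Mhi_eq[OF e(1)] by (simp_all add: Dhi_def D_def)
    then show ?thesis by auto
  qed
  fix a b assume *: "a \<in> {e\<in>VV. Mhi e \<noteq> {}}" "b \<in> {e\<in>VV. Mhi e \<noteq> {}}" "hi a = hi b"
  then have "lam a = lam b"
    using level_unique[of "lam a" "hi a" "lam b"] hi_props[of a] hi_props[of b] ne[of a] ne[of b] by simp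
  then show "Dhi a = Dhi b" using hi_props(2)[of a] hi_props(2)[of b] * by (simp add: Dhi_def)
next
  show "finite {e\<in>VV. Mhi e \<noteq> {}}" using finite_VV by simp
  show "hi a < n" if "a \<in> {e\<in>VV. Mhi e \<noteq> {}}" for a
    unfolding hi_def using VV_less[of a] that by (intro least_less) simp
qed

text \<open>Arcs representing the distinct selected cuts form a forest. Among those remaining, take
  the lowest level \<open>m\<close>, one link class there, and in it the arc \<open>e\<close> with
  the heaviest cut. Another remaining arc that \<open>S e\<close> separates within the class must
  leave \<open>S e\<close>, so it has level \<open>m\<close> and \<open>S e\<close> among its
  minimisers; its own selected cut would be heavier.\<close>

lemma card_selection:
  fixes wt :: "nat set \<Rightarrow> nat"
  assumes "A \<subseteq> VV" and S: "\<And>e. e \<in> A \<Longrightarrow> S e \<in> min_crossing N e"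
    and wt: "\<And>e e'. e \<in> A \<Longrightarrow> e' \<in> A \<Longrightarrow> lam e = lam e' \<Longrightarrow> root e = root e' \<Longrightarrow> S e \<in> min_crossing N e' \<Longrightarrow>
      S e = S e' \<or> wt (S e) < wt (S e')"
  shows "card (S ` A) \<le> n"
proof -
  obtain R where R: "R \<subseteq> A" "inj_on S R" "S ` A = S ` R" by (metis subset_image_inj subset_refl)
  have finR: "finite R" using R(1) assms(1) finite_VV by (meson finite_subset)
  have RV: "R \<subseteq> VV" using R(1) assms(1) by auto
  have "card R \<le> card {..<n}"
  proof (rule forest_card)
    show "R \<subseteq> {..<n} \<times> {..<n}"
    proof
      fix e assume "e \<in> R"
      then show "e \<in> {..<n} \<times> {..<n}" using VV_less[of e] RV by (cases e) auto
    qed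
    fix R' assume R': "R' \<subseteq> R" "R' \<noteq> {}"
    have finR': "finite R'" using R'(1) finR finite_subset by auto
    define m where "m = Min (lam ` R')"
    have "m \<in> lam ` R'" unfolding m_def using finR' R'(2) by (intro Min_in) auto
    then obtain e0 where e0: "e0 \<in> R'" "lam e0 = m" by auto
    have mle: "m \<le> lam e" if "e \<in> R'" for e unfolding m_def using finR' that by (intro Min_le) auto
    define B where "B = {e\<in>R'. lam e = m \<and> (fst e0, fst e) \<in> links {m..}}"
    have "e0 \<in> B" using e0 by (simp add: B_def)
    moreover have "finite B" using finR' by (simp add: B_def)
    ultimately have "finite (wt ` S ` B)" "wt ` S ` B \<noteq> {}" by auto
    then have "Max (wt ` S ` B) \<in> wt ` S ` B" by (rule Max_in)
    then obtain e where e: "e \<in> B" "wt (S e) = Max (wt ` S ` B)" by auto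
    have emax: "wt (S e') \<le> wt (S e)" if "e' \<in> B" for e'
      using e(2) \<open>finite (wt ` S ` B)\<close> that by simp
    have eR: "e \<in> R'" "lam e = m" "(fst e0, fst e) \<in> links {m..}" using e by (auto simp: B_def)
    have eA: "e \<in> A" "e \<in> VV" using eR(1) R'(1) R(1) assms(1) by auto
    have Se: "fst e \<in> S e" "snd e \<notin> S e" "cut_cap N (S e) = m" "st_cut N (S e)"
      using S[OF eA(1)] eR(2) by (auto simp: min_crossing_def crossing_cuts_def)
    \<comment> \<open>Remaining arcs have level at least \<open>m\<close>, so each has both ends in
      the class or neither; intersecting with the class switches off the arcs outside it.\<close>
    define Z where "Z = S e \<inter> {z. (fst e0, z) \<in> links {m..}}"
    have "(fst e \<in> Z) \<noteq> (snd e \<in> Z)" using Se eR(3) by (auto simp: Z_def)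
    moreover have "(fst e' \<in> Z) = (snd e' \<in> Z)" if e': "e' \<in> R' - {e}" for e'
    proof (rule ccontr)
      assume sep: "(fst e' \<in> Z) \<noteq> (snd e' \<in> Z)"
      have e'A: "e' \<in> A" "e' \<in> VV" using e' R'(1) R(1) assms(1) by auto
      have arc: "(fst e', snd e') \<in> links {m..}" using links_arc[OF e'A(2)] mle[of e'] e' by simp
      then have both: "(fst e0, fst e') \<in> links {m..}" "(fst e' \<in> S e) \<noteq> (snd e' \<in> S e)"
        using sep links_trans[OF _ arc] links_trans[OF _ links_sym[OF arc]] unfolding Z_def by blast+
      have "\<not> (fst e' \<notin> S e \<and> snd e' \<in> S e)"
        using not_entering[OF eA(2) e'A(2) _ S[OF eA(1)]] eR(2) mle[of e'] e' by simp
      then have lv: "fst e' \<in> S e" "snd e' \<notin> S e" using both(2) by auto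
      then have cr: "S e \<in> crossing_cuts N e'" using Se(4) by (simp add: crossing_cuts_def)
      then have lm: "lam e' = m" using lam1_le[OF cr] Se(3) mle[of e'] e' by simp
      then have "S e \<in> min_crossing N e'" using cr Se(3) by (simp add: min_crossing_def)
      moreover have "root e = root e'"
        unfolding root_def eR(2) lm
        by (rule least_eq) (rule links_trans[OF links_sym[OF eR(3)] both(1)])
      ultimately have "S e = S e' \<or> wt (S e) < wt (S e')" using wt[OF eA(1) e'A(1)] eR(2) lm by simp
      moreover have "e' \<in> B" using e' lm both(1) by (simp add: B_def)
      moreover have "S e \<noteq> S e'" using R(2) e' eR(1) R'(1) by (metis DiffE inj_onD insertI1 subsetD)
      ultimately show False using emax[of e'] by simp
    qed
    ultimately show "\<exists>e\<in>R'. \<exists>Z. (fst e \<in> Z) \<noteq> (snd e \<in> Z) \<and> (\<forall>e'\<in>R' - {e}. (fst e' \<in> Z) = (snd e' \<in> Z))"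
      using eR(1) by blast
  qed (use finR in auto)
  moreover have "card (S ` A) = card R" using R by (simp add: card_image)
  ultimately show ?thesis by simp
qed

lemma min_crossing_sub: "X \<in> min_crossing N e \<Longrightarrow> X \<subseteq> {..<n}"
  by (auto simp: min_crossing_def crossing_cuts_def st_cut_def V_eq)

lemma finite_min_crossing: "finite (min_crossing N e)"
  by (rule finite_subset[OF _ finite_crossing]) (auto simp: min_crossing_def)

lemma Union_Mlo:
  assumes "Mlo e \<noteq> {}"
  shows "\<Union>(Mlo e) \<in> Mlo e"
proof -
  have "\<Union>G \<in> Mlo e" if "finite G" "G \<noteq> {}" "G \<subseteq> Mlo e" for G
    using that by (induction rule: finite_ne_induct) (auto simp: Mlo_def intro: min_crossing_lattice)
  then show ?thesis using assms finite_min_crossing finite_subset[of "Mlo e" "min_crossing N e"] by (auto simp: Mlo_def)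
qed

lemma Inter_Mhi:
  assumes "Mhi e \<noteq> {}"
  shows "\<Inter>(Mhi e) \<in> Mhi e"
proof -
  have "\<Inter>G \<in> Mhi e" if "finite G" "G \<noteq> {}" "G \<subseteq> Mhi e" for G
    using that by (induction rule: finite_ne_induct) (auto simp: Mhi_def intro: min_crossing_lattice)
  then show ?thesis using assms finite_min_crossing finite_subset[of "Mhi e" "min_crossing N e"] by (auto simp: Mhi_def)
qed

text \<open>If the cut selected for \<open>e\<close> also minimises for \<open>e'\<close> with the
  same root, it belongs to \<open>Mlo e'\<close> and is contained in the cut selected for
  \<open>e'\<close>; so size is a suitable weight.\<close>

lemma card_Union_Mlo: "card ((\<lambda>e. \<Union>(Mlo e)) ` {e\<in>VV. Mlo e \<noteq> {}}) \<le> n"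
proof (rule card_selection[of _ _ card])
  fix e e' assume *: "e \<in> {e\<in>VV. Mlo e \<noteq> {}}" "e' \<in> {e\<in>VV. Mlo e \<noteq> {}}"
    "root e = root e'" "\<Union>(Mlo e) \<in> min_crossing N e'"
  have "\<Union>(Mlo e) \<in> Mlo e'" using Union_Mlo[of e] * by (auto simp: Mlo_def)
  then have sub: "\<Union>(Mlo e) \<subseteq> \<Union>(Mlo e')" by auto
  have "\<Union>(Mlo e') \<subseteq> {..<n}" using min_crossing_sub[of _ e'] unfolding Mlo_def by blast
  then have "finite (\<Union>(Mlo e'))" by (rule finite_subset) simp
  then show "\<Union>(Mlo e) = \<Union>(Mlo e') \<or> card (\<Union>(Mlo e)) < card (\<Union>(Mlo e'))"
    using sub psubset_card_mono by (metis psubsetI)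
next
  fix e assume "e \<in> {e\<in>VV. Mlo e \<noteq> {}}"
  then show "\<Union>(Mlo e) \<in> min_crossing N e" using Union_Mlo[of e] by (simp add: Mlo_def)
qed auto

lemma card_Inter_Mhi: "card ((\<lambda>e. \<Inter>(Mhi e)) ` {e\<in>VV. Mhi e \<noteq> {}}) \<le> n"
proof (rule card_selection[of _ _ "\<lambda>X. n - card X"])
  fix e e' assume *: "e \<in> {e\<in>VV. Mhi e \<noteq> {}}" "e' \<in> {e\<in>VV. Mhi e \<noteq> {}}"
    "root e = root e'" "\<Inter>(Mhi e) \<in> min_crossing N e'"
  have "\<Inter>(Mhi e) \<in> Mhi e'" using Inter_Mhi[of e] * by (auto simp: Mhi_def)
  then have sub: "\<Inter>(Mhi e') \<subseteq> \<Inter>(Mhi e)" by auto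
  have s: "\<Inter>(Mhi e) \<subseteq> {..<n}" by (rule min_crossing_sub[OF *(4)])
  have "card (\<Inter>(Mhi e)) \<le> n" using card_mono[OF _ s] by simp
  moreover have "card (\<Inter>(Mhi e')) < card (\<Inter>(Mhi e))" if "\<Inter>(Mhi e) \<noteq> \<Inter>(Mhi e')"
    using sub that finite_subset[OF s] by (intro psubset_card_mono) auto
  ultimately show "\<Inter>(Mhi e) = \<Inter>(Mhi e') \<or> n - card (\<Inter>(Mhi e)) < n - card (\<Inter>(Mhi e'))"
    using diff_less_mono2 by (metis order_less_le_trans)
next
  fix e assume "e \<in> {e\<in>VV. Mhi e \<noteq> {}}"
  then show "\<Inter>(Mhi e) \<in> min_crossing N e" using Inter_Mhi[of e] by (simp add: Mhi_def)
qed auto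

end

section \<open>Changing one capacity\<close>

lemma path_leaves:
  assumes "(x, y) \<in> r\<^sup>*" "x \<in> X" "y \<notin> X"
  shows "\<exists>p q. (p, q) \<in> r \<and> p \<in> X \<and> q \<notin> X \<and> (x, p) \<in> r\<^sup>* \<and> (q, y) \<in> r\<^sup>*"
  using assms
proof (induction rule: rtrancl_induct)
  case (step y z)
  show ?case
  proof (cases "y \<in> X")
    case True
    then show ?thesis using step.hyps step.prems by blast
  next
    case False
    then show ?thesis using step.IH step.prems step.hyps(2) by (meson rtrancl_into_rtrancl)
  qed
qed simp

definition noncrossing_cuts :: "'a network \<Rightarrow> 'a \<times> 'a \<Rightarrow> 'a set set" where
  "noncrossing_cuts N e = {X. st_cut N X \<and> \<not> (fst e \<in> X \<and> snd e \<notin> X)}"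

definition lam0 :: "'a network \<Rightarrow> 'a \<times> 'a \<Rightarrow> real" where
  "lam0 N e = Min (cut_cap N ` noncrossing_cuts N e)"

definition min_noncrossing :: "'a network \<Rightarrow> 'a \<times> 'a \<Rightarrow> 'a set set" where
  "min_noncrossing N e = {X\<in>noncrossing_cuts N e. cut_cap N X = lam0 N e}"

text \<open>Which of the cuts that \<open>e\<close> leaves (1) and the other cuts (0) are minimum after the change; 2
  stands for both.\<close>

definition change_kind :: "'a network \<Rightarrow> 'a \<times> 'a \<Rightarrow> real \<Rightarrow> nat" where
  "change_kind N e \<Delta> =
     (if noncrossing_cuts N e = {} then 1 else if crossing_cuts N e = {} then 0
      else if lam0 N e < lam1 N e + \<Delta> then 0 else if lam1 N e + \<Delta> < lam0 N e then 1 else 2)"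

definition kind_cuts :: "'a network \<Rightarrow> 'a \<times> 'a \<Rightarrow> nat \<Rightarrow> 'a set set" where
  "kind_cuts N e k = (if k = 1 then {} else min_noncrossing N e) \<union> (if k = 0 then {} else min_crossing N e)"

lemma change_cap_simps [simp]:
  "V (change_cap N e \<Delta>) = V N" "E (change_cap N e \<Delta>) = E N" "src (change_cap N e \<Delta>) = src N"
  "snk (change_cap N e \<Delta>) = snk N" "st_cut (change_cap N e \<Delta>) X = st_cut N X"
  "cap (change_cap N e \<Delta>) = (cap N)(e := cap N e + \<Delta>)"
  by (auto simp: change_cap_def st_cut_def)

context st_net
begin

lemma st_net_change: "e \<in> E N \<Longrightarrow> - cap N e \<le> \<Delta> \<Longrightarrow> st_net (change_cap N e \<Delta>)"
  unfolding change_cap_def by (rule st_net_upd_cap) (use cap_nonneg in auto)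

lemma cut_cap_change:
  "e \<in> E N \<Longrightarrow> cut_cap (change_cap N e \<Delta>) X = cut_cap N X + (if fst e \<in> X \<and> snd e \<notin> X then \<Delta> else 0)"
  unfolding change_cap_def by (subst cut_cap_upd) auto

lemma finite_noncrossing: "finite (noncrossing_cuts N e)"
  by (rule finite_subset[OF _ finite_cuts]) (auto simp: noncrossing_cuts_def)

lemma lam0_le: "X \<in> noncrossing_cuts N e \<Longrightarrow> lam0 N e \<le> cut_cap N X"
  unfolding lam0_def using finite_noncrossing by (intro Min_le) auto

lemma min_noncrossing_nonempty: "noncrossing_cuts N e \<noteq> {} \<Longrightarrow> min_noncrossing N e \<noteq> {}"
proof -
  assume "noncrossing_cuts N e \<noteq> {}"
  then have "lam0 N e \<in> cut_cap N ` noncrossing_cuts N e"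
    unfolding lam0_def using finite_noncrossing by (intro Min_in) simp_all
  then obtain X where "X \<in> noncrossing_cuts N e" "cut_cap N X = lam0 N e" by force
  then show ?thesis unfolding min_noncrossing_def by blast
qed

lemma cut_cases: "st_cut N X \<longleftrightarrow> X \<in> crossing_cuts N e \<or> X \<in> noncrossing_cuts N e"
  by (auto simp: crossing_cuts_def noncrossing_cuts_def)

lemma change_caps:
  assumes "e \<in> E N"
  shows "X \<in> crossing_cuts N e \<Longrightarrow> cut_cap (change_cap N e \<Delta>) X = cut_cap N X + \<Delta>"
    and "X \<in> noncrossing_cuts N e \<Longrightarrow> cut_cap (change_cap N e \<Delta>) X = cut_cap N X"
  using cut_cap_change[OF assms] by (auto simp: crossing_cuts_def noncrossing_cuts_def)

lemma mincuts_change: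
  assumes e: "e \<in> E N" and D: "- cap N e \<le> \<Delta>"
  shows "{X. st_mincut (change_cap N e \<Delta>) X} = kind_cuts N e (change_kind N e \<Delta>)"
    and "mincut_cap (change_cap N e \<Delta>) = (if change_kind N e \<Delta> = 1 then lam1 N e + \<Delta> else lam0 N e)"
proof -
  interpret N': st_net "change_cap N e \<Delta>" by (rule st_net_change[OF e D])
  let ?k = "change_kind N e \<Delta>"
  let ?c = "if ?k = 1 then lam1 N e + \<Delta> else lam0 N e"
  have cr: "lam1 N e + \<Delta> \<le> cut_cap (change_cap N e \<Delta>) X" if "X \<in> crossing_cuts N e" for X
    using change_caps(1)[OF e that] lam1_le[OF that] by simp
  have nc: "lam0 N e \<le> cut_cap (change_cap N e \<Delta>) X" if "X \<in> noncrossing_cuts N e" for X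
    using change_caps(2)[OF e that] lam0_le[OF that] by simp
  have ge: "?c \<le> cut_cap (change_cap N e \<Delta>) X" if "st_cut N X" for X
    using that[unfolded cut_cases[of X e]] cr[of X] nc[of X]
    by (auto simp: change_kind_def split: if_splits)
  have eq: "cut_cap (change_cap N e \<Delta>) X = ?c \<longleftrightarrow> X \<in> kind_cuts N e ?k" if "st_cut N X" for X
  proof (cases "X \<in> crossing_cuts N e")
    case True
    then have "X \<notin> noncrossing_cuts N e" by (auto simp: crossing_cuts_def noncrossing_cuts_def)
    moreover have "cut_cap (change_cap N e \<Delta>) X = ?c \<longleftrightarrow> ?k \<noteq> 0 \<and> cut_cap N X = lam1 N e"
      using True change_caps(1)[OF e True, of \<Delta>] lam1_le[OF True]
      by (auto simp: change_kind_def split: if_splits)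
    ultimately show ?thesis using True by (auto simp: kind_cuts_def min_crossing_def min_noncrossing_def)
  next
    case False
    then have T: "X \<in> noncrossing_cuts N e" using that cut_cases[of X e] by auto
    moreover have "cut_cap (change_cap N e \<Delta>) X = ?c \<longleftrightarrow> ?k \<noteq> 1 \<and> cut_cap N X = lam0 N e"
      using T change_caps(2)[OF e T, of \<Delta>] lam0_le[OF T]
      by (auto simp: change_kind_def split: if_splits)
    ultimately show ?thesis using False by (auto simp: kind_cuts_def min_crossing_def min_noncrossing_def)
  qed
  have sub: "st_cut N X" if "X \<in> kind_cuts N e k" for X k
    using that by (auto simp: kind_cuts_def min_crossing_def min_noncrossing_def crossing_cuts_def noncrossing_cuts_def split: if_splits)
  have "kind_cuts N e ?k \<noteq> {}"
    using min_crossing_nonempty[of e] min_noncrossing_nonempty[of e] st_cut_src cut_cases[of _ e]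
    by (auto simp: kind_cuts_def change_kind_def split: if_splits)
  then obtain Y where Y: "Y \<in> kind_cuts N e ?k" by auto
  obtain Z where Z: "st_cut N Z" "cut_cap (change_cap N e \<Delta>) Z = mincut_cap (change_cap N e \<Delta>)"
    using N'.ex_mincut unfolding N'.st_mincut_iff by auto
  have "mincut_cap (change_cap N e \<Delta>) \<le> ?c" using N'.mincut_le[of Y] eq[OF sub[OF Y]] Y sub[OF Y] by simp
  then show mc: "mincut_cap (change_cap N e \<Delta>) = ?c" using ge[OF Z(1)] Z(2) by linarith
  show "{X. st_mincut (change_cap N e \<Delta>) X} = kind_cuts N e ?k"
    unfolding N'.st_mincut_iff mc using eq sub by auto
qed

lemma lam_mincut:
  assumes "noncrossing_cuts N e \<noteq> {}" "crossing_cuts N e \<noteq> {}"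
  shows "mincut_cap N = min (lam0 N e) (lam1 N e)"
proof -
  obtain X where X: "st_cut N X" "cut_cap N X = mincut_cap N" using ex_mincut unfolding st_mincut_iff by auto
  obtain Y Z where "Y \<in> min_noncrossing N e" "Z \<in> min_crossing N e"
    using min_noncrossing_nonempty[OF assms(1)] min_crossing_nonempty[OF assms(2)] by blast
  then have "mincut_cap N \<le> lam0 N e" "mincut_cap N \<le> lam1 N e"
    using mincut_le[of Y] mincut_le[of Z]
    by (auto simp: min_noncrossing_def min_crossing_def noncrossing_cuts_def crossing_cuts_def)
  moreover have "lam0 N e \<le> mincut_cap N \<or> lam1 N e \<le> mincut_cap N"
    using X cut_cases[of X e] lam0_le[of X e] lam1_le[of X e] by auto
  ultimately show ?thesis by linarith
qed

lemma lam1_mincut: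
  assumes "noncrossing_cuts N e = {}"
  shows "lam1 N e = mincut_cap N" "crossing_cuts N e \<noteq> {}"
proof -
  show c: "crossing_cuts N e \<noteq> {}" using st_cut_src cut_cases[of _ e] assms by auto
  obtain X where X: "st_cut N X" "cut_cap N X = mincut_cap N" using ex_mincut unfolding st_mincut_iff by auto
  obtain Z where "Z \<in> min_crossing N e" using min_crossing_nonempty[OF c] by blast
  then have "mincut_cap N \<le> lam1 N e" using mincut_le[of Z] by (auto simp: min_crossing_def crossing_cuts_def)
  moreover have "lam1 N e \<le> mincut_cap N" using X cut_cases[of X e] lam1_le[of X e] assms by auto
  ultimately show "lam1 N e = mincut_cap N" by simp
qed

definition avoiding :: "'a \<Rightarrow> 'a set set" where
  "avoiding u = {X. st_cut N X \<and> u \<notin> X \<and> (\<forall>Y. st_cut N Y \<longrightarrow> u \<notin> Y \<longrightarrow> cut_cap N X \<le> cut_cap N Y)}"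

definition containing :: "'a \<Rightarrow> 'a set set" where
  "containing v = {X. st_cut N X \<and> v \<in> X \<and> (\<forall>Y. st_cut N Y \<longrightarrow> v \<in> Y \<longrightarrow> cut_cap N X \<le> cut_cap N Y)}"

text \<open>No cut avoiding the tail is left by \<open>e\<close>, so once such a cut attains
  \<open>lam0\<close>, this is the minimum over all cuts avoiding the tail.\<close>

lemma min_noncrossing_avoiding:
  assumes "{X\<in>min_noncrossing N e. fst e \<notin> X} \<noteq> {}"
  shows "{X\<in>min_noncrossing N e. fst e \<notin> X} = avoiding (fst e)"
proof -
  obtain Y where Y: "st_cut N Y" "fst e \<notin> Y" "cut_cap N Y = lam0 N e"
    using assms by (auto simp: min_noncrossing_def noncrossing_cuts_def)
  have "lam0 N e \<le> cut_cap N X" if "st_cut N X" "fst e \<notin> X" for X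
    using lam0_le[of X e] that by (simp add: noncrossing_cuts_def)
  then show ?thesis unfolding avoiding_def min_noncrossing_def noncrossing_cuts_def
    using Y by (auto intro!: antisym)
qed

lemma min_noncrossing_containing:
  assumes "{X\<in>min_noncrossing N e. snd e \<in> X} \<noteq> {}"
  shows "{X\<in>min_noncrossing N e. snd e \<in> X} = containing (snd e)"
proof -
  obtain Y where Y: "st_cut N Y" "snd e \<in> Y" "cut_cap N Y = lam0 N e"
    using assms by (auto simp: min_noncrossing_def noncrossing_cuts_def)
  have "lam0 N e \<le> cut_cap N X" if "st_cut N X" "snd e \<in> X" for X
    using lam0_le[of X e] that by (simp add: noncrossing_cuts_def)
  then show ?thesis unfolding containing_def min_noncrossing_def noncrossing_cuts_def
    using Y by (auto intro!: antisym)
qed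

end

section \<open>Arcs on the verge of being vital\<close>

context tight_flow
begin

text \<open>The assumption on the capacity says that \<open>e\<close> alone accounts for the excess
  of \<open>X\<close> over the minimum, so no other arc has residual capacity leaving
  \<open>X\<close>.\<close>

lemma R_leaving:
  assumes X: "st_cut N X" and e: "e \<in> E N"
    and c: "cut_cap N X = mincut_cap N + (if fst e \<in> X \<and> snd e \<notin> X then cap N e - f e else 0) +
      (if fst e \<notin> X \<and> snd e \<in> X then f e else 0)"
    and pq: "(p, q) \<in> R" "p \<in> X" "q \<notin> X"
  shows "(p, q) = e \<or> (q, p) = e"
proof (rule ccontr)
  assume ne: "\<not> ?thesis"
  let ?g = "\<lambda>e. (if fst e \<in> X \<and> snd e \<notin> X then cap N e - f e else 0) + (if fst e \<notin> X \<and> snd e \<in> X then f e else 0)"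
  have nn: "0 \<le> ?g a" if "a \<in> E N" for a using f_bounds[OF that] by auto
  have "sum ?g (E N) = ?g e + sum ?g (E N - {e})"
    using finite_E e by (rule sum.remove)
  moreover have "sum ?g (E N) = ?g e" using residual_cut_cap[OF X] c by linarith
  ultimately have "sum ?g (E N - {e}) = 0" by linarith
  then have z: "?g a = 0" if "a \<in> E N" "a \<noteq> e" for a
    using nn finite_E that by (subst (asm) sum_nonneg_eq_0_iff) auto
  from pq(1) consider "(p, q) \<in> E N" "f (p, q) < cap N (p, q)" | "(q, p) \<in> E N" "0 < f (q, p)"
    by (auto simp: R_iff)
  then show False
  proof cases
    case 1
    then show False using z[of "(p, q)"] ne pq by simp
  next
    case 2
    then show False using z[of "(q, p)"] ne pq by simp
  qed
qed

lemma residual_ge: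
  assumes X: "st_cut N X" and e: "e \<in> E N" "fst e \<notin> X" "snd e \<in> X"
  shows "mincut_cap N + f e \<le> cut_cap N X"
proof -
  let ?g = "\<lambda>e. (if fst e \<in> X \<and> snd e \<notin> X then cap N e - f e else 0) + (if fst e \<notin> X \<and> snd e \<in> X then f e else 0)"
  have nn: "0 \<le> ?g a" if "a \<in> E N" for a using f_bounds[OF that] by auto
  have "?g e \<le> sum ?g (E N)" using finite_E e nn by (intro member_le_sum) auto
  then show ?thesis using residual_cut_cap[OF X] e by simp
qed

definition VV :: "('a \<times> 'a) set" where
  "VV = {e\<in>E N. crossing_cuts N e \<noteq> {} \<and> (lam1 N e < mincut_cap N + cap N e \<or>
     lam1 N e = mincut_cap N + cap N e \<and> f e = cap N e \<and>
     \<not> (\<exists>X. st_cut N X \<and> fst e \<notin> X \<and> snd e \<in> X \<and> cut_cap N X = mincut_cap N + cap N e))}"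

text \<open>Vital arcs are handled by uncrossing. A saturated arc forces every cut that it enters to
  cost at least \<open>mincut_cap N + cap N e'\<close>; a minimiser of the same or a lower level
  could only meet this with equality, which \<open>VV\<close> excludes.\<close>

lemma VV_not_entering:
  assumes e: "e \<in> VV" and e': "e' \<in> VV" and le: "lam1 N e \<le> lam1 N e'" and X: "X \<in> min_crossing N e"
  shows "\<not> (fst e' \<notin> X \<and> snd e' \<in> X)"
proof (cases "lam1 N e' < mincut_cap N + cap N e'")
  case True
  show ?thesis by (rule vital_not_entering[OF _ _ X]) (use e e' True in \<open>auto simp: VV_def\<close>)
next
  case False
  then have b: "e' \<in> E N" "lam1 N e' = mincut_cap N + cap N e'" "f e' = cap N e'"
    "\<not> (\<exists>X. st_cut N X \<and> fst e' \<notin> X \<and> snd e' \<in> X \<and> cut_cap N X = mincut_cap N + cap N e')"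
    using e' by (auto simp: VV_def)
  have X': "st_cut N X" "cut_cap N X = lam1 N e" using X by (auto simp: min_crossing_def crossing_cuts_def)
  show ?thesis
  proof
    assume ent: "fst e' \<notin> X \<and> snd e' \<in> X"
    then have "cut_cap N X = mincut_cap N + cap N e'"
      using residual_ge[OF X'(1) b(1)] b(2,3) X'(2) le by simp
    then show False using b(4) ent X'(1) by blast
  qed
qed

text \<open>The excess of \<open>X\<close> equals the flow on the arc, so in the residual graph only
  the reversed arc leaves \<open>X\<close>: it is a bridge. Its ends lie in one component, since no
  minimum cut is left by \<open>(u, v)\<close> and both ends are on source-sink walks.\<close>

lemma borderline_saturated:
  assumes e: "(u, v) \<in> E N" "0 < cap N (u, v)" "f (u, v) = cap N (u, v)"
    and lam: "lam1 N (u, v) = mincut_cap N + cap N (u, v)"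
    and X: "st_cut N X" "u \<notin> X" "v \<in> X" "cut_cap N X = mincut_cap N + cap N (u, v)"
  shows "(v, u) \<in> strong_bridges R"
proof -
  have vu: "(v, u) \<in> R" using e by (auto simp: R_iff)
  have "(v, u) \<notin> (R - {(v, u)})\<^sup>*"
  proof
    assume "(v, u) \<in> (R - {(v, u)})\<^sup>*"
    then have "u \<in> X"
    proof (rule rtrancl_closed[OF _ X(3)])
      fix p q assume pq: "(p, q) \<in> R - {(v, u)}" "p \<in> X"
      show "q \<in> X"
      proof (rule ccontr)
        assume "q \<notin> X"
        then have "(p, q) = (u, v) \<or> (q, p) = (u, v)"
          by (intro R_leaving[OF X(1) e(1)]) (use X e pq in auto)
        then show False using pq X by auto
      qed
    qed
    then show False using X by simp
  qed
  moreover have "(u, v) \<in> R\<^sup>*"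
  proof -
    have op: "on_path N u" "on_path N v" using flow_on_path[OF e(1)] e by auto
    have uV: "u \<in> V N" using arc_ends[OF e(1)] by simp
    have us: "(u, src N) \<in> R\<^sup>*" using reach_src[OF mincut_pos[OF op(1)]] op(1) by (auto simp: on_path_def)
    have tv: "(snk N, v) \<in> R\<^sup>*" using snk_reach[OF mincut_pos[OF op(1)]] op(2) by (auto simp: on_path_def)
    show ?thesis
    proof (cases "(u, snk N) \<in> R\<^sup>*")
      case True
      then show ?thesis using tv by (rule rtrancl_trans)
    next
      case False
      let ?Z = "{y. (src N, y) \<in> R\<^sup>* \<or> (u, y) \<in> R\<^sup>*}"
      have Z: "st_mincut N ?Z" by (rule mincut_reach[OF uV False])
      have "v \<in> ?Z"
      proof (rule ccontr)
        assume "v \<notin> ?Z"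
        then have "?Z \<in> crossing_cuts N (u, v)" using Z by (simp add: crossing_cuts_def st_mincut_iff)
        then have "lam1 N (u, v) \<le> mincut_cap N" using lam1_le[of ?Z "(u, v)"] Z by (simp add: st_mincut_iff)
        then show False using lam e(2) by simp
      qed
      then show ?thesis using rtrancl_trans[OF us, of v] by auto
    qed
  qed
  ultimately show ?thesis using vu by (simp add: strong_bridges_def)
qed

text \<open>The arc is empty, so its own residual capacity is the whole excess of \<open>Y\<close>,
  and no other residual arc leaves \<open>Y\<close>.\<close>

lemma borderline_empty_leaving:
  assumes e: "(u, v) \<in> E N" "f (u, v) = 0"
    and lam: "lam1 N (u, v) = mincut_cap N + cap N (u, v)"
    and Y: "Y \<in> min_crossing N (u, v)" and pq: "(p, q) \<in> R" "p \<in> Y" "q \<notin> Y"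
  shows "(p, q) = (u, v)"
proof -
  have Y': "st_cut N Y" "u \<in> Y" "v \<notin> Y" "cut_cap N Y = lam1 N (u, v)"
    using Y by (auto simp: min_crossing_def crossing_cuts_def)
  have "(p, q) = (u, v) \<or> (q, p) = (u, v)"
    by (rule R_leaving[OF Y'(1) e(1) _ pq]) (use Y' e lam in auto)
  then show ?thesis using pq Y' by auto
qed

lemma borderline_empty:
  assumes e: "(u, v) \<in> E N" "0 < cap N (u, v)" "f (u, v) = 0" "crossing_cuts N (u, v) \<noteq> {}"
    and lam: "lam1 N (u, v) = mincut_cap N + cap N (u, v)" and vu: "(v, u) \<in> R\<^sup>*"
  shows "(u, v) \<in> strong_bridges R"
proof -
  obtain Y where Y: "Y \<in> min_crossing N (u, v)" using min_crossing_nonempty[OF e(4)] by auto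
  then have Y': "u \<in> Y" "v \<notin> Y" by (auto simp: min_crossing_def crossing_cuts_def)
  have "(u, v) \<notin> (R - {(u, v)})\<^sup>*"
  proof
    assume "(u, v) \<in> (R - {(u, v)})\<^sup>*"
    then have "v \<in> Y"
      by (rule rtrancl_closed[OF _ Y'(1)]) (use borderline_empty_leaving[OF e(1,3) lam Y] in auto)
    then show False using Y' by simp
  qed
  moreover have "(u, v) \<in> R" using e by (auto simp: R_iff)
  ultimately show ?thesis using vu by (simp add: strong_bridges_def)
qed

text \<open>The converse is included because a saturated arc appears reversed in
  \<open>R\<close>.\<close>

definition exceptional :: "('a \<times> 'a) set" where
  "exceptional = {e\<in>E N. 0 < f e \<and> f e < cap N e} \<union> strong_bridges R \<union> (strong_bridges R)\<inverse>"

lemma card_exceptional: "finite exceptional" "card exceptional \<le> 5 * card (V N)"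
proof -
  have R: "R \<subseteq> V N \<times> V N" using R_V by auto
  note SB = card_strong_bridges[OF finite_V R]
  show "finite exceptional" unfolding exceptional_def using finite_E SB(1) by simp
  have "card exceptional \<le> card {e\<in>E N. 0 < f e \<and> f e < cap N e} + card (strong_bridges R) + card ((strong_bridges R)\<inverse>)"
    unfolding exceptional_def by (rule order_trans[OF card_Un_le add_right_mono[OF card_Un_le]])
  then show "card exceptional \<le> 5 * card (V N)" using SB(2) f_fractional by simp
qed

end

section \<open>Good labels\<close>

lemma good_of_layered:
  fixes N :: "nat network"
  assumes "st_net N" "V N = {..<n}" "layered Q {X. st_mincut N X} {} ts"
  shows "good_labels N (test_label Q b ts) (junk_label n (src N) (snk N) (pos_arcs N))"
proof -
  interpret st_net N by fact
  have T: "(test_label Q b ts x < test_label Q b ts y \<longrightarrow> (\<exists>X\<in>{X. st_mincut N X}. x \<in> X \<and> y \<notin> X)) \<and>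
    (test_label Q b ts x = test_label Q b ts y \<longrightarrow> (\<forall>X\<in>{X. st_mincut N X}. x \<in> X \<longleftrightarrow> y \<in> X))" for x y
    by (rule test_label_layered[OF assms(3)]) auto
  have lt: "\<exists>X. st_mincut N X \<and> x \<in> X \<and> y \<notin> X" if "test_label Q b ts x < test_label Q b ts y" for x y
    using T[of x y] that by auto
  have eq: "x \<in> X \<longleftrightarrow> y \<in> X" if "test_label Q b ts x = test_label Q b ts y" "st_mincut N X" for x y X
    using T[of x y] that by auto
  have snk: "snk N \<notin> X" if "st_mincut N X" for X using that by (simp add: st_mincut_iff st_cut_def)
  show ?thesis
    unfolding good_labels_def
  proof (intro conjI ballI impI allI)
    show "\<exists>X. st_mincut N X \<and> x \<in> X \<and> y \<notin> X" if "test_label Q b ts x < test_label Q b ts y" for x y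
      by (rule lt[OF that])
    show "x \<in> X \<longleftrightarrow> y \<in> X" if "test_label Q b ts x = test_label Q b ts y" "st_mincut N X" for x y X
      by (rule eq[OF that])
    show "junk_label n (src N) (snk N) (pos_arcs N) x = junk_label n (src N) (snk N) (pos_arcs N) y \<longleftrightarrow>
      on_path N x \<and> on_path N y \<or> \<not> on_path N x \<and> \<not> on_path N y \<and> (x, y) \<in> (pos_arcs N)\<^sup>* \<and> (y, x) \<in> (pos_arcs N)\<^sup>*"
      if "x \<in> V N" "y \<in> V N" for x y
      unfolding on_path_def using that assms(2) by (intro junk_label_eq_iff) auto
    show "(\<forall>a\<in>V N. test_label Q b ts a = test_label Q b ts (snk N) \<longrightarrow> (\<forall>X. st_mincut N X \<longrightarrow> a \<notin> X)) \<or>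
      (\<forall>a\<in>V N. test_label Q b ts a = test_label Q b ts (src N) \<longrightarrow> (\<forall>X. st_mincut N X \<longrightarrow> a \<in> X))"
      using eq snk by blast
  qed
qed

lemma (in st_net) finite_mincut_sub: "st_mincut N X \<Longrightarrow> X \<subseteq> V N"
  by (simp add: st_mincut_iff st_cut_def)

lemma layered_single:
  fixes N :: "nat network"
  assumes "st_net N" "V N = {..<n}"
  shows "layered (n * n + n + 1) {X. st_mincut N X} {} [(\<Union>{X. st_mincut N X}, rank n {X. st_mincut N X})]"
proof -
  interpret st_net N by fact
  interpret cut_family n "{X. st_mincut N X}"
    by unfold_locales (use finite_mincut_sub assms(2) st_mincut_Int in auto)
  have U: "\<Union>{X. st_mincut N X} \<in> {X. st_mincut N X}"
    by (rule CollectI, rule st_mincut_Union) (use ex_mincut in blast)+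
  show ?thesis
  proof (rule layeredI[OF U rank_less_bound])
    fix x y assume "x \<in> \<Union>{X. st_mincut N X} - {}" "y \<in> \<Union>{X. st_mincut N X} - {}"
    then have n: "x < n" "y < n" using finite_mincut_sub assms(2) by auto
    show "(rank n {X. st_mincut N X} x < rank n {X. st_mincut N X} y \<longrightarrow> (\<exists>X\<in>{X. st_mincut N X}. x \<in> X \<and> y \<notin> X)) \<and>
      (rank n {X. st_mincut N X} x = rank n {X. st_mincut N X} y \<longrightarrow> (\<forall>X\<in>{X. st_mincut N X}. (x \<in> X) = (y \<in> X)))"
    proof (intro conjI impI ballI)
      show "\<exists>X\<in>{X. st_mincut N X}. x \<in> X \<and> y \<notin> X" if "rank n {X. st_mincut N X} x < rank n {X. st_mincut N X} y"
        by (rule rank_lessD[OF n that])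
      show "(x \<in> X) = (y \<in> X)" if "rank n {X. st_mincut N X} x = rank n {X. st_mincut N X} y" "X \<in> {X. st_mincut N X}" for X
        by (rule rank_eqD[OF n that])
    qed
  qed auto
qed

text \<open>Deleting an arc on the verge of being vital that carries no flow changes the residual graph
  only by that one arc.\<close>

lemma (in tight_flow) good_labels_delete_empty:
  fixes cl :: "'a \<Rightarrow> nat"
  assumes e: "(u, v) \<in> E N" "0 < cap N (u, v)" "f (u, v) = 0"
    and lam: "lam1 N (u, v) = mincut_cap N + cap N (u, v)" and vu: "(v, u) \<notin> R\<^sup>*"
    and sub: "\<And>X. st_mincut N X \<Longrightarrow> st_mincut (change_cap N (u, v) (- cap N (u, v))) X"
    and new: "\<And>X. st_mincut (change_cap N (u, v) (- cap N (u, v))) X \<Longrightarrow> st_mincut N X \<or> X \<in> min_crossing N (u, v)"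
    and lt: "\<And>x y. x \<in> V N \<Longrightarrow> y \<in> V N \<Longrightarrow> cl x < cl y \<Longrightarrow> \<exists>X. st_mincut N X \<and> x \<in> X \<and> y \<notin> X"
    and eq: "\<And>x y X. cl x = cl y \<Longrightarrow> st_mincut N X \<Longrightarrow> x \<in> X \<longleftrightarrow> y \<in> X"
    and jl: "\<And>x y. x \<in> V N \<Longrightarrow> y \<in> V N \<Longrightarrow> jl x = jl y \<longleftrightarrow>
      on_path (change_cap N (u, v) (- cap N (u, v))) x \<and> on_path (change_cap N (u, v) (- cap N (u, v))) y \<or>
      \<not> on_path (change_cap N (u, v) (- cap N (u, v))) x \<and> \<not> on_path (change_cap N (u, v) (- cap N (u, v))) y \<and>
      (x, y) \<in> (pos_arcs (change_cap N (u, v) (- cap N (u, v))))\<^sup>* \<and> (y, x) \<in> (pos_arcs (change_cap N (u, v) (- cap N (u, v))))\<^sup>*"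
  shows "good_labels (change_cap N (u, v) (- cap N (u, v))) cl jl"
proof -
  let ?N = "change_cap N (u, v) (- cap N (u, v))"
  have pa: "pos_arcs ?N \<subseteq> pos_arcs N" by (auto simp: pos_arcs_def split: if_splits)
  have op: "on_path N x" if "on_path ?N x" for x
    using that rtrancl_mono[OF pa] by (auto simp: on_path_def)
  \<comment> \<open>An old residual walk leaves no old minimum cut, so the cut it leaves is a
    minimiser of \<open>(u, v)\<close>; the walk must then pass through this very arc.\<close>
  have leave: "(x, u) \<in> R\<^sup>* \<and> (v, y) \<in> R\<^sup>*" if X: "st_mincut ?N X" "x \<in> X" "y \<notin> X" and xy: "(x, y) \<in> R\<^sup>*" for x y X
  proof -
    have M: "X \<in> min_crossing N (u, v)" using new[OF X(1)] mincut_star[of X x y] X xy by auto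
    obtain p q where "(p, q) \<in> R" "p \<in> X" "q \<notin> X" "(x, p) \<in> R\<^sup>*" "(q, y) \<in> R\<^sup>*"
      using path_leaves[OF xy X(2,3)] by auto
    then show ?thesis using borderline_empty_leaving[OF e(1,3) lam M] by auto
  qed
  have st: "src N \<in> X \<and> snk N \<notin> X" if "st_mincut ?N X" for X
    using that by (simp add: st_mincut_def st_cut_def)
  show ?thesis
    unfolding good_labels_def
  proof (intro conjI ballI impI allI)
    fix x y assume xy: "x \<in> V ?N" "y \<in> V ?N"
    show "\<exists>X. st_mincut ?N X \<and> x \<in> X \<and> y \<notin> X" if "cl x < cl y"
      using lt[of x y] that xy sub by auto
    show "jl x = jl y \<longleftrightarrow> on_path ?N x \<and> on_path ?N y \<or>
      \<not> on_path ?N x \<and> \<not> on_path ?N y \<and> (x, y) \<in> (pos_arcs ?N)\<^sup>* \<and> (y, x) \<in> (pos_arcs ?N)\<^sup>*"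
      using jl xy by simp
    fix X assume *: "on_path ?N x" "on_path ?N y" "cl x = cl y" "st_mincut ?N X"
    have xV: "x \<in> V N" "y \<in> V N" using xy by simp_all
    have xyR: "(x, y) \<in> R\<^sup>*" by (rule unseparated_reach[OF op[OF *(1)] op[OF *(2)] xV(1) iffD1[OF eq[OF *(3)]]])
    have yxR: "(y, x) \<in> R\<^sup>*" by (rule unseparated_reach[OF op[OF *(2)] op[OF *(1)] xV(2) iffD2[OF eq[OF *(3)]]])
    show "x \<in> X \<longleftrightarrow> y \<in> X"
    proof (rule ccontr)
      assume "\<not> ?thesis"
      then consider "x \<in> X" "y \<notin> X" | "y \<in> X" "x \<notin> X" by blast
      then have "(v, u) \<in> R\<^sup>*"
      proof cases
        case 1
        then have "(x, u) \<in> R\<^sup>*" "(v, y) \<in> R\<^sup>*" using leave[OF *(4) _ _ xyR] by auto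
        then show ?thesis using rtrancl_trans[OF rtrancl_trans[OF _ yxR]] by blast
      next
        case 2
        then have "(y, u) \<in> R\<^sup>*" "(v, x) \<in> R\<^sup>*" using leave[OF *(4) _ _ yxR] by auto
        then show ?thesis using rtrancl_trans[OF rtrancl_trans[OF _ xyR]] by blast
      qed
      then show False using vu by simp
    qed
  next
    show "(\<forall>a\<in>V ?N. cl a = cl (snk ?N) \<longrightarrow> (\<forall>X. st_mincut ?N X \<longrightarrow> a \<notin> X)) \<or>
      (\<forall>b\<in>V ?N. cl b = cl (src ?N) \<longrightarrow> (\<forall>X. st_mincut ?N X \<longrightarrow> b \<in> X))"
    proof (rule ccontr)
      assume "\<not> ?thesis"
      \<comment> \<open>If both alternatives failed, the source would reach \<open>u\<close> and
        \<open>v\<close> would reach the sink in the old residual graph, with \<open>(u, v)\<close>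
        completing a residual walk from source to sink.\<close>
      then obtain a X b Y where a: "a \<in> V N" "cl a = cl (snk N)" "st_mincut ?N X" "a \<in> X"
        and b: "b \<in> V N" "cl b = cl (src N)" "st_mincut ?N Y" "b \<notin> Y" by auto
      have "\<not> (\<exists>Z. st_mincut N Z \<and> a \<in> Z)"
        using eq[OF a(2)] by (auto simp: st_mincut_iff st_cut_def)
      then have "(a, snk N) \<in> R\<^sup>*" using in_mincut_iff[OF a(1)] by blast
      then have 1: "(v, snk N) \<in> R\<^sup>*" using leave[OF a(3,4)] st[OF a(3)] by blast
      have "\<forall>Z. st_mincut N Z \<longrightarrow> b \<in> Z"
        using eq[OF b(2)] by (auto simp: st_mincut_iff st_cut_def)
      then have "(src N, b) \<in> R\<^sup>*" using in_all_mincuts_iff by blast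
      then have 2: "(src N, u) \<in> R\<^sup>*" using leave[OF b(3) _ b(4)] st[OF b(3)] by blast
      have "(u, v) \<in> R" using e by (auto simp: R_iff)
      then have "(src N, snk N) \<in> R\<^sup>*" using 1 2 by (meson rtrancl_into_rtrancl rtrancl_trans)
      then show False using src_not_snk by simp
    qed
  qed
qed

section \<open>The pool of arrays\<close>

text \<open>The size comes first, so that a cut is read in time proportional to its size; hence rows
  of \<open>n + 1\<close> cells.\<close>

definition cut_array :: "nat set \<Rightarrow> nat \<Rightarrow> nat" where
  "cut_array C i = (if i = 0 then card C else if i \<le> card C then sorted_list_of_set C ! (i - 1) else 0)"

locale sensitivity = tight_flow N f for N :: "nat network" and f +
  fixes n :: nat
  assumes V_n: "V N = {..<n}" and cap_pos: "e \<in> E N \<Longrightarrow> 0 < cap N e"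
begin

sublocale lam: laminar_arcs N n VV
proof
  show "V N = {..<n}" by (rule V_n)
  show "VV \<subseteq> E N" unfolding VV_def by blast
  show "crossing_cuts N e \<noteq> {}" if "e \<in> VV" for e using that unfolding VV_def by blast
  show "\<not> (fst e' \<notin> X \<and> snd e' \<in> X)" if "e \<in> VV" "e' \<in> VV" "lam1 N e \<le> lam1 N e'" "X \<in> min_crossing N e" for e e' X
    using VV_not_entering[OF that] by simp
qed

definition deleted :: "nat \<times> nat \<Rightarrow> nat set set" where
  "deleted e = {X. st_mincut (change_cap N e (- cap N e)) X}"

abbreviation "base \<equiv> {X. st_mincut N X}"
abbreviation "lows \<equiv> {e\<in>VV. lam.Mlo e \<noteq> {}}"
abbreviation "highs \<equiv> {e\<in>VV. lam.Mhi e \<noteq> {}}"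

definition sets :: "nat set set" where
  "sets = (\<lambda>u. \<Union>(avoiding u)) ` {..<n} \<union> (\<lambda>v. \<Union>(containing v)) ` {..<n} \<union>
     (\<lambda>e. \<Union>(lam.Mlo e)) ` lows \<union> (\<lambda>e. \<Inter>(lam.Mhi e)) ` highs \<union> Union ` lam.Dhi ` highs \<union>
     {\<Union>base} \<union> (\<lambda>e. \<Union>(deleted e)) ` (exceptional \<inter> E N)"

definition families :: "nat set set set" where
  "families = avoiding ` {..<n} \<union> containing ` {..<n} \<union> lam.Dlo ` lows \<union> lam.Dhi ` highs \<union> {base} \<union>
     deleted ` (exceptional \<inter> E N)"

definition junk :: "nat \<times> nat \<Rightarrow> bool \<Rightarrow> nat \<Rightarrow> nat" where
  "junk e z = junk_label n (src N) (snk N) (if z then E N - {e} else E N)"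

definition pool :: "(nat \<Rightarrow> nat) set" where
  "pool = indic ` sets \<union> cut_array ` sets \<union> rank n ` families \<union> (\<lambda>e. junk e True) ` E N \<union>
     {junk_label n (src N) (snk N) (E N), \<lambda>_. 0, \<lambda>_. 1}"

text \<open>Five tests are what \<open>layering\<close> uses: one each for \<open>L1\<close>,
  \<open>Mlo\<close> and \<open>L3\<close>, and two for \<open>Mhi\<close>.\<close>

definition tests_ok :: "(nat set \<times> (nat \<Rightarrow> nat)) list \<Rightarrow> bool" where
  "tests_ok ts \<longleftrightarrow> length ts \<le> 5 \<and> (\<forall>(Z, r)\<in>set ts. Z \<in> sets \<and> r \<in> insert (\<lambda>_. 0) (rank n ` families))"

lemma finite_lows: "finite lows" "finite highs"
  using lam.finite_VV by auto

lemma finite_pool_parts: "finite sets" "finite families"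
  unfolding sets_def families_def using finite_lows card_exceptional(1) by auto

lemma card_Un_add: "card A \<le> a \<Longrightarrow> card B \<le> b \<Longrightarrow> card (A \<union> B) \<le> a + b"
  using card_Un_le[of A B] by linarith

lemma card_parts: "card sets \<le> 10 * n + 1" "card families \<le> 9 * n + 1"
proof -
  have ex: "card (exceptional \<inter> E N) \<le> 5 * n"
    using card_exceptional card_mono[of exceptional "exceptional \<inter> E N"] V_n by simp
  have im: "card (g ` {..<n}) \<le> n" for g :: "nat \<Rightarrow> 'b" using card_image_le[of "{..<n}" g] by simp
  have im2: "card (g ` (exceptional \<inter> E N)) \<le> 5 * n" for g :: "nat \<times> nat \<Rightarrow> 'b"
    using card_image_le[of "exceptional \<inter> E N" g] card_exceptional(1) ex by simp
  have dh: "card (Union ` lam.Dhi ` highs) \<le> n"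
    using card_image_le[of "lam.Dhi ` highs" Union] lam.card_Dhi finite_lows by simp
  have one: "card {x} \<le> 1" for x :: 'b by simp
  have "card sets \<le> n + n + n + n + n + 1 + 5 * n"
    unfolding sets_def by (intro card_Un_add im im2 dh lam.card_Union_Mlo lam.card_Inter_Mhi) simp
  then show "card sets \<le> 10 * n + 1" by simp
  have "card families \<le> n + n + n + n + 1 + 5 * n"
    unfolding families_def by (intro card_Un_add im im2 lam.card_Dlo lam.card_Dhi) simp
  then show "card families \<le> 9 * n + 1" by simp
qed

lemma E_n: "E N \<subseteq> {..<n} \<times> {..<n}"
  using arcs_wf V_n by simp

text \<open>Two arrays for each of the \<open>10 * n + 1\<close> sets, one for each of the
  \<open>9 * n + 1\<close> families, \<open>4 * n + 1\<close> arrays of labels for deletions, and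
  three more.\<close>

lemma card_pool: "finite pool" "card pool \<le> 33 * n + 7"
proof -
  show "finite pool" unfolding pool_def using finite_pool_parts finite_E by simp
  have i: "card (g ` sets) \<le> 10 * n + 1" for g :: "nat set \<Rightarrow> 'b"
    using card_image_le[OF finite_pool_parts(1), of g] card_parts(1) by simp
  have r: "card (rank n ` families) \<le> 9 * n + 1"
    using card_image_le[OF finite_pool_parts(2), of "rank n"] card_parts(2) by simp
  have j: "card ((\<lambda>e. junk e True) ` E N) \<le> 4 * n + 1"
    unfolding junk_def using card_junk_labels(2)[OF E_n] by simp
  have three: "card {a, b, c} \<le> 3" for a b c :: "nat \<Rightarrow> nat"
    using card_insert_le_m1[of 3 "{b, c}" a] card_insert_le_m1[of 2 "{c}" b] by simp
  have "card pool \<le> (10 * n + 1) + (10 * n + 1) + (9 * n + 1) + (4 * n + 1) + 3"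
    unfolding pool_def by (intro card_Un_add i r j three)
  then show "card pool \<le> 33 * n + 7" by simp
qed

lemma families_cut_family: "F \<in> families \<Longrightarrow> X \<in> F \<Longrightarrow> X \<subseteq> {..<n}"
  unfolding families_def avoiding_def containing_def lam.Dlo_def lam.Dhi_def lam.D_def lam.F_def deleted_def
  by (auto simp: st_cut_def st_mincut_def V_n)

lemma sets_sub: "Z \<in> sets \<Longrightarrow> Z \<subseteq> {..<n}"
proof -
  assume "Z \<in> sets"
  then consider u where "Z = \<Union>(avoiding u)" | v where "Z = \<Union>(containing v)" | e where "e \<in> lows" "Z = \<Union>(lam.Mlo e)"
    | e where "e \<in> highs" "Z = \<Inter>(lam.Mhi e)" | e where "Z = \<Union>(lam.Dhi e)" | "Z = \<Union>base" | e where "Z = \<Union>(deleted e)"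
    unfolding sets_def by blast
  then show "Z \<subseteq> {..<n}"
  proof cases
    case (3 e)
    then have "Z \<in> lam.Mlo e" using lam.Union_Mlo[of e] by simp
    then show ?thesis using lam.min_crossing_sub[of Z e] by (simp add: lam.Mlo_def)
  next
    case (4 e)
    then have "Z \<in> lam.Mhi e" using lam.Inter_Mhi[of e] by simp
    then show ?thesis using lam.min_crossing_sub[of Z e] by (simp add: lam.Mhi_def)
  qed (auto simp: avoiding_def containing_def lam.Dhi_def lam.D_def lam.F_def deleted_def st_cut_def st_mincut_def V_n)
qed

lemma rank_bound:
  assumes "\<And>X. X \<in> F \<Longrightarrow> X \<subseteq> {..<n}"
  shows "rank n F x < n * n + n + 1"
proof (cases "x < n")
  case True
  have "hull_in n F x \<subseteq> {..<n}" using assms by (auto simp: hull_in_def)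
  then have "card (hull_in n F x) \<le> n" using card_mono[of "{..<n}"] by fastforce
  then have "card (hull_in n F x) * n \<le> n * n" by (rule mult_le_mono1)
  moreover have "Min {y. y < n \<and> hull_in n F y = hull_in n F x} \<in> {y. y < n \<and> hull_in n F y = hull_in n F x}"
    using True by (intro Min_in) auto
  then have "Min {y. y < n \<and> hull_in n F y = hull_in n F x} < n" by simp
  ultimately show ?thesis unfolding rank_def if_P[OF True] by linarith
qed (simp add: rank_def)

lemma pool_bound: "a \<in> pool \<Longrightarrow> a i < n * n + n + 1"
proof -
  assume a: "a \<in> pool"
  have n: "0 < n" using src_V V_n by auto
  consider Z where "Z \<in> sets" "a = indic Z" | Z where "Z \<in> sets" "a = cut_array Z" | F where "F \<in> families" "a = rank n F"
    | r where "a = junk_label n (src N) (snk N) r" | "a = (\<lambda>_. 0)" | "a = (\<lambda>_. 1)"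
    using a unfolding pool_def junk_def by blast
  then show ?thesis
  proof cases
    case (1 Z)
    then show ?thesis using n by (auto simp: indic_def)
  next
    case (2 Z)
    have Z: "Z \<subseteq> {..<n}" by (rule sets_sub[OF 2(1)])
    then have fin: "finite Z" and card: "card Z \<le> n" using card_mono[of "{..<n}" Z] finite_subset by auto
    have "sorted_list_of_set Z ! (i - 1) < n" if "i \<noteq> 0" "i \<le> card Z"
    proof -
      have "sorted_list_of_set Z ! (i - 1) \<in> set (sorted_list_of_set Z)"
        using that fin by (intro nth_mem) (simp add: length_sorted_list_of_set)
      then show ?thesis using Z fin by auto
    qed
    moreover have "i = 0 \<or> i \<noteq> 0 \<and> i \<le> card Z \<or> i \<noteq> 0 \<and> \<not> i \<le> card Z" by blast
    ultimately show ?thesis using card 2(2) by (elim disjE) (auto simp: cut_array_def)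
  next
    case (3 F)
    then show ?thesis using rank_bound families_cut_family by simp
  next
    case (4 r)
    then show ?thesis using junk_label_le[of n "src N" "snk N" r i] by simp
  qed (use n in auto)
qed

lemma lows_mem: "e \<in> lows \<Longrightarrow> \<Union>(lam.Mlo e) \<in> sets" "e \<in> lows \<Longrightarrow> lam.Dlo e \<in> families"
  and highs_mem: "e \<in> highs \<Longrightarrow> \<Inter>(lam.Mhi e) \<in> sets" "e \<in> highs \<Longrightarrow> \<Union>(lam.Dhi e) \<in> sets"
    "e \<in> highs \<Longrightarrow> lam.Dhi e \<in> families"
  unfolding sets_def families_def by (intro UnI1 UnI2 imageI; assumption)+

text \<open>Cuts left by \<open>e\<close> compete only if
  \<open>lam1 N e + \<Delta> \<le> lam0 N e\<close>. For an arc that is not vital,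
  \<open>\<Delta> \<ge> - cap N e\<close> turns all these inequalities into equalities: the arc is
  deleted at a tie.\<close>

lemma kind_VV:
  assumes e: "e \<in> E N" and D: "- cap N e \<le> \<Delta>" and k: "change_kind N e \<Delta> \<noteq> 0"
  shows "e \<in> VV \<or> change_kind N e \<Delta> = 2 \<and> \<Delta> = - cap N e \<and> crossing_cuts N e \<noteq> {} \<and>
    lam0 N e = mincut_cap N \<and> lam1 N e = mincut_cap N + cap N e"
proof (cases "noncrossing_cuts N e = {}")
  case True
  then show ?thesis using lam1_mincut[OF True] cap_pos[OF e] e by (simp add: VV_def)
next
  case False
  then have c: "crossing_cuts N e \<noteq> {}" "lam1 N e + \<Delta> \<le> lam0 N e"
    using k by (auto simp: change_kind_def split: if_splits)
  show ?thesis
  proof (cases "lam1 N e < mincut_cap N + cap N e")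
    case True
    then show ?thesis using e c(1) by (simp add: VV_def)
  next
    case F: False
    then have "mincut_cap N = lam0 N e" using lam_mincut[OF False c(1)] cap_pos[OF e] by (auto simp: min_def split: if_splits)
    then have "\<Delta> = - cap N e" "lam1 N e = mincut_cap N + cap N e" "lam1 N e + \<Delta> = lam0 N e"
      using F c(2) D by linarith+
    then show ?thesis using False c(1) \<open>mincut_cap N = lam0 N e\<close> by (simp add: change_kind_def)
  qed
qed

lemma kind_parts:
  "{X\<in>kind_cuts N e k. fst e \<notin> X} = (if k = 1 then {} else {X\<in>min_noncrossing N e. fst e \<notin> X})"
  "{X\<in>kind_cuts N e k. snd e \<in> X} = (if k = 1 then {} else {X\<in>min_noncrossing N e. snd e \<in> X})"
  "{X\<in>kind_cuts N e k. fst e \<in> X \<and> snd e \<notin> X} = (if k = 0 then {} else min_crossing N e)"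
  by (auto simp: kind_cuts_def min_crossing_def min_noncrossing_def crossing_cuts_def noncrossing_cuts_def)

lemma pos_arcs_change:
  assumes "e \<in> E N" "- cap N e \<le> \<Delta>"
  shows "pos_arcs (change_cap N e \<Delta>) = (if \<Delta> = - cap N e then E N - {e} else E N)"
  using assms cap_pos by (auto simp: pos_arcs_def)

lemma junk_change:
  assumes "e \<in> E N" "- cap N e \<le> \<Delta>"
  shows "junk e (\<Delta> = - cap N e) = junk_label n (src (change_cap N e \<Delta>)) (snk (change_cap N e \<Delta>)) (pos_arcs (change_cap N e \<Delta>))"
  unfolding junk_def pos_arcs_change[OF assms] by simp

lemma tests_layering:
  assumes e: "e \<in> E N" and D: "- cap N e \<le> \<Delta>"
    and ok: "change_kind N e \<Delta> = 0 \<or> e \<in> VV"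
  shows "\<exists>ts. tests_ok ts \<and> layered (n * n + n + 1) (kind_cuts N e (change_kind N e \<Delta>)) {} ts"
proof -
  define k where "k = change_kind N e \<Delta>"
  define L where "L = kind_cuts N e k"
  interpret N': st_net "change_cap N e \<Delta>" by (rule st_net_change[OF e D])
  have L: "L = {X. st_mincut (change_cap N e \<Delta>) X}" unfolding L_def k_def mincuts_change(1)[OF e D] ..
  \<comment> \<open>Outside \<open>VV\<close> the kind is 0 and no minimum cut is left by
    \<open>e\<close>, so any family will do.\<close>
  define Dl where "Dl = (if e \<in> VV then lam.Dlo e else {})"
  define Dh where "Dh = (if e \<in> VV then lam.Dhi e else {})"
  have u: "fst e < n" "snd e < n" using E_n e by (cases e, auto)+
  have crossL: "k \<noteq> 0 \<and> e \<in> VV" if "X \<in> L" "fst e \<in> X" "snd e \<notin> X" for X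
    using that ok kind_parts(3)[of e k] unfolding L_def k_def by (auto split: if_splits)
  have Mlo: "{X\<in>L. fst e \<in> X \<and> snd e \<notin> X \<and> lam.root e \<notin> X} = lam.Mlo e"
    and Mhi: "{X\<in>L. fst e \<in> X \<and> snd e \<notin> X \<and> lam.root e \<in> X} = lam.Mhi e" if "k \<noteq> 0"
    using kind_parts(3)[of e k] that unfolding L_def lam.Mlo_def lam.Mhi_def by auto
  interpret lay: layering n L "fst e" "snd e" "lam.root e" Dl Dh
  proof
    show "X \<subseteq> {..<n}" if "X \<in> L" for X using that N'.finite_mincut_sub V_n by (simp add: L)
    show "X \<inter> Y \<in> L" "X \<union> Y \<in> L" if "X \<in> L" "Y \<in> L" for X Y
      using that N'.st_mincut_Int N'.st_mincut_Un by (auto simp: L)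
    show "X \<subseteq> {..<n}" if "X \<in> Dl" for X
      using that cut_family.sub[OF lam.D_family[OF lam.root_links(1)]] by (auto simp: Dl_def lam.Dlo_def split: if_splits)
    show "X \<subseteq> {..<n}" if "X \<in> Dh" for X
      using that cut_family.sub[OF lam.D_family[OF lam.root_links(2)]] by (auto simp: Dh_def lam.Dhi_def split: if_splits)
    show "X \<inter> Y \<in> Dl" if "X \<in> Dl" "Y \<in> Dl" for X Y
      using that lam.D_lattice(1)[OF lam.root_links(1)] by (auto simp: Dl_def lam.Dlo_def split: if_splits)
    show "X \<inter> Y \<in> Dh" "X \<union> Y \<in> Dh" if "X \<in> Dh" "Y \<in> Dh" for X Y
      using that lam.D_lattice[OF lam.root_links(2)] by (auto simp: Dh_def lam.Dhi_def split: if_splits)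
    fix X assume X: "X \<in> L" "fst e \<in> X" "snd e \<notin> X"
    note c = crossL[OF X]
    show "{X\<in>L. fst e \<in> X \<and> snd e \<notin> X \<and> lam.root e \<notin> X} = {X\<in>Dl. snd e \<notin> X}"
      using Mlo lam.Mlo_eq[of e] c by (simp add: Dl_def)
    show "{X\<in>L. fst e \<in> X \<and> snd e \<notin> X \<and> lam.root e \<in> X} = {X\<in>Dh. fst e \<in> X}"
      using Mhi lam.Mhi_eq[of e] c by (simp add: Dh_def)
  qed
  have L1: "lay.L1 = (if k = 1 then {} else {X\<in>min_noncrossing N e. fst e \<notin> X})"
    unfolding kind_parts(1)[of e k, symmetric] lay.L1_def by (simp only: L_def)
  have L3: "lay.L3 = (if k = 1 then {} else {X\<in>min_noncrossing N e. snd e \<in> X})"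
    unfolding kind_parts(2)[of e k, symmetric] lay.L3_def by (simp only: L_def)
  have 1: "lay.L1 = avoiding (fst e)" if ne: "lay.L1 \<noteq> {}"
    using ne min_noncrossing_avoiding[of e] unfolding L1 by (cases "k = 1") simp_all
  have 4: "lay.L3 = containing (snd e)" if ne: "lay.L3 \<noteq> {}"
    using ne min_noncrossing_containing[of e] unfolding L3 by (cases "k = 1") simp_all
  have 2: "e \<in> lows \<and> lay.Mlo = lam.Mlo e \<and> Dl = lam.Dlo e" if ne: "lay.Mlo \<noteq> {}"
  proof -
    obtain X where "X \<in> L" "fst e \<in> X" "snd e \<notin> X" using ne unfolding lay.Mlo_def by auto
    then have "k \<noteq> 0 \<and> e \<in> VV" by (rule crossL)
    moreover from this have "lay.Mlo = lam.Mlo e" unfolding lay.Mlo_def using Mlo by simp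
    ultimately show ?thesis using ne by (simp add: Dl_def)
  qed
  have 3: "e \<in> highs \<and> lay.Mhi = lam.Mhi e \<and> Dh = lam.Dhi e" if ne: "lay.Mhi \<noteq> {}"
  proof -
    obtain X where "X \<in> L" "fst e \<in> X" "snd e \<notin> X" using ne unfolding lay.Mhi_def by auto
    then have "k \<noteq> 0 \<and> e \<in> VV" by (rule crossL)
    moreover from this have "lay.Mhi = lam.Mhi e" unfolding lay.Mhi_def using Mhi by simp
    ultimately show ?thesis using ne by (simp add: Dh_def)
  qed
  let ?ok = "\<lambda>ts. \<forall>(Z, r)\<in>set ts. Z \<in> sets \<and> r \<in> insert (\<lambda>_. 0) (rank n ` families)"
  have "?ok lay.t1"
  proof (cases "lay.L1 = {}")
    case False
    have "\<Union>(avoiding (fst e)) \<in> sets" "avoiding (fst e) \<in> families"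
      unfolding sets_def families_def using u by blast+
    then show ?thesis using False 1[OF False] by (simp add: lay.t1_def)
  qed (simp add: lay.t1_def)
  moreover have "?ok lay.t4"
  proof (cases "lay.L3 = {}")
    case False
    have "\<Union>(containing (snd e)) \<in> sets" "containing (snd e) \<in> families"
      unfolding sets_def families_def using u by blast+
    then show ?thesis using False 4[OF False] by (simp add: lay.t4_def)
  qed (simp add: lay.t4_def)
  moreover have "?ok lay.t2"
  proof (cases "lay.Mlo = {}")
    case False
    have "\<Union>(lam.Mlo e) \<in> sets" "lam.Dlo e \<in> families"
      using lows_mem 2[OF False] by blast+
    then show ?thesis unfolding lay.t2_def if_not_P[OF False] using 2[OF False] by simp
  qed (simp add: lay.t2_def)
  moreover have "?ok lay.t3"
  proof (cases "lay.Mhi = {}")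
    case False
    have "\<Inter>(lam.Mhi e) \<in> sets" "\<Union>(lam.Dhi e) \<in> sets" "lam.Dhi e \<in> families"
      using highs_mem 3[OF False] by blast+
    then show ?thesis unfolding lay.t3_def if_not_P[OF False] using 3[OF False] by simp
  qed (simp add: lay.t3_def)
  moreover have "length (lay.t1 @ lay.t2 @ lay.t3 @ lay.t4) \<le> 5"
    by (simp add: lay.t1_def lay.t2_def lay.t3_def lay.t4_def)
  ultimately have "tests_ok (lay.t1 @ lay.t2 @ lay.t3 @ lay.t4)"
    unfolding tests_ok_def set_append by blast
  then show ?thesis using lay.layered1 unfolding L_def k_def by blast
qed

text \<open>Exceptional arcs have arrays of their own. Any other is empty: were it saturated, then,
  being outside \<open>VV\<close>, it would enter a cut that makes its reverse a strong bridge. Nor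
  is it itself a strong bridge, so its head does not reach its tail, and the ranks of the unchanged
  network remain good.\<close>

lemma tests_borderline:
  assumes e: "e \<in> E N" and no: "e \<notin> VV" and lam: "crossing_cuts N e \<noteq> {}"
    "lam0 N e = mincut_cap N" "lam1 N e = mincut_cap N + cap N e" and k: "change_kind N e (- cap N e) = 2"
  shows "\<exists>ts. tests_ok ts \<and> (\<forall>b. good_labels (change_cap N e (- cap N e)) (test_label (n * n + n + 1) b ts) (junk e True))"
proof -
  let ?N = "change_cap N e (- cap N e)"
  have D: "- cap N e \<le> - cap N e" by simp
  interpret N': st_net ?N by (rule st_net_change[OF e D])
  have jn: "junk e True = junk_label n (src ?N) (snk ?N) (pos_arcs ?N)"
    using junk_change[OF e D] by simp
  obtain u v where uv: "e = (u, v)" by (cases e)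
  note pos = cap_pos[OF e]
  show ?thesis
  proof (cases "e \<in> exceptional")
    case True
    have "\<Union>(deleted e) \<in> sets" "deleted e \<in> families"
      unfolding sets_def families_def using True e by simp_all
    then have "tests_ok [(\<Union>(deleted e), rank n (deleted e))]"
      unfolding tests_ok_def by simp
    moreover have lay: "layered (n * n + n + 1) {X. st_mincut ?N X} {} [(\<Union>(deleted e), rank n (deleted e))]"
      unfolding deleted_def by (rule layered_single) (use N'.st_net_axioms V_n in auto)
    have "good_labels ?N (test_label (n * n + n + 1) b [(\<Union>(deleted e), rank n (deleted e))]) (junk e True)" for b
      unfolding jn by (rule good_of_layered[OF N'.st_net_axioms _ lay]) (simp add: V_n)
    ultimately show ?thesis by blast
  next
    case False
    have "f e = 0"
    proof (rule ccontr)
      assume "f e \<noteq> 0"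
      then have sat: "f e = cap N e" using f_bounds[OF e] False e unfolding exceptional_def by force
      then obtain X where X: "st_cut N X" "fst e \<notin> X" "snd e \<in> X" "cut_cap N X = mincut_cap N + cap N e"
        using no e lam by (auto simp: VV_def)
      have "(v, u) \<in> strong_bridges R"
        by (rule borderline_saturated[of u v X]) (use e pos sat lam X uv in auto)
      then show False using False uv by (auto simp: exceptional_def)
    qed
    have "(v, u) \<notin> R\<^sup>*"
    proof
      assume "(v, u) \<in> R\<^sup>*"
      then have "(u, v) \<in> strong_bridges R"
        by (intro borderline_empty) (use e pos \<open>f e = 0\<close> lam uv in auto)
      then show False using False uv by (auto simp: exceptional_def)
    qed
    have base: "layered (n * n + n + 1) {X. st_mincut N X} {} [(\<Union>base, rank n base)]"
      by (rule layered_single) (use st_net_axioms V_n in auto)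
    have "\<Union>base \<in> sets" "base \<in> families" unfolding sets_def families_def by simp_all
    then have ok: "tests_ok [(\<Union>base, rank n base)]" unfolding tests_ok_def by simp
    have mc: "st_mincut ?N X \<longleftrightarrow> X \<in> min_noncrossing N e \<or> X \<in> min_crossing N e" for X
    proof -
      have "X \<in> {X. st_mincut ?N X} \<longleftrightarrow> X \<in> kind_cuts N e 2" using mincuts_change(1)[OF e D] k by simp
      then show ?thesis by (simp add: kind_cuts_def)
    qed
    have mb: "st_mincut N X \<longleftrightarrow> X \<in> min_noncrossing N e" for X
    proof
      assume X: "st_mincut N X"
      then have "X \<notin> crossing_cuts N e" using lam1_le[of X e] lam pos by (auto simp: st_mincut_iff)
      then show "X \<in> min_noncrossing N e"
        using X lam cut_cases[of X e] by (auto simp: min_noncrossing_def st_mincut_iff)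
    next
      assume "X \<in> min_noncrossing N e"
      then show "st_mincut N X" using lam by (auto simp: min_noncrossing_def noncrossing_cuts_def st_mincut_iff)
    qed
    have "good_labels ?N (test_label (n * n + n + 1) b [(\<Union>base, rank n base)]) (junk e True)" for b
    proof -
      let ?cl = "test_label (n * n + n + 1) b [(\<Union>base, rank n base)]"
      have T: "(?cl x < ?cl y \<longrightarrow> (\<exists>X\<in>base. x \<in> X \<and> y \<notin> X)) \<and> (?cl x = ?cl y \<longrightarrow> (\<forall>X\<in>base. x \<in> X \<longleftrightarrow> y \<in> X))" for x y
        by (rule test_label_layered[OF base]) auto
      have lt: "\<exists>X. st_mincut N X \<and> x \<in> X \<and> y \<notin> X" if "?cl x < ?cl y" for x y
        using T[of x y] that by blast
      have eq: "x \<in> X \<longleftrightarrow> y \<in> X" if "?cl x = ?cl y" "st_mincut N X" for x y X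
        using T[of x y] that by blast
      have jl: "junk e True x = junk e True y \<longleftrightarrow> on_path ?N x \<and> on_path ?N y \<or>
        \<not> on_path ?N x \<and> \<not> on_path ?N y \<and> (x, y) \<in> (pos_arcs ?N)\<^sup>* \<and> (y, x) \<in> (pos_arcs ?N)\<^sup>*"
        if "x \<in> V N" "y \<in> V N" for x y
        unfolding jn on_path_def using that V_n by (intro junk_label_eq_iff) auto
      show ?thesis
        unfolding uv
      proof (rule good_labels_delete_empty)
        show "(u, v) \<in> E N" "0 < cap N (u, v)" "f (u, v) = 0" "(v, u) \<notin> R\<^sup>*"
          "lam1 N (u, v) = mincut_cap N + cap N (u, v)" using e pos \<open>f e = 0\<close> \<open>(v, u) \<notin> R\<^sup>*\<close> lam uv by auto
      qed (use lt eq jl mc mb uv in blast)+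
    qed
    then show ?thesis using ok by blast
  qed
qed

text \<open>One list of tests serves all changes of equal kind \<open>k\<close> and deletion status
  \<open>z\<close>. It has to be good for every \<open>b\<close>, since \<open>b\<close> will be the
  address at which the tests are stored.\<close>

lemma ex_tests:
  assumes e: "e \<in> E N"
  shows "\<exists>ts. tests_ok ts \<and> (\<forall>\<Delta>\<ge>- cap N e. change_kind N e \<Delta> = k \<longrightarrow> (\<Delta> = - cap N e \<longleftrightarrow> z) \<longrightarrow>
    (\<forall>b. good_labels (change_cap N e \<Delta>) (test_label (n * n + n + 1) b ts) (junk e z)))"
proof (cases "\<exists>\<Delta>\<ge>- cap N e. change_kind N e \<Delta> = k \<and> (\<Delta> = - cap N e \<longleftrightarrow> z)")
  case False
  then show ?thesis by (intro exI[of _ "[]"]) (auto simp: tests_ok_def)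
next
  case True
  then obtain \<Delta>0 where D0: "- cap N e \<le> \<Delta>0" "change_kind N e \<Delta>0 = k" "\<Delta>0 = - cap N e \<longleftrightarrow> z" by auto
  show ?thesis
  proof (cases "k = 0 \<or> e \<in> VV")
    case True
    then obtain ts where ts: "tests_ok ts" "layered (n * n + n + 1) (kind_cuts N e k) {} ts"
      using tests_layering[OF e D0(1)] D0(2) by auto
    have "good_labels (change_cap N e \<Delta>) (test_label (n * n + n + 1) b ts) (junk e z)"
      if D: "- cap N e \<le> \<Delta>" "change_kind N e \<Delta> = k" "\<Delta> = - cap N e \<longleftrightarrow> z" for \<Delta> b
    proof -
      interpret N': st_net "change_cap N e \<Delta>" by (rule st_net_change[OF e D(1)])
      have "junk e z = junk_label n (src (change_cap N e \<Delta>)) (snk (change_cap N e \<Delta>)) (pos_arcs (change_cap N e \<Delta>))"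
        using junk_change[OF e D(1)] D(3) by simp
      moreover have "layered (n * n + n + 1) {X. st_mincut (change_cap N e \<Delta>) X} {} ts"
        unfolding mincuts_change(1)[OF e D(1)] D(2) by (rule ts(2))
      ultimately show ?thesis
        using good_of_layered[OF N'.st_net_axioms, of n] V_n by simp
    qed
    then show ?thesis using ts(1) by blast
  next
    case False
    then have b: "k = 2" "\<Delta>0 = - cap N e" "crossing_cuts N e \<noteq> {}" "lam0 N e = mincut_cap N" "lam1 N e = mincut_cap N + cap N e"
      using kind_VV[OF e D0(1)] D0(2) by auto
    then obtain ts where "tests_ok ts" "\<forall>b. good_labels (change_cap N e (- cap N e)) (test_label (n * n + n + 1) b ts) (junk e True)"
      using tests_borderline[OF e _ b(3-5)] False D0(2) by auto
    moreover have z using D0(3) b(2) by simp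
    ultimately show ?thesis by (intro exI[of _ ts]) auto
  qed
qed

section \<open>The cuts to report\<close>

definition cut0 :: "nat \<times> nat \<Rightarrow> nat set" where
  "cut0 e = (if {X\<in>min_noncrossing N e. fst e \<notin> X} \<noteq> {} then \<Union>(avoiding (fst e)) else \<Union>(containing (snd e)))"

definition cut1 :: "nat \<times> nat \<Rightarrow> nat set" where
  "cut1 e = (if lam.Mlo e \<noteq> {} then \<Union>(lam.Mlo e) else \<Inter>(lam.Mhi e))"

lemma cut0_sets: "e \<in> E N \<Longrightarrow> cut0 e \<in> sets"
proof -
  assume "e \<in> E N"
  then have "fst e < n" "snd e < n" using E_n by (cases e, auto)+
  then show ?thesis unfolding cut0_def sets_def by auto
qed

lemma cut1_sets:
  assumes "e \<in> VV"
  shows "cut1 e \<in> sets"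
proof (cases "lam.Mlo e = {}")
  case True
  have "lam.Mhi e \<noteq> {}"
    using min_crossing_nonempty[OF lam.VV_cross[OF assms]] True by (auto simp: lam.Mlo_def lam.Mhi_def)
  then show ?thesis unfolding cut1_def sets_def using True assms by simp
next
  case False
  then show ?thesis unfolding cut1_def sets_def using assms by simp
qed

lemma reported_cut:
  assumes e: "e \<in> E N" and D: "- cap N e \<le> \<Delta>"
  shows "st_mincut (change_cap N e \<Delta>) (if change_kind N e \<Delta> = 1 then cut1 e else cut0 e)"
    and "change_kind N e \<Delta> = 1 \<Longrightarrow> e \<in> VV"
proof -
  interpret N': st_net "change_cap N e \<Delta>" by (rule st_net_change[OF e D])
  let ?k = "change_kind N e \<Delta>"
  show VV: "?k = 1 \<Longrightarrow> e \<in> VV" using kind_VV[OF e D] by auto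
  have mc: "st_mincut (change_cap N e \<Delta>) X \<longleftrightarrow> X \<in> kind_cuts N e ?k" for X
    using mincuts_change(1)[OF e D] by auto
  show "st_mincut (change_cap N e \<Delta>) (if ?k = 1 then cut1 e else cut0 e)"
  proof (cases "?k = 1")
    case True
    have "cut1 e \<in> min_crossing N e"
    proof (cases "lam.Mlo e = {}")
      case F: True
      then have "lam.Mhi e \<noteq> {}"
        using min_crossing_nonempty[OF lam.VV_cross[OF VV[OF True]]] by (auto simp: lam.Mlo_def lam.Mhi_def)
      then show ?thesis using lam.Inter_Mhi[of e] F by (simp add: cut1_def lam.Mhi_def)
    next
      case False
      then show ?thesis using lam.Union_Mlo[of e] by (simp add: cut1_def lam.Mlo_def)
    qed
    then show ?thesis using True by (simp add: mc kind_cuts_def)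
  next
    case False
    then have nc: "noncrossing_cuts N e \<noteq> {}" by (auto simp: change_kind_def)
    have sub: "X \<in> min_noncrossing N e \<Longrightarrow> st_mincut (change_cap N e \<Delta>) X" for X
      using False by (simp add: mc kind_cuts_def)
    show ?thesis
    proof (cases "{X\<in>min_noncrossing N e. fst e \<notin> X} = {}")
      case T: True
      obtain X where "X \<in> min_noncrossing N e" using min_noncrossing_nonempty[OF nc] by auto
      then have ne: "{X\<in>min_noncrossing N e. snd e \<in> X} \<noteq> {}"
        using T by (auto simp: min_noncrossing_def noncrossing_cuts_def)
      have "st_mincut (change_cap N e \<Delta>) (\<Union>{X\<in>min_noncrossing N e. snd e \<in> X})"
        using ne sub by (intro N'.st_mincut_Union) auto
      moreover have "cut0 e = \<Union>{X\<in>min_noncrossing N e. snd e \<in> X}"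
        unfolding min_noncrossing_containing[OF ne] cut0_def using T by auto
      ultimately show ?thesis using False by simp
    next
      case ne: False
      have "st_mincut (change_cap N e \<Delta>) (\<Union>{X\<in>min_noncrossing N e. fst e \<notin> X})"
        using ne sub by (intro N'.st_mincut_Union) auto
      moreover have "cut0 e = \<Union>{X\<in>min_noncrossing N e. fst e \<notin> X}"
        unfolding cut0_def if_P[OF ne] by (rule min_noncrossing_avoiding[OF ne, symmetric, THEN arg_cong])
      ultimately show ?thesis using False by simp
    qed
  qed
qed

end

section \<open>The query programs\<close>

text \<open>Unlike \<open>run\<close>, this counts steps exactly and returns the state, so that
  computations compose.\<close>

fun execs :: "nat \<Rightarrow> cell list \<Rightarrow> instr list \<Rightarrow> nat \<Rightarrow> state \<Rightarrow> state option" where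
  "execs W D P 0 \<sigma> = Some \<sigma>"
| "execs W D P (Suc k) \<sigma> =
     (if pc \<sigma> < length P then Option.bind (exec W D (P ! pc \<sigma>) \<sigma>) (execs W D P k) else None)"

lemma execs_numeral: "execs W D P (numeral k) \<sigma> =
    (if pc \<sigma> < length P then Option.bind (exec W D (P ! pc \<sigma>) \<sigma>) (execs W D P (pred_numeral k)) else None)"
  by (simp add: numeral_eq_Suc)

lemma run_execs: "execs W D P k \<sigma> = Some \<sigma>' \<Longrightarrow> run W D P (k + T) \<sigma> = run W D P T \<sigma>'"
  by (induction k arbitrary: \<sigma>) (auto split: if_splits bind_splits)

text \<open>A total-correctness statement with time budget \<open>B\<close>, for composition by
  \<open>reaches_trans\<close>.\<close>

definition reaches :: "nat \<Rightarrow> cell list \<Rightarrow> instr list \<Rightarrow> nat \<Rightarrow> state \<Rightarrow> (state \<Rightarrow> bool) \<Rightarrow> bool" where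
  "reaches W D P B \<sigma> Q \<longleftrightarrow> (\<exists>k\<le>B. \<exists>\<sigma>'. execs W D P k \<sigma> = Some \<sigma>' \<and> Q \<sigma>')"

lemma execs_add: "execs W D P j \<sigma> = Some \<sigma>' \<Longrightarrow> execs W D P (j + k) \<sigma> = execs W D P k \<sigma>'"
  by (induction j arbitrary: \<sigma>) (auto split: if_splits bind_splits)

lemma reaches_refl: "Q \<sigma> \<Longrightarrow> reaches W D P B \<sigma> Q"
  unfolding reaches_def by (intro exI[of _ 0]) auto

lemma reachesI: "execs W D P k \<sigma> = Some \<sigma>' \<Longrightarrow> Q \<sigma>' \<Longrightarrow> k \<le> B \<Longrightarrow> reaches W D P B \<sigma> Q"
  unfolding reaches_def by blast

lemma reaches_steps:
  "(case execs W D P k \<sigma> of None \<Rightarrow> False | Some \<sigma>' \<Rightarrow> Q \<sigma>') \<Longrightarrow> k \<le> B \<Longrightarrow> reaches W D P B \<sigma> Q"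
  by (auto split: option.splits intro: reachesI)

lemma reaches_trans:
  assumes "reaches W D P A \<sigma> Q" "\<And>\<sigma>'. Q \<sigma>' \<Longrightarrow> reaches W D P B \<sigma>' Q'" "A + B \<le> C"
  shows "reaches W D P C \<sigma> Q'"
proof -
  obtain j \<sigma>' where j: "j \<le> A" "execs W D P j \<sigma> = Some \<sigma>'" "Q \<sigma>'" using assms(1) unfolding reaches_def by blast
  obtain k \<sigma>'' where k: "k \<le> B" "execs W D P k \<sigma>' = Some \<sigma>''" "Q' \<sigma>''" using assms(2)[OF j(3)] unfolding reaches_def by blast
  show ?thesis by (rule reachesI[of _ _ _ "j + k"]) (use execs_add[OF j(2), of k] j k assms(3) in auto)
qed

lemma reaches_run:
  assumes "reaches W D P B \<sigma> (\<lambda>\<sigma>'. length P \<le> pc \<sigma>' \<and> Q (emitted \<sigma>'))"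
  shows "\<exists>T\<le>B. \<exists>os. run W D P T \<sigma> = Some os \<and> Q os"
proof -
  obtain k \<sigma>' where k: "k \<le> B" "execs W D P k \<sigma> = Some \<sigma>'" "length P \<le> pc \<sigma>'" "Q (emitted \<sigma>')"
    using assms unfolding reaches_def by blast
  have "run W D P (k + 0) \<sigma> = Some (emitted \<sigma>')" unfolding run_execs[OF k(2)] using k(3) by simp
  then show ?thesis using k by (intro exI[of _ k]) simp
qed

text \<open>Register 3 holds \<open>n\<close>, 4 the address of the table entry of the queried arc, 5 and 10 the constants 1 and 0.
  The first twenty instructions are common to the three programs: they leave the two candidate capacities
  in 7 and 8, and in 9 the kind of the change. In \<open>dag_prog\<close>, instructions 47--76 label the end points,
  those from 89 on emit three pairs for each arc, after replacing a deleted arc by a loop at the source.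
  Throughout, 11 holds the position of the deleted arc counted from the end of the arc list, or 0; 12 the address of the
  tests, 13 that of the labels off the paths, 14 and 15 the radices \<open>n * n + n + 1\<close> and \<open>n + 1\<close> of the
  combined labels, 16 and 17 the loop counter and the read position, 18 and 19 source and sink.\<close>

definition cap_prog :: "instr list" where
  "cap_prog = [
    Const 3 0, Read 3 3, Mul 4 0 3, Add 4 4 1, Const 5 112, Mul 4 4 5, Const 5 16, Add 4 4 5,
     Const 5 1, Add 6 4 5, Read 7 6, Add 6 6 5, Read 8 6, Add 8 8 2, Read 9 4, JumpLess 10 9 20,
     JumpLess 7 8 20, Copy 9 5, JumpLess 8 7 20, Add 9 9 5, JumpLess 9 5 23, Emit 8, Jump 24, Emit 7]"

definition cut_prog :: "instr list" where
  "cut_prog = [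
    Const 3 0, Read 3 3, Mul 4 0 3, Add 4 4 1, Const 5 112, Mul 4 4 5, Const 5 16, Add 4 4 5,
     Const 5 1, Add 6 4 5, Read 7 6, Add 6 6 5, Read 8 6, Add 8 8 2, Read 9 4, JumpLess 10 9 20,
     JumpLess 7 8 20, Copy 9 5, JumpLess 8 7 20, Add 9 9 5, Const 6 4, Add 4 4 6, Add 4 4 9,
     Read 4 4, Read 6 4, JumpLess 10 6 27, Jump 32, Add 4 4 5, Read 7 4, Emit 7, Sub 6 6 5, Jump 25]"

definition dag_prog :: "instr list" where
  "dag_prog = [
    Const 3 0, Read 3 3, Mul 4 0 3, Add 4 4 1, Const 5 112, Mul 4 4 5, Const 5 16, Add 4 4 5,
     Const 5 1, Add 6 4 5, Read 7 6, Add 6 6 5, Read 8 6, Add 8 8 2, Read 9 4, JumpLess 10 9 20,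
     JumpLess 7 8 20, Copy 9 5, JumpLess 8 7 20, Add 9 9 5, Const 6 3, Add 6 4 6, Read 6 6,
     JumpLess 6 2 29, Const 7 3, Add 9 9 7, Const 7 7, Add 7 4 7, Read 11 7, Add 9 9 5, Const 7 16,
     Mul 9 9 7, Add 12 4 9, Const 7 12, Add 7 12 7, Read 13 7, Mul 14 3 3, Add 14 14 3,
     Add 14 14 5, Add 15 3 5, Read 16 5, Const 7 2, Read 17 7, Read 18 17, Add 7 17 5, Read 19 7,
     Emit 16, JumpLess 10 16 49, Jump 77, Read 20 17, Copy 21 12, Read 22 21, Add 22 22 20,
     Read 22 22, JumpLess 10 22 58, Add 21 21 5, Add 21 21 5, Jump 51, Add 22 21 5, Read 22 22,
     Add 22 22 20, Read 22 22, Mul 21 21 14, Add 21 21 22, Store 20 21, Mul 21 21 15, Add 22 13 20,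
     Read 22 22, Add 21 21 22, Add 21 21 3, Add 22 3 20, Store 22 21, Emit 20, Emit 21,
     Add 17 17 5, Sub 16 16 5, Jump 47, Const 7 3, Read 16 7, Mul 7 16 7, Add 7 7 5, Emit 7,
     Emit 19, Emit 18, Load 23 18, Load 24 19, Const 7 2, Read 17 7, Add 17 17 7,
     JumpLess 10 16 91, Jump 132, Read 20 17, Add 17 17 5, Read 21 17, Add 17 17 5,
     JumpLess 11 16 99, JumpLess 16 11 99, Copy 20 18, Copy 21 18, Load 22 20, Load 25 21,
     JumpLess 22 25 103, Jump 109, Copy 26 20, Copy 20 21, Copy 21 26, Copy 26 22, Copy 22 25,
     Copy 25 26, Add 26 3 20, Load 26 26, Add 27 3 21, Load 27 27, JumpLess 26 27 118,
     JumpLess 27 26 118, Emit 19, Emit 18, Jump 120, Emit 20, Emit 21, Emit 19, JumpLess 22 24 124,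
     Emit 18, Jump 125, Emit 20, JumpLess 23 25 128, Emit 19, Jump 129, Emit 21, Emit 18,
     Sub 16 16 5, Jump 89]"


definition holds :: "cell list \<Rightarrow> nat \<Rightarrow> cell \<Rightarrow> bool" where
  "holds D a c \<longleftrightarrow> a < length D \<and> D ! a = c"

lemma holds_fetch: "holds D a c \<Longrightarrow> fetch D (Idx a) = Some c"
  by (simp add: holds_def)

text \<open>The cells that a query relies on, independent of how they were computed. Entries begin
  at address 16 and have 112 cells: 16 and six blocks of 16. \<open>flag\<close> will mean that
  every cut is left by the arc.\<close>

locale query =
  fixes W n :: nat and D :: "cell list" and u v :: nat and \<Delta> :: real and flag :: bool and kind :: nat and l0 l1 :: real
  assumes header: "holds D 0 (Idx n)"
    and W: "length D < W" "1000 < W"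
    and uv: "u < n" "v < n"
    and table: "16 + n * n * 112 \<le> length D"
    and entry: "holds D (16 + (u * n + v) * 112) (Idx (if flag then 1 else 0))"
      "holds D (17 + (u * n + v) * 112) (Val l0)" "holds D (18 + (u * n + v) * 112) (Val l1)"
    and kind: "kind = (if flag then 1 else if l0 < l1 + \<Delta> then 0 else if l1 + \<Delta> < l0 then 1 else 2)"
begin

abbreviation "ent \<equiv> 16 + (u * n + v) * 112"

abbreviation started :: "cell list \<Rightarrow> state \<Rightarrow> bool" where
  "started M \<sigma> \<equiv> pc \<sigma> = 20 \<and> scratch \<sigma> = M \<and> emitted \<sigma> = [] \<and> reg \<sigma> 2 = Val \<Delta> \<and> reg \<sigma> 3 = Idx n \<and> reg \<sigma> 4 = Idx ent \<and>
     reg \<sigma> 5 = Idx 1 \<and> reg \<sigma> 7 = Val l0 \<and> reg \<sigma> 8 = Val (l1 + \<Delta>) \<and> reg \<sigma> 9 = Idx kind \<and>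
     reg \<sigma> 10 = Idx 0 \<and> reg \<sigma> 11 = Idx 0"

lemma ent: "u * n + v < n * n" "(u * n + v) * 112 + 128 \<le> length D"
proof -
  have "u * n + v < u * n + n" using uv by simp
  also have "u * n + n \<le> n * n" using mult_le_mono1[of "Suc u" n n] uv by simp
  finally show "u * n + v < n * n" .
  then have "Suc (u * n + v) * 112 \<le> n * n * 112" by (intro mult_le_mono1) simp
  then show "(u * n + v) * 112 + 128 \<le> length D" using table by simp
qed

text \<open>Stated for any program with this beginning, as all three queries share it.\<close>

lemma prologue:
  assumes P: "20 \<le> length P" "take 20 P = take 20 cap_prog"
  shows "reaches W D P 20 (query_state (u, v) \<Delta> M)
    (started M)"
proof -
  have nth: "P ! i = cap_prog ! i" if "i < 20" for i
    using arg_cong[OF P(2), of "\<lambda>l. l ! i"] that by simp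
  have len: "i < length P" if "i < 20" for i using that P(1) by simp
  have e: "u * n + v < W" "(u * n + v) * 112 < W" "16 + (u * n + v) * 112 < W" "17 + (u * n + v) * 112 < W" "18 + (u * n + v) * 112 < W" "u * n < W"
    using ent W by simp_all
  note f = holds_fetch[OF header] entry[THEN holds_fetch]
  have ne: "P \<noteq> []" using P(1) by auto
  consider flag | "\<not> flag" "l0 < l1 + \<Delta>" | "\<not> flag" "l1 + \<Delta> < l0" | "\<not> flag" "l1 + \<Delta> = l0" by linarith
  then show ?thesis
  proof cases
    case 1
    show ?thesis
      by (rule reaches_steps[where k = 16])
        (use W f e 1 in \<open>simp_all add: execs_numeral set_reg_def query_state_def nth len ne cap_prog_def ac_simps kind del: fetch.simps\<close>)
  next
    case 2
    show ?thesis
      by (rule reaches_steps[where k = 17])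
        (use W f e 2 in \<open>simp_all add: execs_numeral set_reg_def query_state_def nth len ne cap_prog_def ac_simps kind del: fetch.simps\<close>)
  next
    case 3
    show ?thesis
      by (rule reaches_steps[where k = 19])
        (use W f e 3 in \<open>simp_all add: execs_numeral set_reg_def query_state_def nth len ne cap_prog_def ac_simps kind del: fetch.simps\<close>)
  next
    case 4
    show ?thesis
      by (rule reaches_steps[where k = 20])
        (use W f e 4 in \<open>simp_all add: execs_numeral set_reg_def query_state_def nth len ne cap_prog_def ac_simps kind del: fetch.simps\<close>)
  qed
qed

lemma cap_query:
  assumes "P = cap_prog"
  shows "reaches W D P 23 (query_state (u, v) \<Delta> M)
    (\<lambda>\<sigma>. length P \<le> pc \<sigma> \<and> emitted \<sigma> = [Val (if kind = 1 then l1 + \<Delta> else l0)])"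
proof (rule reaches_trans[OF prologue])
  show "20 \<le> length P" "take 20 P = take 20 cap_prog" using assms by (simp_all add: cap_prog_def)
  fix \<sigma> :: state
  assume s: "started M \<sigma>"
  consider "kind = 0" | "kind = 1" | "kind = 2" "l0 = l1 + \<Delta>" using kind by (auto split: if_splits)
  then show "reaches W D P 3 \<sigma>
    (\<lambda>\<sigma>. length P \<le> pc \<sigma> \<and> emitted \<sigma> = [Val (if kind = 1 then l1 + \<Delta> else l0)])"
  proof cases
    case 1
    show ?thesis
      by (rule reaches_steps[where k = 2]) (use s 1 in \<open>simp_all add: execs_numeral set_reg_def assms cap_prog_def\<close>)
  next
    case 2
    show ?thesis
      by (rule reaches_steps[where k = 3]) (use s 2 in \<open>simp_all add: execs_numeral set_reg_def assms cap_prog_def\<close>)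
  next
    \<comment> \<open>At a tie the program emits \<open>l1 + \<Delta>\<close>, which equals
      \<open>l0\<close>.\<close>
    case 3
    show ?thesis
      by (rule reaches_steps[where k = 3]) (use s 3 in \<open>simp_all add: execs_numeral set_reg_def assms cap_prog_def\<close>)
  qed
qed simp

lemma cut_loop:
  assumes P: "P = cut_prog" and xs: "\<And>i. i < length xs \<Longrightarrow> holds D (a + 1 + i) (Idx (xs ! i))"
    and s: "pc \<sigma> = 25" "reg \<sigma> 4 = Idx a" "reg \<sigma> 5 = Idx 1" "reg \<sigma> 6 = Idx (length xs)" "reg \<sigma> 10 = Idx 0"
  shows "reaches W D P (6 * length xs + 2) \<sigma> (\<lambda>\<sigma>'. length P \<le> pc \<sigma>' \<and> emitted \<sigma>' = emitted \<sigma> @ map Idx xs)"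
  using xs s
proof (induction xs arbitrary: a \<sigma>)
  case Nil
  show ?case
    by (rule reaches_steps[where k = 2]) (use Nil in \<open>simp_all add: execs_numeral set_reg_def P cut_prog_def\<close>)
next
  case (Cons x xs)
  have x: "holds D (a + 1) (Idx x)" using Cons.prems(1)[of 0] by simp
  then have a: "a + 1 < W" using W by (simp add: holds_def)
  have "reaches W D P 6 \<sigma> (\<lambda>\<sigma>'. pc \<sigma>' = 25 \<and> reg \<sigma>' 4 = Idx (a + 1) \<and> reg \<sigma>' 5 = Idx 1 \<and> reg \<sigma>' 6 = Idx (length xs) \<and>
    reg \<sigma>' 10 = Idx 0 \<and> emitted \<sigma>' = emitted \<sigma> @ [Idx x])"
    by (rule reaches_steps[where k = 6])
      (use Cons.prems(2-) a holds_fetch[OF x] in \<open>simp_all add: execs_numeral set_reg_def P cut_prog_def del: fetch.simps\<close>)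
  then show ?case
  proof (rule reaches_trans)
    fix \<sigma>' :: state assume s': "pc \<sigma>' = 25 \<and> reg \<sigma>' 4 = Idx (a + 1) \<and> reg \<sigma>' 5 = Idx 1 \<and> reg \<sigma>' 6 = Idx (length xs) \<and>
      reg \<sigma>' 10 = Idx 0 \<and> emitted \<sigma>' = emitted \<sigma> @ [Idx x]"
    have "reaches W D P (6 * length xs + 2) \<sigma>' (\<lambda>\<sigma>''. length P \<le> pc \<sigma>'' \<and> emitted \<sigma>'' = emitted \<sigma>' @ map Idx xs)"
    proof (rule Cons.IH)
      show "holds D (a + 1 + 1 + i) (Idx (xs ! i))" if "i < length xs" for i
        using Cons.prems(1)[of "Suc i"] that by simp
    qed (use s' in auto)
    then show "reaches W D P (6 * length xs + 2) \<sigma>' (\<lambda>\<sigma>''. length P \<le> pc \<sigma>'' \<and> emitted \<sigma>'' = emitted \<sigma> @ map Idx (x # xs))"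
      using s' by simp
  qed simp
qed

lemma cut_query:
  assumes P: "P = cut_prog" and row: "holds D (ent + 4 + kind) (Idx a)" "holds D a (Idx (length xs))"
    "\<And>i. i < length xs \<Longrightarrow> holds D (a + 1 + i) (Idx (xs ! i))"
  shows "reaches W D P (6 * length xs + 27) (query_state (u, v) \<Delta> M)
    (\<lambda>\<sigma>. length P \<le> pc \<sigma> \<and> emitted \<sigma> = map Idx xs)"
proof (rule reaches_trans[OF prologue])
  show "20 \<le> length P" "take 20 P = take 20 cap_prog" using P by (simp_all add: cap_prog_def cut_prog_def)
  fix \<sigma> :: state
  assume s: "started M \<sigma>"
  have k: "ent + 4 < W" "ent + 4 + kind < W" using row(1) W by (auto simp: holds_def)
  have "reaches W D P 5 \<sigma> (\<lambda>\<sigma>'. pc \<sigma>' = 25 \<and> reg \<sigma>' 4 = Idx a \<and> reg \<sigma>' 5 = Idx 1 \<and> reg \<sigma>' 6 = Idx (length xs) \<and>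
    reg \<sigma>' 10 = Idx 0 \<and> emitted \<sigma>' = [])"
    by (rule reaches_steps[where k = 5])
      (use s k row(1,2)[THEN holds_fetch] W in \<open>simp_all add: execs_numeral set_reg_def P cut_prog_def del: fetch.simps\<close>)
  then show "reaches W D P (6 * length xs + 7) \<sigma> (\<lambda>\<sigma>. length P \<le> pc \<sigma> \<and> emitted \<sigma> = map Idx xs)"
  proof (rule reaches_trans)
    fix \<sigma>' :: state assume s': "pc \<sigma>' = 25 \<and> reg \<sigma>' 4 = Idx a \<and> reg \<sigma>' 5 = Idx 1 \<and> reg \<sigma>' 6 = Idx (length xs) \<and>
      reg \<sigma>' 10 = Idx 0 \<and> emitted \<sigma>' = []"
    show "reaches W D P (6 * length xs + 2) \<sigma>' (\<lambda>\<sigma>. length P \<le> pc \<sigma> \<and> emitted \<sigma> = map Idx xs)"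
      using cut_loop[OF P row(3), of \<sigma>'] s' by simp
  qed simp
qed simp

end

text \<open>The vertices are classified by running through the tests; the machine never leaves the list of
  tests, since a test that every vertex passes is put behind them.\<close>

fun tests_at :: "nat \<Rightarrow> cell list \<Rightarrow> nat \<Rightarrow> (nat set \<times> (nat \<Rightarrow> nat)) list \<Rightarrow> bool" where
  "tests_at n D p [] \<longleftrightarrow> (\<exists>i r. holds D p (Idx i) \<and> holds D (p + 1) (Idx r) \<and>
     (\<forall>x<n. holds D (i + x) (Idx 1) \<and> holds D (r + x) (Idx 0)))"
| "tests_at n D p ((Z, \<rho>) # ts) \<longleftrightarrow> (\<exists>i r. holds D p (Idx i) \<and> holds D (p + 1) (Idx r) \<and>
     (\<forall>x<n. holds D (i + x) (Idx (indic Z x)) \<and> holds D (r + x) (Idx (\<rho> x)))) \<and> tests_at n D (p + 2) ts"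

text \<open>\<open>lo\<close> will be the negative capacity, so \<open>lo < \<Delta>\<close> means
  that the arc survives; \<open>cas\<close> is the number of the block in its entry. The last
  assumption keeps labels and lengths below the word bound.\<close>

locale dag_query = query +
  fixes N :: "nat network" and m base cas r0 jr :: nat and es :: "(nat \<times> nat) list" and lo :: real
    and ts :: "(nat set \<times> (nat \<Rightarrow> nat)) list" and jl :: "nat \<Rightarrow> nat"
  assumes list_header: "holds D 1 (Idx (2 * m + 2))" "holds D 2 (Idx base)" "holds D 3 (Idx m)"
    and m: "length es = m"
    and endpoints: "\<And>i. i < 2 * m + 2 \<Longrightarrow> holds D (base + i) (Idx ((src N # snk N # flat es) ! i))"
    and es_n: "set es \<subseteq> {..<n} \<times> {..<n}" "src N < n" "snk N < n"
    and lo: "holds D (ent + 3) (Val lo)"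
    and cas: "cas = (if lo < \<Delta> then kind else kind + 3)"
    and r0: "if lo < \<Delta> then r0 = 0 else holds D (ent + 7) (Idx r0)"
    and tests: "tests_at n D (ent + (cas + 1) * 16) ts" "length ts \<le> 5"
      "\<And>Z \<rho> x. (Z, \<rho>) \<in> set ts \<Longrightarrow> x < n \<Longrightarrow> \<rho> x < n * n + n + 1"
    and junk: "holds D (ent + (cas + 1) * 16 + 12) (Idx jr)" "\<And>x. x < n \<Longrightarrow> holds D (jr + x) (Idx (jl x))"
      "\<And>x. x < n \<Longrightarrow> jl x \<le> n"
    and big: "length D * (n * n + n + 1) * (n + 1) + n < W" "3 * m + 1 < W"
begin

section \<open>First pass of the DAG query: labelling the listed vertices\<close>

abbreviation "Q \<equiv> n * n + n + 1"
abbreviation "b \<equiv> ent + (cas + 1) * 16"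
abbreviation "CL \<equiv> test_label Q b ts"

text \<open>Two digits to base \<open>n + 1\<close>, shifted by \<open>n\<close> to stay clear of
  the vertices that are not listed, which are their own labels.\<close>

definition LAB :: "nat \<Rightarrow> nat" where "LAB x = CL x * (n + 1) + jl x + n"

abbreviation P :: "instr list" where "P \<equiv> dag_prog"

definition env :: "state \<Rightarrow> bool" where
  "env \<sigma> \<longleftrightarrow> reg \<sigma> 3 = Idx n \<and> reg \<sigma> 5 = Idx 1 \<and> reg \<sigma> 10 = Idx 0 \<and> reg \<sigma> 11 = Idx r0 \<and> reg \<sigma> 12 = Idx b \<and>
     reg \<sigma> 13 = Idx jr \<and> reg \<sigma> 14 = Idx Q \<and> reg \<sigma> 15 = Idx (n + 1) \<and> reg \<sigma> 18 = Idx (src N) \<and> reg \<sigma> 19 = Idx (snk N)"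

lemma kind_le: "kind \<le> 2"
  by (simp add: kind)

lemma holds_W: "holds D a c \<Longrightarrow> a < W"
  using W by (simp add: holds_def)

lemma n_W: "n < W" "n + 1 < W" "n * n < W" "n * n + n < W" "Q < W" "n + 2 < W" "n + n < W"
proof -
  have "1 * Q * 1 \<le> length D * Q * (n + 1)" by (intro mult_le_mono) (use table in auto)
  then have "Q + n \<le> length D * Q * (n + 1) + n" by simp
  from le_less_trans[OF this big(1)] have "Q + n < W" .
  then show "n < W" "n + 1 < W" "n * n < W" "n * n + n < W" "Q < W" "n + 2 < W" "n + n < W" using es_n(2) by auto
qed

lemmas exec_simps = execs_numeral set_reg_def dag_prog_def

lemma dag_start:
  "reaches W D P 47 (query_state (u, v) \<Delta> M) (\<lambda>\<sigma>. pc \<sigma> = 47 \<and> env \<sigma> \<and> scratch \<sigma> = M \<and> emitted \<sigma> = [Idx (2 * m + 2)] \<and>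
     reg \<sigma> 16 = Idx (2 * m + 2) \<and> reg \<sigma> 17 = Idx base)"
proof (rule reaches_trans[OF prologue])
  show "20 \<le> length P" "take 20 P = take 20 cap_prog" by (simp_all add: cap_prog_def dag_prog_def)
  fix \<sigma> :: state
  assume s: "started M \<sigma>"
  note lW = holds_W[OF lo]
  have "reaches W D P 9 \<sigma> (\<lambda>\<sigma>. pc \<sigma> = 29 \<and> scratch \<sigma> = M \<and> emitted \<sigma> = [] \<and> reg \<sigma> 3 = Idx n \<and> reg \<sigma> 4 = Idx ent \<and>
    reg \<sigma> 5 = Idx 1 \<and> reg \<sigma> 9 = Idx cas \<and> reg \<sigma> 10 = Idx 0 \<and> reg \<sigma> 11 = Idx r0)"
  proof (cases "lo < \<Delta>")
    case True
    show ?thesis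
      by (rule reaches_steps[where k = 4])
        (use s True cas r0 lW holds_fetch[OF lo] W in \<open>simp_all add: exec_simps del: fetch.simps\<close>)
  next
    case False
    then have h: "holds D (ent + 7) (Idx r0)" using r0 by simp
    show ?thesis
      by (rule reaches_steps[where k = 9])
        (use s False cas kind_le lW holds_fetch[OF lo] holds_W[OF h] holds_fetch[OF h] W in \<open>simp_all add: exec_simps del: fetch.simps\<close>)
  qed
  then show "reaches W D P 27 \<sigma> (\<lambda>\<sigma>. pc \<sigma> = 47 \<and> env \<sigma> \<and> scratch \<sigma> = M \<and> emitted \<sigma> = [Idx (2 * m + 2)] \<and>
     reg \<sigma> 16 = Idx (2 * m + 2) \<and> reg \<sigma> 17 = Idx base)"
  proof (rule reaches_trans)
    fix \<sigma> :: state
    assume s: "pc \<sigma> = 29 \<and> scratch \<sigma> = M \<and> emitted \<sigma> = [] \<and> reg \<sigma> 3 = Idx n \<and> reg \<sigma> 4 = Idx ent \<and>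
      reg \<sigma> 5 = Idx 1 \<and> reg \<sigma> 9 = Idx cas \<and> reg \<sigma> 10 = Idx 0 \<and> reg \<sigma> 11 = Idx r0"
    have c: "cas + 1 < W" "(cas + 1) * 16 < W" "b < W" using kind_le cas holds_W[OF junk(1)] W by (auto split: if_splits)
    have st: "holds D base (Idx (src N))" "holds D (base + 1) (Idx (snk N))" using endpoints[of 0] endpoints[of 1] by auto
    show "reaches W D P 18 \<sigma> (\<lambda>\<sigma>. pc \<sigma> = 47 \<and> env \<sigma> \<and> scratch \<sigma> = M \<and> emitted \<sigma> = [Idx (2 * m + 2)] \<and>
       reg \<sigma> 16 = Idx (2 * m + 2) \<and> reg \<sigma> 17 = Idx base)"
      by (rule reaches_steps[where k = 18])
        (use s c n_W W holds_W[OF st(2)] holds_W[OF junk(1)] holds_fetch[OF junk(1)] list_header[THEN holds_fetch] st[THEN holds_fetch]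
          in \<open>simp_all add: exec_simps env_def del: fetch.simps mult_Suc\<close>)
  qed simp
qed simp

abbreviation classified :: "nat \<Rightarrow> state \<Rightarrow> state \<Rightarrow> bool" where
  "classified l \<sigma> \<sigma>' \<equiv> pc \<sigma>' = 62 \<and> scratch \<sigma>' = scratch \<sigma> \<and> emitted \<sigma>' = emitted \<sigma> \<and>
    (\<forall>i. i \<noteq> 21 \<longrightarrow> i \<noteq> 22 \<longrightarrow> reg \<sigma>' i = reg \<sigma> i) \<and>
    (\<exists>q r. reg \<sigma>' 21 = Idx q \<and> reg \<sigma>' 22 = Idx r \<and> q < length D \<and> r < Q \<and> q * Q + r = l)"

text \<open>The address of the successful test becomes the leading digit of the rank, so the tests
  need not be counted.\<close>

lemma classify:
  assumes "tests_at n D p us" "x < n" "\<And>Z \<rho>. (Z, \<rho>) \<in> set us \<Longrightarrow> \<rho> x < Q"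
    and "pc \<sigma> = 51" "reg \<sigma> 5 = Idx 1" "reg \<sigma> 10 = Idx 0" "reg \<sigma> 20 = Idx x" "reg \<sigma> 21 = Idx p"
  shows "reaches W D P (7 * length us + 8) \<sigma> (classified (test_label Q p us x) \<sigma>)"
  using assms
proof (induction us arbitrary: p \<sigma>)
  case Nil
  then obtain i r where *: "holds D p (Idx i)" "holds D (p + 1) (Idx r)" "holds D (i + x) (Idx 1)" "holds D (r + x) (Idx 0)" by auto
  have "p < length D" using *(1) by (simp add: holds_def)
  then show ?case
    by (intro reaches_steps[where k = 8])
      (use Nil * [THEN holds_fetch] * [THEN holds_W] in \<open>simp_all add: exec_simps del: fetch.simps\<close>)
next
  case (Cons t us)
  obtain Z \<rho> where t: "t = (Z, \<rho>)" by (cases t)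
  obtain i r where *: "holds D p (Idx i)" "holds D (p + 1) (Idx r)" "holds D (i + x) (Idx (indic Z x))" "holds D (r + x) (Idx (\<rho> x))"
    and nxt: "tests_at n D (p + 2) us"
    using Cons.prems(1,2) unfolding t by auto
  have pl: "p < length D" using *(1) by (simp add: holds_def)
  show ?case
  proof (cases "x \<in> Z")
    case True
    have "\<rho> x < Q" using Cons.prems(3)[of Z \<rho>] t by simp
    then show ?thesis
      using pl True
      by (intro reaches_steps[where k = 8])
        (use Cons.prems(4-) *[THEN holds_fetch] *[THEN holds_W] t in \<open>simp_all add: exec_simps indic_def del: fetch.simps\<close>)
  next
    case False
    have p2: "p + 2 < W" using nxt by (cases us) (auto dest: holds_W)
    have "reaches W D P 7 \<sigma> (\<lambda>\<sigma>'. pc \<sigma>' = 51 \<and> scratch \<sigma>' = scratch \<sigma> \<and> emitted \<sigma>' = emitted \<sigma> \<and>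
      (\<forall>i. i \<noteq> 21 \<longrightarrow> i \<noteq> 22 \<longrightarrow> reg \<sigma>' i = reg \<sigma> i) \<and> reg \<sigma>' 21 = Idx (p + 2))"
      by (rule reaches_steps[where k = 7])
        (use False p2 Cons.prems(4-) *[THEN holds_fetch] *[THEN holds_W] t in \<open>simp_all add: exec_simps indic_def del: fetch.simps\<close>)
    then show ?thesis
    proof (rule reaches_trans)
      fix \<sigma>' :: state
      assume s: "pc \<sigma>' = 51 \<and> scratch \<sigma>' = scratch \<sigma> \<and> emitted \<sigma>' = emitted \<sigma> \<and>
        (\<forall>i. i \<noteq> 21 \<longrightarrow> i \<noteq> 22 \<longrightarrow> reg \<sigma>' i = reg \<sigma> i) \<and> reg \<sigma>' 21 = Idx (p + 2)"
      have "reaches W D P (7 * length us + 8) \<sigma>' (classified (test_label Q (p + 2) us x) \<sigma>')"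
        by (rule Cons.IH[OF nxt Cons.prems(2)]) (use Cons.prems(3-) s in auto)
      then show "reaches W D P (7 * length us + 8) \<sigma>' (classified (test_label Q p (t # us) x) \<sigma>)"
        using s t False by simp
    qed simp
  qed
qed

definition labelled :: "cell list \<Rightarrow> nat \<Rightarrow> bool" where
  "labelled S x \<longleftrightarrow> S ! x = Idx (CL x) \<and> S ! (n + x) = Idx (LAB x)"

lemma LAB_W:
  assumes "q < length D" "r < Q" "x < n" "CL x = q * Q + r"
  shows "q * Q + r < W" "q * Q < W" "q < W" "LAB x < W" "(q * Q + r) * (n + 1) < W" "(q * Q + r) * (n + 1) + jl x < W"
proof -
  have "q * Q + r + 1 \<le> Suc q * Q" using assms(2) by simp
  also have "\<dots> \<le> length D * Q" using assms(1) by (intro mult_le_mono1) simp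
  finally have "(q * Q + r + 1) * (n + 1) \<le> length D * Q * (n + 1)" by (rule mult_le_mono1)
  then have "(q * Q + r) * (n + 1) + (n + 1) + n < W" using big(1) by (simp only: distrib_right mult_1)
  then have *: "(q * Q + r) * (n + 1) + n + n < W" by linarith
  then show mW: "(q * Q + r) * (n + 1) < W" by linarith
  show "LAB x < W" "(q * Q + r) * (n + 1) + jl x < W"
    using * junk(3)[OF assms(3)] unfolding LAB_def assms(4) by linarith+
  have "(q * Q + r) * 1 \<le> (q * Q + r) * (n + 1)" by (rule mult_le_mono2) simp
  from le_less_trans[OF this mW] show "q * Q + r < W" unfolding mult_1_right .
  then show "q * Q < W" by linarith
  show "q < W" using assms(1) W by simp
qed

abbreviation after_pass1 :: "nat list \<Rightarrow> state \<Rightarrow> state \<Rightarrow> bool" where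
  "after_pass1 xs \<sigma> \<sigma>' \<equiv> pc \<sigma>' = 77 \<and> env \<sigma>' \<and> emitted \<sigma>' = emitted \<sigma> @ map Idx (flat (map (\<lambda>x. (x, LAB x)) xs)) \<and>
    length (scratch \<sigma>') = length (scratch \<sigma>) \<and>
    (\<forall>y<n. y \<in> set xs \<or> labelled (scratch \<sigma>) y \<longrightarrow> labelled (scratch \<sigma>') y)"

text \<open>A vertex takes at most 3 + 43 + 15 steps, where 43 covers five failed tests of 7 steps
  and a last one of 8. A vertex listed several times is given the same values again.\<close>

lemma pass1:
  assumes "\<And>i. i < length xs \<Longrightarrow> holds D (a + i) (Idx (xs ! i))" "set xs \<subseteq> {..<n}"
    and "pc \<sigma> = 47" "env \<sigma>" "reg \<sigma> 16 = Idx (length xs)" "reg \<sigma> 17 = Idx a" "2 * n \<le> length (scratch \<sigma>)"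
  shows "reaches W D P (70 * length xs + 2) \<sigma> (after_pass1 xs \<sigma>)"
  using assms
proof (induction xs arbitrary: a \<sigma>)
  case Nil
  show ?case
    by (rule reaches_steps[where k = 2]) (use Nil in \<open>simp_all add: exec_simps env_def flat_def\<close>)
next
  case (Cons x xs)
  have x: "holds D a (Idx x)" "x < n" using Cons.prems(1)[of 0] Cons.prems(2) by auto
  have bW: "b < W" using holds_W[OF junk(1)] by simp
  have "reaches W D P 3 \<sigma> (\<lambda>\<sigma>'. pc \<sigma>' = 51 \<and> env \<sigma>' \<and> reg \<sigma>' 16 = Idx (Suc (length xs)) \<and> reg \<sigma>' 17 = Idx a \<and>
    reg \<sigma>' 20 = Idx x \<and> reg \<sigma>' 21 = Idx b \<and> scratch \<sigma>' = scratch \<sigma> \<and> emitted \<sigma>' = emitted \<sigma>)"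
    by (rule reaches_steps[where k = 3])
      (use Cons.prems(3-) holds_fetch[OF x(1)] in \<open>simp_all add: exec_simps env_def del: fetch.simps\<close>)
  then show ?case
  proof (rule reaches_trans)
    fix \<sigma>1 :: state
    assume s1: "pc \<sigma>1 = 51 \<and> env \<sigma>1 \<and> reg \<sigma>1 16 = Idx (Suc (length xs)) \<and> reg \<sigma>1 17 = Idx a \<and>
      reg \<sigma>1 20 = Idx x \<and> reg \<sigma>1 21 = Idx b \<and> scratch \<sigma>1 = scratch \<sigma> \<and> emitted \<sigma>1 = emitted \<sigma>"
    have "reaches W D P (7 * length ts + 8) \<sigma>1 (classified (CL x) \<sigma>1)"
      by (rule classify[OF tests(1) x(2)]) (use tests(3) x(2) s1 in \<open>auto simp: env_def\<close>)
    then show "reaches W D P (70 * length xs + 69) \<sigma>1 (after_pass1 (x # xs) \<sigma>)"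
    proof (rule reaches_trans)
      fix \<sigma>2 :: state
      assume "classified (CL x) \<sigma>1 \<sigma>2"
      then obtain q r where s2: "pc \<sigma>2 = 62" "scratch \<sigma>2 = scratch \<sigma>" "emitted \<sigma>2 = emitted \<sigma>" "env \<sigma>2"
        "reg \<sigma>2 16 = Idx (Suc (length xs))" "reg \<sigma>2 17 = Idx a" "reg \<sigma>2 20 = Idx x"
        "reg \<sigma>2 21 = Idx q" "reg \<sigma>2 22 = Idx r" "q < length D" "r < Q" "CL x = q * Q + r"
        using s1 unfolding env_def by auto
      note w = LAB_W[OF s2(10,11) x(2) s2(12)]
      note j = junk(2)[OF x(2)]
      have aW: "a + 1 < W" using x(1) W by (simp add: holds_def)
      have nx: "n + x < W" "n + x < length (scratch \<sigma>)" "x < length (scratch \<sigma>)" using n_W x(2) Cons.prems(7) by auto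
      have "reaches W D P 15 \<sigma>2 (\<lambda>\<sigma>'. pc \<sigma>' = 47 \<and> env \<sigma>' \<and> reg \<sigma>' 16 = Idx (length xs) \<and> reg \<sigma>' 17 = Idx (a + 1) \<and>
        scratch \<sigma>' = (scratch \<sigma>)[x := Idx (CL x), n + x := Idx (LAB x)] \<and> emitted \<sigma>' = emitted \<sigma> @ [Idx x, Idx (LAB x)])"
        by (rule reaches_steps[where k = 15])
          (use s2 w aW nx holds_fetch[OF j] holds_W[OF j] in
            \<open>simp_all add: exec_simps env_def LAB_def del: fetch.simps mult_Suc mult_Suc_right\<close>)
      then show "reaches W D P (70 * length xs + 17) \<sigma>2 (after_pass1 (x # xs) \<sigma>)"
      proof (rule reaches_trans)
        fix \<sigma>3 :: state
        assume s3: "pc \<sigma>3 = 47 \<and> env \<sigma>3 \<and> reg \<sigma>3 16 = Idx (length xs) \<and> reg \<sigma>3 17 = Idx (a + 1) \<and>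
          scratch \<sigma>3 = (scratch \<sigma>)[x := Idx (CL x), n + x := Idx (LAB x)] \<and> emitted \<sigma>3 = emitted \<sigma> @ [Idx x, Idx (LAB x)]"
        have l: "labelled (scratch \<sigma>3) y" if "y = x \<or> labelled (scratch \<sigma>) y" "y < n" for y
          using that nx x(2) s3 by (auto simp: labelled_def nth_list_update)
        have "reaches W D P (70 * length xs + 2) \<sigma>3 (after_pass1 xs \<sigma>3)"
        proof (rule Cons.IH)
          show "holds D (a + 1 + i) (Idx (xs ! i))" if "i < length xs" for i
            using Cons.prems(1)[of "Suc i"] that by simp
        qed (use s3 Cons.prems in auto)
        then show "reaches W D P (70 * length xs + 2) \<sigma>3 (after_pass1 (x # xs) \<sigma>)"
        proof (rule reaches_trans)
          fix \<sigma>4 :: state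
          assume "after_pass1 xs \<sigma>3 \<sigma>4"
          then show "reaches W D P 0 \<sigma>4 (after_pass1 (x # xs) \<sigma>)"
            by (intro reaches_refl) (use s3 l in \<open>auto simp: flat_def\<close>)
        qed simp
      qed simp
    qed (use tests(2) in simp)
  qed simp
qed

end

lemma mixed_radix:
  fixes k :: nat
  assumes "c * k + j = c' * k + j'" "j < k" "j' < k"
  shows "c = c'" "j = j'"
proof -
  show j: "j = j'" using arg_cong[OF assms(1), of "\<lambda>i. i mod k"] assms(2,3) by simp
  show "c = c'" using arg_cong[OF assms(1), of "\<lambda>i. i div k"] assms(2,3) by simp
qed

text \<open>Positions count from the end because the loop counter of the program runs downwards;
  position 0 never occurs.\<close>

fun mask :: "nat \<Rightarrow> 'a \<Rightarrow> 'a list \<Rightarrow> 'a list" where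
  "mask r c [] = []"
| "mask r c (x # xs) = (if r = Suc (length xs) then c else x) # mask r c xs"

lemma mask_keep: "length xs < r \<or> r = 0 \<Longrightarrow> mask r c xs = xs"
  by (induction xs) auto

lemma mask_drop: "mask (Suc (length ys)) c (xs @ x # ys) = xs @ c # ys"
  by (induction xs) (auto simp: mask_keep)

lemma length_mask: "length (mask r c xs) = length xs"
  by (induction xs) auto

lemma flat_append: "flat (xs @ ys) = flat xs @ flat ys"
  by (simp add: flat_def)

lemma length_flat: "length (flat xs) = 2 * length xs"
  by (induction xs) (auto simp: flat_def)

lemma set_flat: "set (flat xs) = fst ` set xs \<union> snd ` set xs"
  by (induction xs) (auto simp: flat_def)

section \<open>Second pass of the DAG query: emitting the edges\<close>

context dag_query begin

definition inv :: "nat \<Rightarrow> nat \<Rightarrow> cell list \<Rightarrow> cell list \<Rightarrow> state \<Rightarrow> bool" where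
  "inv r a S os \<sigma> \<longleftrightarrow> env \<sigma> \<and> reg \<sigma> 16 = Idx r \<and> reg \<sigma> 17 = Idx a \<and> reg \<sigma> 23 = Idx (CL (src N)) \<and>
     reg \<sigma> 24 = Idx (CL (snk N)) \<and> scratch \<sigma> = S \<and> emitted \<sigma> = os"

definition ready :: "cell list \<Rightarrow> nat \<Rightarrow> bool" where
  "ready S x \<longleftrightarrow> x < n \<and> n + x < length S \<and> labelled S x"

lemma ready_src: "ready S x \<Longrightarrow> fetch S (Idx x) = Some (Idx (CL x))" "ready S x \<Longrightarrow> fetch S (Idx (n + x)) = Some (Idx (LAB x))"
  "ready S x \<Longrightarrow> n + x < W"
  using n_W by (auto simp: ready_def labelled_def)

lemma LAB_eq_iff:
  assumes "x < n" "y < n"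
  shows "LAB x = LAB y \<longleftrightarrow> CL x = CL y \<and> jl x = jl y"
proof
  assume "LAB x = LAB y"
  then have *: "CL x * (n + 1) + jl x = CL y * (n + 1) + jl y" unfolding LAB_def by simp
  have j: "jl x < n + 1" "jl y < n + 1" using junk(3) assms by (auto simp: less_Suc_eq_le)
  show "CL x = CL y \<and> jl x = jl y" using mixed_radix[OF * j] by blast
qed (simp add: LAB_def)

lemma pass2_start:
  assumes "pc \<sigma> = 77" "env \<sigma>" "ready (scratch \<sigma>) (src N)" "ready (scratch \<sigma>) (snk N)"
  shows "reaches W D P 12 \<sigma> (\<lambda>\<sigma>'. pc \<sigma>' = 89 \<and>
    inv m (base + 2) (scratch \<sigma>) (emitted \<sigma> @ map Idx [3 * m + 1, snk N, src N]) \<sigma>')"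
proof -
  have "base + 1 < length D" using endpoints[of 1] by (simp add: holds_def)
  then have "base + 2 < W" using W by linarith
  then show ?thesis
    by (intro reaches_steps[where k = 12])
      (use assms list_header[THEN holds_fetch] ready_src[OF assms(3)] ready_src[OF assms(4)] big(2) W in
        \<open>simp_all add: exec_simps env_def inv_def del: fetch.simps mult_Suc mult_Suc_right\<close>)
qed

lemma read_arc:
  assumes "holds D a (Idx x)" "holds D (a + 1) (Idx y)"
    and "pc \<sigma> = 89" "inv (Suc r) a S os \<sigma>"
  shows "reaches W D P 9 \<sigma> (\<lambda>\<sigma>'. pc \<sigma>' = 99 \<and> inv (Suc r) (a + 2) S os \<sigma>' \<and>
    (let (x', y') = if r0 = Suc r then (src N, src N) else (x, y) in reg \<sigma>' 20 = Idx x' \<and> reg \<sigma>' 21 = Idx y'))"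
proof -
  have "a + 1 < length D" using assms(2) by (simp add: holds_def)
  then have aW: "a + 1 < W" "a + 2 < W" using W by linarith+
  consider "r0 = Suc r" | "r0 < Suc r" | "Suc r < r0" by linarith
  then show ?thesis
  proof cases
    case 1
    show ?thesis
      by (rule reaches_steps[where k = 9])
        (use assms(3-) assms(1,2)[THEN holds_fetch] aW 1[symmetric] in \<open>simp_all add: exec_simps env_def inv_def del: fetch.simps\<close>)
  next
    case 2
    show ?thesis
      by (rule reaches_steps[where k = 6])
        (use assms(3-) assms(1,2)[THEN holds_fetch] aW 2 in \<open>simp_all add: exec_simps env_def inv_def del: fetch.simps\<close>)
  next
    case 3
    show ?thesis
      by (rule reaches_steps[where k = 7])
        (use assms(3-) assms(1,2)[THEN holds_fetch] aW 3 in \<open>simp_all add: exec_simps env_def inv_def del: fetch.simps\<close>)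
  qed
qed

lemma orient_arc:
  assumes "ready S x" "ready S y" "pc \<sigma> = 99" "inv r a S os \<sigma>" "reg \<sigma> 20 = Idx x" "reg \<sigma> 21 = Idx y"
  shows "reaches W D P 9 \<sigma> (\<lambda>\<sigma>'. pc \<sigma>' = 109 \<and> inv r a S os \<sigma>' \<and>
    (let (c, d) = orient CL (x, y) in reg \<sigma>' 20 = Idx c \<and> reg \<sigma>' 21 = Idx d \<and> reg \<sigma>' 22 = Idx (CL c) \<and> reg \<sigma>' 25 = Idx (CL d)))"
proof (cases "CL x < CL y")
  case True
  show ?thesis
    by (rule reaches_steps[where k = 9])
      (use assms(3-) True ready_src[OF assms(1)] ready_src[OF assms(2)] in \<open>simp_all add: exec_simps env_def inv_def orient_def del: fetch.simps\<close>)
next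
  case False
  show ?thesis
    by (rule reaches_steps[where k = 4])
      (use assms(3-) False ready_src[OF assms(1)] ready_src[OF assms(2)] in \<open>simp_all add: exec_simps env_def inv_def orient_def del: fetch.simps\<close>)
qed

lemma emit_arcs:
  assumes "ready S c" "ready S d" "pc \<sigma> = 109" "inv (Suc r) a S os \<sigma>"
    "reg \<sigma> 20 = Idx c" "reg \<sigma> 21 = Idx d" "reg \<sigma> 22 = Idx (CL c)" "reg \<sigma> 25 = Idx (CL d)"
  shows "reaches W D P 30 \<sigma> (\<lambda>\<sigma>'. pc \<sigma>' = 89 \<and> inv r a S (os @ map Idx (flat [
    if CL c = CL d \<and> jl c = jl d then (snk N, src N) else (c, d),
    if CL c < CL (snk N) then (snk N, c) else (snk N, src N),
    if CL (src N) < CL d then (d, src N) else (snk N, src N)])) \<sigma>')"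
proof -
  let ?a1 = "if CL c = CL d \<and> jl c = jl d then (snk N, src N) else (c, d)"
  let ?a2 = "if CL c < CL (snk N) then (snk N, c) else (snk N, src N)"
  let ?a3 = "if CL (src N) < CL d then (d, src N) else (snk N, src N)"
  let ?I = "\<lambda>r os \<sigma>. inv r a S os \<sigma> \<and> reg \<sigma> 20 = Idx c \<and> reg \<sigma> 21 = Idx d \<and> reg \<sigma> 22 = Idx (CL c) \<and> reg \<sigma> 25 = Idx (CL d)"
  have n: "c < n" "d < n" using assms(1,2) by (auto simp: ready_def)
  note f = ready_src[OF assms(1)] ready_src[OF assms(2)]
  have "reaches W D P 9 \<sigma> (\<lambda>\<sigma>'. pc \<sigma>' = 120 \<and> ?I (Suc r) (os @ map Idx (flat [?a1])) \<sigma>')"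
  proof -
    consider "LAB c = LAB d" | "LAB c < LAB d" | "LAB d < LAB c" by linarith
    then show ?thesis
    proof cases
      case 1
      then have e: "CL c = CL d \<and> jl c = jl d" using LAB_eq_iff[OF n] by simp
      show ?thesis unfolding if_P[OF e]
        by (rule reaches_steps[where k = 9]) (use assms(3-) f 1 in \<open>simp_all add: exec_simps env_def inv_def flat_def del: fetch.simps\<close>)
    next
      case 2
      then have e: "\<not> (CL c = CL d \<and> jl c = jl d)" using LAB_eq_iff[OF n] by simp
      show ?thesis unfolding if_not_P[OF e]
        by (rule reaches_steps[where k = 7]) (use assms(3-) f 2 in \<open>simp_all add: exec_simps env_def inv_def flat_def del: fetch.simps\<close>)
    next
      case 3
      then have e: "\<not> (CL c = CL d \<and> jl c = jl d)" using LAB_eq_iff[OF n] by auto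
      show ?thesis unfolding if_not_P[OF e]
        by (rule reaches_steps[where k = 8]) (use assms(3-) f 3 in \<open>simp_all add: exec_simps env_def inv_def flat_def del: fetch.simps\<close>)
    qed
  qed
  then show ?thesis
  proof (rule reaches_trans)
    fix \<sigma>1 :: state assume s: "pc \<sigma>1 = 120 \<and> ?I (Suc r) (os @ map Idx (flat [?a1])) \<sigma>1"
    obtain os1 where os1: "os1 = os @ map Idx (flat [?a1])" by simp
    have "reaches W D P 4 \<sigma>1 (\<lambda>\<sigma>'. pc \<sigma>' = 125 \<and> ?I (Suc r) (os1 @ map Idx (flat [?a2])) \<sigma>')"
    proof (cases "CL c < CL (snk N)")
      case True
      show ?thesis unfolding if_P[OF True]
        by (rule reaches_steps[where k = 3]) (use s[folded os1] True in \<open>simp_all add: exec_simps env_def inv_def flat_def\<close>)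
    next
      case False
      show ?thesis unfolding if_not_P[OF False]
        by (rule reaches_steps[where k = 4]) (use s[folded os1] False in \<open>simp_all add: exec_simps env_def inv_def flat_def\<close>)
    qed
    then show "reaches W D P 21 \<sigma>1 (\<lambda>\<sigma>'. pc \<sigma>' = 89 \<and> inv r a S (os @ map Idx (flat [?a1, ?a2, ?a3])) \<sigma>')"
    proof (rule reaches_trans)
      fix \<sigma>2 :: state assume s: "pc \<sigma>2 = 125 \<and> ?I (Suc r) (os1 @ map Idx (flat [?a2])) \<sigma>2"
      obtain os2 where os2: "os2 = os1 @ map Idx (flat [?a2])" by simp
      have "reaches W D P 6 \<sigma>2 (\<lambda>\<sigma>'. pc \<sigma>' = 89 \<and> inv r a S (os2 @ map Idx (flat [?a3])) \<sigma>')"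
      proof (cases "CL (src N) < CL d")
        case True
        show ?thesis unfolding if_P[OF True]
          by (rule reaches_steps[where k = 5]) (use s[folded os2] True in \<open>simp_all add: exec_simps env_def inv_def flat_def\<close>)
      next
        case False
        show ?thesis unfolding if_not_P[OF False]
          by (rule reaches_steps[where k = 6]) (use s[folded os2] False in \<open>simp_all add: exec_simps env_def inv_def flat_def\<close>)
      qed
      moreover have "os2 @ map Idx (flat [?a3]) = os @ map Idx (flat [?a1, ?a2, ?a3])"
        unfolding os1 os2 by (simp add: flat_def)
      ultimately show "reaches W D P 6 \<sigma>2 (\<lambda>\<sigma>'. pc \<sigma>' = 89 \<and> inv r a S (os @ map Idx (flat [?a1, ?a2, ?a3])) \<sigma>')" by simp
    qed simp
  qed simp
qed

lemma process_arc:
  assumes "holds D a (Idx x)" "holds D (a + 1) (Idx y)" "ready S (src N)" "ready S x" "ready S y"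
    and "pc \<sigma> = 89" "inv (Suc r) a S os \<sigma>"
  shows "reaches W D P 48 \<sigma> (\<lambda>\<sigma>'. pc \<sigma>' = 89 \<and>
    inv r (a + 2) S (os @ map Idx (flat (emitted_arcs N CL jl (if r0 = Suc r then (src N, src N) else (x, y))))) \<sigma>')"
proof (rule reaches_trans[OF read_arc[OF assms(1,2,6,7)]])
  fix \<sigma>1 :: state
  obtain x' y' where xy: "(if r0 = Suc r then (src N, src N) else (x, y)) = (x', y')" by (metis surj_pair)
  have rd: "ready S x'" "ready S y'" using xy assms(3-5) by (auto split: if_splits)
  assume "pc \<sigma>1 = 99 \<and> inv (Suc r) (a + 2) S os \<sigma>1 \<and>
    (let (x', y') = if r0 = Suc r then (src N, src N) else (x, y) in reg \<sigma>1 20 = Idx x' \<and> reg \<sigma>1 21 = Idx y')"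
  then have s1: "pc \<sigma>1 = 99" "inv (Suc r) (a + 2) S os \<sigma>1" "reg \<sigma>1 20 = Idx x'" "reg \<sigma>1 21 = Idx y'"
    unfolding xy by simp_all
  obtain c d where cd: "orient CL (x', y') = (c, d)" by (metis surj_pair)
  have rd': "ready S c" "ready S d" using cd rd by (auto simp: orient_def split: if_splits)
  show "reaches W D P 39 \<sigma>1 (\<lambda>\<sigma>'. pc \<sigma>' = 89 \<and>
    inv r (a + 2) S (os @ map Idx (flat (emitted_arcs N CL jl (if r0 = Suc r then (src N, src N) else (x, y))))) \<sigma>')"
    unfolding xy
  proof (rule reaches_trans[OF orient_arc[OF rd s1]])
    fix \<sigma>2 :: state
    assume "pc \<sigma>2 = 109 \<and> inv (Suc r) (a + 2) S os \<sigma>2 \<and>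
      (let (c, d) = orient CL (x', y') in reg \<sigma>2 20 = Idx c \<and> reg \<sigma>2 21 = Idx d \<and> reg \<sigma>2 22 = Idx (CL c) \<and> reg \<sigma>2 25 = Idx (CL d))"
    then have s2: "pc \<sigma>2 = 109" "inv (Suc r) (a + 2) S os \<sigma>2"
      "reg \<sigma>2 20 = Idx c" "reg \<sigma>2 21 = Idx d" "reg \<sigma>2 22 = Idx (CL c)" "reg \<sigma>2 25 = Idx (CL d)"
      unfolding cd by simp_all
    show "reaches W D P 30 \<sigma>2 (\<lambda>\<sigma>'. pc \<sigma>' = 89 \<and> inv r (a + 2) S (os @ map Idx (flat (emitted_arcs N CL jl (x', y')))) \<sigma>')"
      using emit_arcs[OF rd' s2] unfolding emitted_arcs_def cd by simp
  qed simp
qed simp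

definition all_arcs :: "(nat \<times> nat) list \<Rightarrow> (nat \<times> nat) list" where
  "all_arcs xs = concat (map (emitted_arcs N CL jl) (mask r0 (src N, src N) xs))"

lemma pass2:
  assumes "\<And>i. i < 2 * length xs \<Longrightarrow> holds D (a + i) (Idx (flat xs ! i))" "ready S (src N)"
    "\<And>x y. (x, y) \<in> set xs \<Longrightarrow> ready S x \<and> ready S y"
    and "pc \<sigma> = 89" "inv (length xs) a S os \<sigma>"
  shows "reaches W D P (48 * length xs + 2) \<sigma> (\<lambda>\<sigma>'. length P \<le> pc \<sigma>' \<and> emitted \<sigma>' = os @ map Idx (flat (all_arcs xs)))"
  using assms
proof (induction xs arbitrary: a \<sigma> os)
  case Nil
  show ?case
    by (rule reaches_steps[where k = 2]) (use Nil in \<open>simp_all add: exec_simps env_def inv_def flat_def all_arcs_def\<close>)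
next
  case (Cons e xs)
  obtain x y where e: "e = (x, y)" by (cases e)
  have h: "holds D a (Idx x)" "holds D (a + 1) (Idx y)"
    using Cons.prems(1)[of 0] Cons.prems(1)[of 1] by (simp_all add: e flat_def)
  have r: "ready S x" "ready S y" using Cons.prems(3)[of x y] e by auto
  have st: "inv (Suc (length xs)) a S os \<sigma>" using Cons.prems(5) by simp
  let ?o = "os @ map Idx (flat (emitted_arcs N CL jl (if r0 = Suc (length xs) then (src N, src N) else (x, y))))"
  show ?case
  proof (rule reaches_trans[OF process_arc[OF h Cons.prems(2) r Cons.prems(4) st]])
    fix \<sigma>' :: state
    assume s: "pc \<sigma>' = 89 \<and> inv (length xs) (a + 2) S ?o \<sigma>'"
    have "reaches W D P (48 * length xs + 2) \<sigma>' (\<lambda>\<sigma>'. length P \<le> pc \<sigma>' \<and> emitted \<sigma>' = ?o @ map Idx (flat (all_arcs xs)))"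
    proof (rule Cons.IH)
      show "holds D (a + 2 + i) (Idx (flat xs ! i))" if "i < 2 * length xs" for i
        using Cons.prems(1)[of "Suc (Suc i)"] that by (simp add: e flat_def)
      show "ready S x \<and> ready S y" if "(x, y) \<in> set xs" for x y using Cons.prems(3)[of x y] that by simp
    qed (use s Cons.prems(2) in auto)
    then show "reaches W D P (48 * length xs + 2) \<sigma>' (\<lambda>\<sigma>'. length P \<le> pc \<sigma>' \<and> emitted \<sigma>' = os @ map Idx (flat (all_arcs (e # xs))))"
      by (simp add: e flat_append all_arcs_def)
  qed simp
qed

definition endpoint_list :: "nat list" where "endpoint_list = src N # snk N # flat es"

text \<open>The budget covers 47 steps for the start, \<open>70 * (2 * m + 2) + 2\<close> for the
  first pass and \<open>12 + 48 * m + 2\<close> for the second.\<close>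

lemma dag_run:
  assumes "2 * n \<le> length M"
  shows "reaches W D P (200 * m + 300) (query_state (u, v) \<Delta> M) (\<lambda>\<sigma>. length P \<le> pc \<sigma> \<and>
    emitted \<sigma> = map Idx ((2 * m + 2) # flat (map (\<lambda>x. (x, LAB x)) endpoint_list) @ (3 * m + 1) # flat ((snk N, src N) # all_arcs es)))"
proof (rule reaches_trans[OF dag_start])
  fix \<sigma>1 :: state
  assume s1: "pc \<sigma>1 = 47 \<and> env \<sigma>1 \<and> scratch \<sigma>1 = M \<and> emitted \<sigma>1 = [Idx (2 * m + 2)] \<and>
     reg \<sigma>1 16 = Idx (2 * m + 2) \<and> reg \<sigma>1 17 = Idx base"
  have len: "length endpoint_list = 2 * m + 2" using m by (simp add: endpoint_list_def length_flat)
  have sub: "set endpoint_list \<subseteq> {..<n}" using es_n by (auto simp: endpoint_list_def set_flat)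
  let ?vs = "map Idx (flat (map (\<lambda>x. (x, LAB x)) endpoint_list))"
  let ?post = "\<lambda>\<sigma>. length P \<le> pc \<sigma> \<and>
    emitted \<sigma> = map Idx ((2 * m + 2) # flat (map (\<lambda>x. (x, LAB x)) endpoint_list) @ (3 * m + 1) # flat ((snk N, src N) # all_arcs es))"
  have "reaches W D P (70 * (2 * m + 2) + 2) \<sigma>1 (after_pass1 endpoint_list \<sigma>1)"
    unfolding len[symmetric]
    by (rule pass1[where a = base]) (use endpoints sub s1 assms len in \<open>auto simp: endpoint_list_def\<close>)
  then show "reaches W D P (200 * m + 253) \<sigma>1 ?post"
  proof (rule reaches_trans)
    fix \<sigma>2 :: state
    assume s2: "after_pass1 endpoint_list \<sigma>1 \<sigma>2"
    have rd: "ready (scratch \<sigma>2) x" if "x \<in> set endpoint_list" for x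
      using that sub s1 s2 assms by (auto simp: ready_def)
    have st: "ready (scratch \<sigma>2) (src N)" "ready (scratch \<sigma>2) (snk N)" by (rule rd; simp add: endpoint_list_def)+
    show "reaches W D P (48 * m + 60) \<sigma>2 ?post"
    proof (rule reaches_trans[OF pass2_start])
      show "pc \<sigma>2 = 77" "env \<sigma>2" using s2 by auto
      fix \<sigma>3 :: state
      assume s3: "pc \<sigma>3 = 89 \<and> inv m (base + 2) (scratch \<sigma>2) (emitted \<sigma>2 @ map Idx [3 * m + 1, snk N, src N]) \<sigma>3"
      have "reaches W D P (48 * length es + 2) \<sigma>3 (\<lambda>\<sigma>'. length P \<le> pc \<sigma>' \<and>
        emitted \<sigma>' = (emitted \<sigma>2 @ map Idx [3 * m + 1, snk N, src N]) @ map Idx (flat (all_arcs es)))"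
      proof (rule pass2[OF _ st(1)])
        show "holds D (base + 2 + i) (Idx (flat es ! i))" if "i < 2 * length es" for i
          using endpoints[of "i + 2"] that m by (simp add: algebra_simps)
        show "ready (scratch \<sigma>2) x \<and> ready (scratch \<sigma>2) y" if "(x, y) \<in> set es" for x y
          by (intro conjI rd) (use imageI[OF that, of fst] imageI[OF that, of snd] in \<open>simp_all add: endpoint_list_def set_flat\<close>)
      qed (use s3 m in auto)
      moreover have "emitted \<sigma>2 = Idx (2 * m + 2) # ?vs" using s1 s2 by simp
      then have "(emitted \<sigma>2 @ map Idx [3 * m + 1, snk N, src N]) @ map Idx (flat (all_arcs es)) =
        map Idx ((2 * m + 2) # flat (map (\<lambda>x. (x, LAB x)) endpoint_list) @ (3 * m + 1) # flat ((snk N, src N) # all_arcs es))"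
        by (simp add: flat_append flat_def)
      ultimately show "reaches W D P (48 * m + 2) \<sigma>3 ?post" unfolding m by simp
    qed (use st in auto)
  qed simp
qed simp

end

section \<open>The output read as a DAG\<close>

context dag_query begin

definition vertex_labels :: "(nat \<times> nat) list" where
  "vertex_labels = map (\<lambda>x. (x, LAB x)) endpoint_list"

lemma label_listed: "label vertex_labels x = (if x \<in> set endpoint_list then LAB x else x)"
  by (simp add: label_def vertex_labels_def map_of_map_restrict restrict_map_def)

lemma LAB_ge: "n \<le> LAB x"
  by (simp add: LAB_def)

text \<open>A vertex that is not listed has no arcs and is neither source nor sink, so it is alone
  in its node. Its label, itself, is below \<open>n\<close>, while labels of listed vertices are at
  least \<open>n\<close>.\<close>

lemma label_eq_iff:
  assumes N': "V N' = {..<n}" "E N' = set es" "src N' = src N" "snk N' = snk N" and good: "good_labels N' CL jl"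
    and x: "x < n" and y: "y < n"
  shows "label vertex_labels x = label vertex_labels y \<longleftrightarrow> CL x = CL y \<and> jl x = jl y"
proof -
  have alone: "x = y" if y: "y \<notin> set endpoint_list" "y < n" and x: "x < n" and j: "jl x = jl y" for x y
  proof -
    have no: "(a, y) \<notin> pos_arcs N'" "y \<noteq> src N'" for a
      using y(1) N' imageI[of "(a, y)" "set es" snd] by (auto simp: endpoint_list_def set_flat pos_arcs_def)
    have stay: "a = y" if "(a, y) \<in> (pos_arcs N')\<^sup>*" for a
      using that by (cases rule: rtranclE) (use no in auto)
    have "\<not> on_path N' y" using stay no(2) by (auto simp: on_path_def)
    moreover have "on_path N' x \<and> on_path N' y \<or> \<not> on_path N' x \<and> \<not> on_path N' y \<and>
      (x, y) \<in> (pos_arcs N')\<^sup>* \<and> (y, x) \<in> (pos_arcs N')\<^sup>*"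
      using good j x y(2) N'(1) unfolding good_labels_def by blast
    ultimately show ?thesis using stay by blast
  qed
  show ?thesis
  proof (cases "x \<in> set endpoint_list"; cases "y \<in> set endpoint_list")
    assume "x \<in> set endpoint_list" "y \<in> set endpoint_list"
    then show ?thesis using LAB_eq_iff[OF x y] by (simp add: label_listed)
  next
    assume *: "x \<in> set endpoint_list" "y \<notin> set endpoint_list"
    then have "x \<noteq> y" by auto
    then show ?thesis using * alone[OF *(2) y x] LAB_ge[of x] y by (auto simp: label_listed)
  next
    assume *: "x \<notin> set endpoint_list" "y \<in> set endpoint_list"
    then have "x \<noteq> y" by auto
    then show ?thesis using * alone[OF *(1) x y] LAB_ge[of y] x by (auto simp: label_listed)
  next
    assume *: "x \<notin> set endpoint_list" "y \<notin> set endpoint_list"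
    then show ?thesis using alone[OF *(2) y x] by (auto simp: label_listed)
  qed
qed

lemma length_all_arcs: "length (all_arcs xs) = 3 * length xs"
proof -
  have "length (emitted_arcs N CL jl e) = 3" for e by (simp add: emitted_arcs_def split: prod.split)
  then have "length (concat (map (emitted_arcs N CL jl) zs)) = 3 * length zs" for zs by (induction zs) auto
  then show ?thesis by (simp add: all_arcs_def length_mask)
qed

lemma all_arcs_keep:
  assumes "r0 = 0"
  shows "set (all_arcs xs) = (\<Union>e\<in>set xs. set (emitted_arcs N CL jl e))"
proof -
  have "mask r0 (src N, src N) xs = xs" using assms by (intro mask_keep) simp
  then show ?thesis unfolding all_arcs_def by simp
qed

text \<open>A loop at the source stands in for the deleted arc; it emits only the filler
  pair.\<close>

lemma all_arcs_drop:
  assumes "r0 = Suc (length ys)"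
  shows "insert (snk N, src N) (set (all_arcs (xs @ e # ys))) =
    insert (snk N, src N) (\<Union>e\<in>set xs \<union> set ys. set (emitted_arcs N CL jl e))"
proof -
  have "set (emitted_arcs N CL jl (src N, src N)) = {(snk N, src N)}"
    by (auto simp: emitted_arcs_def orient_def)
  moreover have "mask r0 (src N, src N) (xs @ e # ys) = xs @ (src N, src N) # ys" unfolding assms by (rule mask_drop)
  ultimately show ?thesis unfolding all_arcs_def by simp
qed

lemma emitted_arcs_V:
  assumes "e \<in> set es" "a \<in> set (emitted_arcs N CL jl e)"
  shows "fst a < n \<and> snd a < n"
proof -
  obtain x y where e: "e = (x, y)" by (cases e)
  have "x < n" "y < n" using assms(1) es_n(1) e by auto
  then show ?thesis using assms(2) es_n by (auto simp: e emitted_arcs_def orient_def split: if_splits)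
qed

lemma lists_label_dag:
  assumes N': "V N' = {..<n}" "E N' = set es" "src N' = src N" "snk N' = snk N" and good: "good_labels N' CL jl"
    and arcs: "insert (snk N, src N) (set (all_arcs es)) = insert (snk N, src N) (\<Union>e\<in>pos_arcs N'. set (emitted_arcs N CL jl e))"
  shows "lists_dag N' (map Idx ((2 * m + 2) # flat vertex_labels @ (3 * m + 1) # flat ((snk N, src N) # all_arcs es)))
    (label_dag N' CL jl)"
proof -
  have node: "node_of N' vertex_labels x = label_node N' CL jl x" if "x < n" for x
    using label_eq_iff[OF N' good _ that] N'(1) by (auto simp: node_of_def label_node_def)
  have em: "emitted_arcs N' CL jl e = emitted_arcs N CL jl e" for e unfolding emitted_arcs_def N' ..
  have "parcs (label_dag N' CL jl) = (\<lambda>(x, y). (node_of N' vertex_labels x, node_of N' vertex_labels y)) ` set ((snk N, src N) # all_arcs es)"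
  proof -
    have "set ((snk N, src N) # all_arcs es) = insert (snk N, src N) (\<Union>e\<in>pos_arcs N'. set (emitted_arcs N CL jl e))"
      using arcs by simp
    moreover have "fst a < n \<and> snd a < n" if "a \<in> insert (snk N, src N) (\<Union>e\<in>pos_arcs N'. set (emitted_arcs N CL jl e))" for a
    proof (cases "a = (snk N, src N)")
      case False
      then have "a \<in> (\<Union>e\<in>pos_arcs N'. set (emitted_arcs N CL jl e))" using that by simp
      then obtain e where "e \<in> pos_arcs N'" "a \<in> set (emitted_arcs N CL jl e)" by (rule UN_E)
      then show ?thesis using emitted_arcs_V[of e a] N'(2) by (simp add: pos_arcs_def)
    qed (use es_n in simp)
    then have "(\<lambda>(x, y). (label_node N' CL jl x, label_node N' CL jl y)) ` A =
      (\<lambda>(x, y). (node_of N' vertex_labels x, node_of N' vertex_labels y)) ` A"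
      if "A = insert (snk N, src N) (\<Union>e\<in>pos_arcs N'. set (emitted_arcs N CL jl e))" for A
      unfolding that by (intro image_cong refl) (simp add: node case_prod_beta)
    ultimately show ?thesis
      unfolding label_dag_def em N'(3,4) by simp
  qed
  moreover have "pverts (label_dag N' CL jl) = node_of N' vertex_labels ` V N'"
    unfolding label_dag_def using node N'(1) by (auto intro!: image_cong)
  moreover have "length vertex_labels = 2 * m + 2" "length ((snk N, src N) # all_arcs es) = 3 * m + 1"
    using m by (simp_all add: vertex_labels_def endpoint_list_def length_flat length_all_arcs)
  ultimately show ?thesis unfolding lists_dag_def by metis
qed

end

section \<open>The data structure\<close>

locale data_structure = sensitivity N f n for N :: "nat network" and f n +
  fixes es :: "(nat \<times> nat) list" and pl :: "(nat \<Rightarrow> nat) list"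
    and T :: "nat \<times> nat \<Rightarrow> nat \<Rightarrow> bool \<Rightarrow> (nat set \<times> (nat \<Rightarrow> nat)) list"
  assumes es: "distinct es" "set es = E N"
    and pl: "distinct pl" "set pl = pool"
    and T: "e \<in> E N \<Longrightarrow> tests_ok (T e k z)"
      "e \<in> E N \<Longrightarrow> - cap N e \<le> \<Delta> \<Longrightarrow> change_kind N e \<Delta> = k \<Longrightarrow> (\<Delta> = - cap N e \<longleftrightarrow> z) \<Longrightarrow>
        good_labels (change_cap N e \<Delta>) (test_label (n * n + n + 1) b (T e k z)) (junk e z)"
begin

definition pool_start :: nat where "pool_start = 16 + n * n * 112"
definition list_start :: nat where "list_start = pool_start + length pl * (n + 1)"
definition total :: nat where "total = list_start + 2 * length es + 2"

definition pool_index :: "(nat \<Rightarrow> nat) \<Rightarrow> nat" where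
  "pool_index a = (SOME i. i < length pl \<and> pl ! i = a)"

definition row :: "(nat \<Rightarrow> nat) \<Rightarrow> nat" where
  "row a = (if a \<in> pool then pool_start + pool_index a * (n + 1) else 0)"

definition remaining :: "nat \<times> nat \<Rightarrow> nat" where
  "remaining e = (SOME r. \<exists>xs ys. es = xs @ e # ys \<and> r = Suc (length ys))"

definition low :: "nat \<times> nat \<Rightarrow> real" where
  "low e = (if noncrossing_cuts N e = {} then 0 else lam0 N e)"

text \<open>If no cut is left by \<open>e\<close>, the second capacity has to stay above the first after every change.\<close>

definition high :: "nat \<times> nat \<Rightarrow> real" where
  "high e = (if crossing_cuts N e = {} then lam0 N e + 2 * cap N e else lam1 N e)"

definition case_cell :: "nat \<times> nat \<Rightarrow> nat \<Rightarrow> nat \<Rightarrow> cell" where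
  "case_cell e c j = (let ts = T e (c mod 3) (3 \<le> c) in Idx (row (
     if j = 12 then junk e (3 \<le> c)
     else if j div 2 < length ts then if even j then indic (fst (ts ! (j div 2))) else snd (ts ! (j div 2))
     else if even j then (\<lambda>_. 1) else (\<lambda>_. 0))))"

text \<open>The entry of an arc: whether every cut is left by it, the capacities \<open>low\<close> and \<open>high\<close>, the negative
  capacity, the cuts to report for the kinds 0, 1, 2, and the position in the arc list counted from
  its end. Six blocks of 16 cells follow, one for each kind, first without and then with deletion: up to
  six tests, of which the last is passed by every vertex, and in cell 12 the labels off the paths.\<close>

definition entry_cell :: "nat \<times> nat \<Rightarrow> nat \<Rightarrow> cell" where
  "entry_cell e i =
     (if e \<notin> E N then Idx 0
      else if i < 8 then [Idx (if noncrossing_cuts N e = {} then 1 else 0), Val (low e), Val (high e), Val (- cap N e),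
        Idx (row (cut_array (cut0 e))), Idx (row (cut_array (cut1 e))), Idx (row (cut_array (cut0 e))),
        Idx (remaining e)] ! i
      else if i < 16 then Idx 0 else case_cell e ((i - 16) div 16) ((i - 16) mod 16))"

definition cell_at :: "nat \<Rightarrow> cell" where
  "cell_at a =
     (if a < 16 then if a < 4 then [Idx n, Idx (2 * length es + 2), Idx list_start, Idx (length es)] ! a else Idx 0
      else if a < pool_start then
        entry_cell ((a - 16) div 112 div n, (a - 16) div 112 mod n) ((a - 16) mod 112)
      else if a < list_start then Idx ((pl ! ((a - pool_start) div (n + 1))) ((a - pool_start) mod (n + 1)))
      else Idx ((src N # snk N # flat es) ! (a - list_start)))"

section \<open>Reading the stored cells, and their number and size\<close>

definition D :: "cell list" where "D = map cell_at [0..<total]"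

lemma holds_D: "a < total \<Longrightarrow> cell_at a = c \<Longrightarrow> holds D a c"
  by (simp add: holds_def D_def)

lemma length_D: "length D = total"
  by (simp add: D_def)

lemma starts: "16 \<le> pool_start" "pool_start \<le> list_start" "list_start < total"
  by (simp_all add: pool_start_def list_start_def total_def)

lemma pool_index:
  assumes "a \<in> pool"
  shows "pool_index a < length pl" "pl ! pool_index a = a"
proof -
  have "\<exists>i. i < length pl \<and> pl ! i = a" using assms pl(2) by (metis in_set_conv_nth)
  then have "pool_index a < length pl \<and> pl ! pool_index a = a" unfolding pool_index_def by (rule someI_ex)
  then show "pool_index a < length pl" "pl ! pool_index a = a" by auto
qed

lemma holds_row:
  assumes "a \<in> pool" "x \<le> n"
  shows "holds D (row a + x) (Idx (a x))"
proof (rule holds_D)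
  have "pool_index a * (n + 1) + x < Suc (pool_index a) * (n + 1)" using assms(2) by simp
  also have "\<dots> \<le> length pl * (n + 1)" using pool_index(1)[OF assms(1)] by (intro mult_le_mono1) simp
  finally have *: "pool_index a * (n + 1) + x < length pl * (n + 1)" .
  then have lt: "row a + x < list_start" using assms(1) by (simp add: row_def list_start_def)
  then show "row a + x < total" using starts by linarith
  have ge: "pool_start \<le> row a + x" "16 \<le> row a + x" using assms(1) starts by (simp_all add: row_def)
  have sub: "row a + x - pool_start = pool_index a * (n + 1) + x" using assms(1) by (simp add: row_def)
  have q: "(pool_index a * (n + 1) + x) div (n + 1) = pool_index a" "(pool_index a * (n + 1) + x) mod (n + 1) = x"
    using assms(2) div_mult_self3[of "n + 1" "pool_index a" x] mod_mult_self3[of "pool_index a" "n + 1" x] by simp_all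
  show "cell_at (row a + x) = Idx (a x)"
    unfolding cell_at_def sub q using ge lt pool_index(2)[OF assms(1)] by simp
qed

lemma row_less: "row a < total"
proof (cases "a \<in> pool")
  case True
  then show ?thesis using holds_row[of a 0] by (simp add: holds_def length_D)
qed (use starts in \<open>simp add: row_def\<close>)

lemma remaining:
  assumes "e \<in> E N"
  shows "\<exists>xs ys. es = xs @ e # ys \<and> remaining e = Suc (length ys)"
proof -
  have "\<exists>r xs ys. es = xs @ e # ys \<and> r = Suc (length ys)" using split_list[of e es] assms es(2) by auto
  then show ?thesis unfolding remaining_def by (rule someI_ex)
qed

lemma holds_header: "holds D 0 (Idx n)" "holds D 1 (Idx (2 * length es + 2))" "holds D 2 (Idx list_start)" "holds D 3 (Idx (length es))"
  using starts by (auto intro!: holds_D simp: cell_at_def)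

lemma holds_entry:
  assumes "(u, v) \<in> E N" "i < 112"
  shows "holds D (16 + (u * n + v) * 112 + i) (entry_cell (u, v) i)"
proof (rule holds_D)
  have uv: "u < n" "v < n" using E_n assms(1) by auto
  have "u * n + v < Suc u * n" using uv by simp
  also have "\<dots> \<le> n * n" using uv by (intro mult_le_mono1) simp
  finally have "Suc (u * n + v) * 112 \<le> n * n * 112" by (intro mult_le_mono1) simp
  then have lt: "16 + (u * n + v) * 112 + i < pool_start" using assms(2) by (simp add: pool_start_def)
  then show "16 + (u * n + v) * 112 + i < total" using starts by linarith
  obtain w where w: "w = u * n + v" by simp
  have q: "w div n = u" "w mod n = v" using uv by (simp_all add: w)
  have sub: "16 + w * 112 + i - 16 = w * 112 + i" by simp
  have r: "(w * 112 + i) div 112 = w" "(w * 112 + i) mod 112 = i" using assms(2) by simp_all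
  show "cell_at (16 + (u * n + v) * 112 + i) = entry_cell (u, v) i"
    using lt unfolding cell_at_def w[symmetric] sub r q by simp
qed

lemma holds_endpoints: "i < 2 * length es + 2 \<Longrightarrow> holds D (list_start + i) (Idx ((src N # snk N # flat es) ! i))"
  using starts by (intro holds_D) (simp_all add: cell_at_def total_def)

lemma zero_one_pool: "(\<lambda>_. 0) \<in> pool" "(\<lambda>_. 1) \<in> pool"
  unfolding pool_def by simp_all

lemma junk_pool: "e \<in> E N \<Longrightarrow> junk e z \<in> pool"
  unfolding pool_def junk_def by (cases z) auto

lemma cut_array_pool: "Z \<in> sets \<Longrightarrow> cut_array Z \<in> pool" and indic_pool: "Z \<in> sets \<Longrightarrow> indic Z \<in> pool"
  unfolding pool_def by simp_all

lemma test_pool: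
  assumes "tests_ok ts" "(Z, r) \<in> set ts"
  shows "indic Z \<in> pool" "r \<in> pool"
proof -
  have *: "Z \<in> sets" "r \<in> insert (\<lambda>_. 0) (rank n ` families)" using assms unfolding tests_ok_def by auto
  show "indic Z \<in> pool" by (rule indic_pool[OF *(1)])
  show "r \<in> pool" using *(2) unfolding pool_def by auto
qed

lemma tests_atI:
  assumes "\<And>j. j < 2 * length ts + 2 \<Longrightarrow> holds D (p + j) (Idx (row (
      if j div 2 < length ts then if even j then indic (fst (ts ! (j div 2))) else snd (ts ! (j div 2))
      else if even j then (\<lambda>_. 1) else (\<lambda>_. 0))))"
    and "\<And>Z r. (Z, r) \<in> set ts \<Longrightarrow> indic Z \<in> pool \<and> r \<in> pool"
  shows "tests_at n D p ts"
  using assms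
proof (induction ts arbitrary: p)
  case Nil
  have "holds D p (Idx (row (\<lambda>_. 1)))" "holds D (p + 1) (Idx (row (\<lambda>_. 0)))"
    using Nil(1)[of 0] Nil(1)[of 1] by simp_all
  moreover have "holds D (row (\<lambda>_. 1) + x) (Idx 1) \<and> holds D (row (\<lambda>_. 0) + x) (Idx 0)" if "x < n" for x
    using holds_row[OF zero_one_pool(1), of x] holds_row[OF zero_one_pool(2), of x] that by simp
  ultimately show ?case unfolding tests_at.simps by blast
next
  case (Cons t ts)
  obtain Z r where t: "t = (Z, r)" by (cases t)
  have "holds D p (Idx (row (indic Z)))" "holds D (p + 1) (Idx (row r))"
    using Cons.prems(1)[of 0] Cons.prems(1)[of 1] by (simp_all add: t)
  moreover have "holds D (row (indic Z) + x) (Idx (indic Z x)) \<and> holds D (row r + x) (Idx (r x))" if "x < n" for x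
    using holds_row[of "indic Z" x] holds_row[of r x] Cons.prems(2)[of Z r] that t by simp
  moreover have "tests_at n D (p + 2) ts"
  proof (rule Cons.IH)
    show "indic Z \<in> pool \<and> r \<in> pool" if "(Z, r) \<in> set ts" for Z r using Cons.prems(2)[of Z r] that by simp
    show "holds D (p + 2 + j) (Idx (row (
      if j div 2 < length ts then if even j then indic (fst (ts ! (j div 2))) else snd (ts ! (j div 2))
      else if even j then (\<lambda>_. 1) else (\<lambda>_. 0))))" if "j < 2 * length ts + 2" for j
    proof -
      have q: "(j + 2) div 2 = Suc (j div 2)" "even (j + 2) \<longleftrightarrow> even j" "p + (j + 2) = p + 2 + j" by simp_all
      have "j + 2 < 2 * length (t # ts) + 2" using that by simp
      from Cons.prems(1)[OF this] show ?thesis unfolding q length_Cons Suc_less_eq nth_Cons_Suc .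
    qed
  qed
  ultimately show ?case unfolding t tests_at.simps by blast
qed

lemma cut_cap_sum: "cut_cap N X = (\<Sum>e\<in>E N. of_int (if fst e \<in> X \<and> snd e \<notin> X then 1 else 0) * cap N e)"
  unfolding cut_cap_def using finite_E by (auto simp: sum.inter_filter intro!: sum.cong)

text \<open>A cut capacity has coefficients 0 and 1, and the additional term raises the absolute
  value of only one of them, by at most \<open>\<bar>k\<bar>\<close>.\<close>

lemma storable_cut_cap:
  assumes e: "e \<in> E N" and k: "\<bar>k\<bar> + 1 < int W"
  shows "storable W N (Val (cut_cap N X + of_int k * cap N e))"
proof -
  let ?c = "\<lambda>a. (if fst a \<in> X \<and> snd a \<notin> X then 1 else 0) + (if a = e then k else 0)"
  have "(\<Sum>a\<in>E N. of_int (if a = e then k else 0) * cap N a) = (\<Sum>a\<in>E N. if a = e then of_int k * cap N a else 0)"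
    by (intro sum.cong) auto
  also have "\<dots> = of_int k * cap N e" using e finite_E by simp
  finally have "cut_cap N X + of_int k * cap N e = (\<Sum>a\<in>E N. of_int (?c a) * cap N a)"
    unfolding cut_cap_sum of_int_add distrib_right sum.distrib by simp
  moreover have "\<forall>a\<in>E N. \<bar>?c a\<bar> < int W" using k by auto
  ultimately show ?thesis unfolding storable.simps by (intro exI[of _ ?c] conjI)
qed

lemma storable_entry:
  assumes e: "e \<in> E N" and W: "3 < W"
  shows "storable W N (Val (low e))" "storable W N (Val (high e))" "storable W N (Val (- cap N e))"
proof -
  have z: "cut_cap N {} = 0" by (simp add: cut_cap_def)
  have nc: "\<exists>X. lam0 N e = cut_cap N X" if ne: "noncrossing_cuts N e \<noteq> {}"
  proof -
    obtain X where "X \<in> min_noncrossing N e" using min_noncrossing_nonempty[OF ne] by blast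
    then have "lam0 N e = cut_cap N X" by (simp add: min_noncrossing_def)
    then show ?thesis ..
  qed
  have cr: "\<exists>X. lam1 N e = cut_cap N X" if ne: "crossing_cuts N e \<noteq> {}"
  proof -
    obtain X where "X \<in> min_crossing N e" using min_crossing_nonempty[OF ne] by blast
    then have "lam1 N e = cut_cap N X" by (simp add: min_crossing_def)
    then show ?thesis ..
  qed
  show "storable W N (Val (- cap N e))" using storable_cut_cap[OF e, of "- 1" W "{}"] W z by simp
  show "storable W N (Val (low e))"
  proof (cases "noncrossing_cuts N e = {}")
    case True
    then show ?thesis using storable_cut_cap[OF e, of 0 W "{}"] W z by (simp add: low_def)
  next
    case False
    then obtain X where "lam0 N e = cut_cap N X" using nc by blast
    then show ?thesis using storable_cut_cap[OF e, of 0 W X] W False by (simp add: low_def)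
  qed
  show "storable W N (Val (high e))"
  proof (cases "crossing_cuts N e = {}")
    case True
    then have "noncrossing_cuts N e \<noteq> {}" using lam1_mincut(2) by blast
    then obtain X where "lam0 N e = cut_cap N X" using nc by blast
    then show ?thesis using storable_cut_cap[OF e, of 2 W X] W True by (simp add: high_def)
  next
    case False
    then obtain X where "lam1 N e = cut_cap N X" using cr by blast
    then show ?thesis using storable_cut_cap[OF e, of 0 W X] W False by (simp add: high_def)
  qed
qed

lemma two_le_n: "2 \<le> n"
  using src_V snk_V src_neq_snk V_n by auto

lemma length_es: "length es = card (E N)" "length es \<le> n * n"
proof -
  show *: "length es = card (E N)" using distinct_card[OF es(1)] es(2) by simp
  show "length es \<le> n * n" unfolding * using card_mono[OF _ E_n] by simp
qed

text \<open>The table takes \<open>112 * n\<^sup>2\<close> cells, the pool at most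
  \<open>(33 * n + 7) * (n + 1)\<close>, the endpoint list at most \<open>2 * n\<^sup>2 + 2\<close>;
  16 more are the header. The linear terms are absorbed because \<open>n\<close> is at least
  2.\<close>

lemma total_le: "total \<le> 200 * n\<^sup>2"
proof -
  have n: "2 * n \<le> n * n" "4 \<le> n * n" using two_le_n mult_le_mono[of 2 n 2 n] by auto
  have "length pl \<le> 33 * n + 7" using card_pool(2) distinct_card[OF pl(1)] pl(2) by simp
  then have "length pl * (n + 1) \<le> (33 * n + 7) * (n + 1)" by (rule mult_le_mono1)
  also have "\<dots> = 33 * (n * n) + 40 * n + 7" by (simp add: algebra_simps)
  finally show ?thesis
    unfolding total_def list_start_def pool_start_def power2_eq_square using length_es(2) n by linarith
qed

lemma storable_D:
  assumes W: "total < W" "3 < W" "n * n + n + 1 \<le> W"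
  shows "\<forall>c\<in>set D. storable W N c"
proof
  fix c assume "c \<in> set D"
  then obtain a where a: "a < total" "c = cell_at a" by (auto simp: D_def)
  have es_n: "x < n" if "x \<in> set (src N # snk N # flat es)" for x
    using that src_V snk_V V_n E_n es(2) by (auto simp: flat_def)
  have cc: "storable W N (case_cell e i j)" for e i j
  proof -
    have "\<exists>b. case_cell e i j = Idx (row b)" unfolding case_cell_def Let_def by blast
    then show ?thesis using row_less W(1) by (metis less_trans storable.simps(1))
  qed
  have entry: "storable W N (entry_cell e i)" for e i
  proof (cases "e \<in> E N \<and> i < 8")
    case True
    then have e: "e \<in> E N" by simp
    have rem: "remaining e < W" using remaining[OF e] W(1) by (auto simp: total_def)
    have r: "row b < W" for b using row_less W(1) less_trans by blast
    consider "i = 0" | "i = 1" | "i = 2" | "i = 3" | "i = 4" | "i = 5" | "i = 6" | "i = 7" using True by linarith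
    then show ?thesis
      by cases (use e storable_entry[OF e W(2)] rem r W in \<open>simp_all add: entry_cell_def del: storable.simps(2)\<close>)
  next
    case False
    then show ?thesis using cc W by (auto simp: entry_cell_def)
  qed
  consider "a < 4" | "4 \<le> a" "a < 16" | "16 \<le> a" "a < pool_start" | "pool_start \<le> a" "a < list_start" | "list_start \<le> a" by linarith
  then show "storable W N c"
  proof cases
    case 1
    then consider "a = 0" | "a = 1" | "a = 2" | "a = 3" by linarith
    then show ?thesis
      by cases (use a W starts in \<open>auto simp: cell_at_def total_def\<close>)
  next
    case 2
    then show ?thesis using a W by (simp add: cell_at_def)
  next
    case 3
    then show ?thesis using a entry by (simp add: cell_at_def)
  next
    case 4
    have "a - pool_start < length pl * (n + 1)" using 4 by (simp add: list_start_def)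
    then have "(a - pool_start) div (n + 1) < length pl" by (simp add: less_mult_imp_div_less)
    then have "pl ! ((a - pool_start) div (n + 1)) \<in> pool" using pl(2) nth_mem by blast
    then have "(pl ! ((a - pool_start) div (n + 1))) ((a - pool_start) mod (n + 1)) < W" using pool_bound W(3) less_le_trans by blast
    then show ?thesis using 4 a starts by (simp add: cell_at_def)
  next
    case 5
    have "(src N # snk N # flat es) ! (a - list_start) \<in> set (src N # snk N # flat es)"
      using 5 a(1) by (intro nth_mem) (simp add: total_def length_flat)
    then have "(src N # snk N # flat es) ! (a - list_start) < W" using es_n W(3) by fastforce
    then show ?thesis using 5 a starts by (simp add: cell_at_def)
  qed
qed

end

section \<open>Answers to the three queries\<close>

context data_structure begin

lemma kind_by_capacities:
  assumes "e \<in> E N" "- cap N e \<le> \<Delta>"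
  shows "change_kind N e \<Delta> = (if noncrossing_cuts N e = {} then 1 else if low e < high e + \<Delta> then 0
    else if high e + \<Delta> < low e then 1 else 2)"
  using assms(2) cap_pos[OF assms(1)] by (auto simp: change_kind_def low_def high_def)

lemma query_D:
  assumes e: "(u, v) \<in> E N" and \<Delta>: "- cap N (u, v) \<le> \<Delta>" and W: "total < W" "1000 < W"
  shows "query W n D u v \<Delta> (noncrossing_cuts N (u, v) = {}) (change_kind N (u, v) \<Delta>) (low (u, v)) (high (u, v))"
proof
  show "holds D 0 (Idx n)" by (rule holds_header)
  show "length D < W" "1000 < W" using W by (simp_all add: length_D)
  show "u < n" "v < n" using E_n e by auto
  show "16 + n * n * 112 \<le> length D" unfolding length_D using starts by (simp add: pool_start_def)
  show "holds D (16 + (u * n + v) * 112) (Idx (if noncrossing_cuts N (u, v) = {} then 1 else 0))"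
    "holds D (17 + (u * n + v) * 112) (Val (low (u, v)))" "holds D (18 + (u * n + v) * 112) (Val (high (u, v)))"
    using holds_entry[OF e, of 0] holds_entry[OF e, of 1] holds_entry[OF e, of 2] e by (simp_all add: entry_cell_def)
qed (rule kind_by_capacities[OF e \<Delta>])

lemma answers_cap:
  assumes e: "e \<in> E N" and \<Delta>: "- cap N e \<le> \<Delta>" and W: "total < W" "1000 < W"
  shows "answers W D S cap_prog e \<Delta> (\<lambda>T os. T \<le> 23 \<and> os = [Val (mincut_cap (change_cap N e \<Delta>))])"
proof -
  obtain u v where uv: "e = (u, v)" by (cases e)
  interpret q: query W n D u v \<Delta> "noncrossing_cuts N (u, v) = {}" "change_kind N (u, v) \<Delta>" "low (u, v)" "high (u, v)"
    by (rule query_D) (use assms uv in auto)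
  have mc: "mincut_cap (change_cap N e \<Delta>) = (if change_kind N (u, v) \<Delta> = 1 then high (u, v) + \<Delta> else low (u, v))"
    using mincuts_change(2)[OF e \<Delta>] lam1_mincut(2)[of "(u, v)"]
    unfolding uv by (auto simp: change_kind_def low_def high_def split: if_splits)
  show ?thesis
    unfolding answers_def mc unfolding uv using reaches_run[OF q.cap_query[OF refl]] by blast
qed

lemma answers_cut:
  assumes e: "e \<in> E N" and \<Delta>: "- cap N e \<le> \<Delta>" and W: "total < W" "1000 < W"
  shows "answers W D S cut_prog e \<Delta>
    (\<lambda>T os. \<exists>C. st_mincut (change_cap N e \<Delta>) C \<and> T \<le> 33 * card C \<and> lists_set os C)"
proof -
  obtain u v where uv: "e = (u, v)" by (cases e)
  interpret q: query W n D u v \<Delta> "noncrossing_cuts N (u, v) = {}" "change_kind N (u, v) \<Delta>" "low (u, v)" "high (u, v)"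
    by (rule query_D) (use assms uv in auto)
  let ?k = "change_kind N e \<Delta>"
  define C where "C = (if ?k = 1 then cut1 e else cut0 e)"
  have mc: "st_mincut (change_cap N e \<Delta>) C" unfolding C_def by (rule reported_cut(1)[OF e \<Delta>])
  then have C: "C \<subseteq> {..<n}" "src N \<in> C" using V_n by (auto simp: st_mincut_def st_cut_def)
  then have fin: "finite C" using finite_subset by blast
  have "C \<in> sets" unfolding C_def using cut0_sets[OF e] cut1_sets reported_cut(2)[OF e \<Delta>] by auto
  note pool = cut_array_pool[OF this]
  let ?xs = "sorted_list_of_set C"
  have "holds D (16 + (u * n + v) * 112 + (4 + ?k)) (entry_cell e (4 + ?k))"
    unfolding uv by (rule holds_entry) (use e uv q.kind in \<open>auto split: if_splits\<close>)
  moreover have "?k = 0 \<or> ?k = 1 \<or> ?k = 2" using q.kind uv by (auto split: if_splits)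
  then have "entry_cell e (4 + ?k) = Idx (row (cut_array C))"
    using e by (auto simp: entry_cell_def C_def)
  ultimately have 1: "holds D (16 + (u * n + v) * 112 + 4 + change_kind N (u, v) \<Delta>) (Idx (row (cut_array C)))"
    by (simp add: uv add.assoc)
  have 2: "holds D (row (cut_array C)) (Idx (length ?xs))"
    using holds_row[OF pool, of 0] fin by (simp add: cut_array_def)
  have le: "card C \<le> n" using card_mono[OF _ C(1)] by simp
  have 3: "holds D (row (cut_array C) + 1 + i) (Idx (?xs ! i))" if "i < length ?xs" for i
    using holds_row[OF pool, of "1 + i"] that le fin by (simp add: cut_array_def)
  \<comment> \<open>A cut contains the source, so its size absorbs the 27 steps that precede its
    elements: 33 = 6 + 27.\<close>
  have "card C \<noteq> 0" using C(2) fin by auto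
  then have "6 * length ?xs + 27 \<le> 33 * card C" by simp
  moreover have "lists_set (map Idx ?xs) C" unfolding lists_set_def using fin by (intro exI[of _ ?xs]) simp
  ultimately show ?thesis
    unfolding answers_def using reaches_run[OF q.cut_query[OF refl 1 2 3]] mc
    unfolding uv by (meson le_trans)
qed

lemma answers_dag:
  assumes e: "e \<in> E N" and \<Delta>: "- cap N e \<le> \<Delta>" and W: "1000 < W"
    and big: "total * (n * n + n + 1) * (n + 1) + n < W" "3 * length es + 1 < W" and S: "2 * n \<le> S"
  shows "answers W D S dag_prog e \<Delta>
    (\<lambda>T os. \<exists>H. PQ_dag (change_cap N e \<Delta>) H \<and> T \<le> 500 * card (E N) \<and> length os \<le> 500 * card (E N) \<and>
       lists_dag (change_cap N e \<Delta>) os H)"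
proof -
  obtain u v where uv: "e = (u, v)" by (cases e)
  let ?k = "change_kind N e \<Delta>"
  define z where "z \<longleftrightarrow> \<Delta> = - cap N e"
  define cas where "cas = (if z then ?k + 3 else ?k)"
  define ts where "ts = T e ?k z"
  define r0 where "r0 = (if z then remaining e else 0)"
  have "total * 1 * 1 \<le> total * (n * n + n + 1) * (n + 1)" by (intro mult_le_mono) auto
  then have tW: "total < W" using big(1) by linarith
  interpret q: query W n D u v \<Delta> "noncrossing_cuts N (u, v) = {}" "change_kind N (u, v) \<Delta>" "low (u, v)" "high (u, v)"
    by (rule query_D) (use e \<Delta> W tW uv in auto)
  have k: "?k = 0 \<or> ?k = 1 \<or> ?k = 2" using q.kind uv by (auto split: if_splits)
  have cas: "cas mod 3 = ?k" "3 \<le> cas \<longleftrightarrow> z" "cas \<le> 5" using k by (auto simp: cas_def)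
  have ok: "tests_ok ts" unfolding ts_def by (rule T(1)[OF e])
  have pool: "indic Z \<in> pool" "r \<in> pool" if "(Z, r) \<in> set ts" for Z r using test_pool[OF ok that] by auto
  have len: "length ts \<le> 5" using ok by (simp add: tests_ok_def)
  have cell: "holds D (q.ent + (cas + 1) * 16 + j) (case_cell e cas j)" if "j < 16" for j
  proof -
    have "16 + (cas * 16 + j) < 112" using that cas(3) by linarith
    from holds_entry[OF e[unfolded uv] this]
    have "holds D (q.ent + (16 + (cas * 16 + j))) (entry_cell e (16 + (cas * 16 + j)))" unfolding uv .
    moreover have "entry_cell e (16 + (cas * 16 + j)) = case_cell e cas j"
      using that e by (simp add: entry_cell_def)
    moreover have "q.ent + (16 + (cas * 16 + j)) = q.ent + (cas + 1) * 16 + j" by simp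
    ultimately show ?thesis by metis
  qed
  have src_snk: "src N < n" "snk N < n" using src_V snk_V V_n by auto
  have D3: "holds D (q.ent + 3) (Val (- cap N e))" and D7: "holds D (q.ent + 7) (Idx (remaining e))"
    using holds_entry[OF e[unfolded uv], of 3] holds_entry[OF e[unfolded uv], of 7] e uv by (simp_all add: entry_cell_def)
  interpret d: dag_query W n D u v \<Delta> "noncrossing_cuts N (u, v) = {}" "change_kind N (u, v) \<Delta>" "low (u, v)" "high (u, v)"
    N "length es" list_start cas r0 "row (junk e z)" es "- cap N e" ts "junk e z"
  proof
    show "holds D 1 (Idx (2 * length es + 2))" "holds D 2 (Idx list_start)" "holds D 3 (Idx (length es))"
      by (rule holds_header)+
    show "holds D (list_start + i) (Idx ((src N # snk N # flat es) ! i))" if "i < 2 * length es + 2" for i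
      by (rule holds_endpoints[OF that])
    show "set es \<subseteq> {..<n} \<times> {..<n}" using E_n es(2) by simp
    show "cas = (if - cap N e < \<Delta> then change_kind N (u, v) \<Delta> else change_kind N (u, v) \<Delta> + 3)"
      using \<Delta> by (auto simp: cas_def z_def uv)
    show "if - cap N e < \<Delta> then r0 = 0 else holds D (q.ent + 7) (Idx r0)"
      using D7 \<Delta> by (auto simp: r0_def z_def)
    show "holds D (q.ent + 3) (Val (- cap N e))" by (rule D3)
    show "tests_at n D (q.ent + (cas + 1) * 16) ts"
    proof (rule tests_atI)
      show "indic Z \<in> pool \<and> r \<in> pool" if "(Z, r) \<in> set ts" for Z r using pool[OF that] by simp
      fix j assume j: "j < 2 * length ts + 2"
      then have "j < 16" "j \<noteq> 12" using len by auto
      with cell[of j] show "holds D (q.ent + (cas + 1) * 16 + j) (Idx (row (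
        if j div 2 < length ts then if even j then indic (fst (ts ! (j div 2))) else snd (ts ! (j div 2))
        else if even j then (\<lambda>_. 1) else (\<lambda>_. 0))))"
        unfolding case_cell_def cas ts_def[symmetric] Let_def by simp
    qed
    show "\<rho> x < n * n + n + 1" if "(Z, \<rho>) \<in> set ts" for Z \<rho> x using pool_bound pool(2)[OF that] by blast
    show "holds D (q.ent + (cas + 1) * 16 + 12) (Idx (row (junk e z)))"
      using cell[of 12] unfolding case_cell_def cas Let_def by simp
    show "holds D (row (junk e z) + x) (Idx (junk e z x))" if "x < n" for x
      using holds_row[OF junk_pool[OF e], of x z] that by simp
    show "junk e z x \<le> n" for x unfolding junk_def by (rule junk_label_le)
    show "length D * (n * n + n + 1) * (n + 1) + n < W" unfolding length_D by (rule big(1))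
  qed (use len src_snk big(2) in auto)
  let ?N = "change_cap N e \<Delta>"
  have good: "good_labels ?N d.CL (junk e z)" unfolding ts_def by (rule T(2)[OF e \<Delta> refl]) (simp add: z_def)
  interpret N': st_net ?N by (rule st_net_change[OF e \<Delta>])
  have arcs: "insert (snk N, src N) (set (d.all_arcs es)) =
    insert (snk N, src N) (\<Union>a\<in>pos_arcs ?N. set (emitted_arcs N d.CL (junk e z) a))"
  proof (cases z)
    case True
    obtain xs ys where xy: "es = xs @ e # ys" "remaining e = Suc (length ys)" using remaining[OF e] by blast
    have "set es - {e} = set xs \<union> set ys" using es(1) unfolding xy(1) by auto
    then have "pos_arcs ?N = set xs \<union> set ys" using pos_arcs_change[OF e \<Delta>] True es(2) by (simp add: z_def)
    moreover have "r0 = Suc (length ys)" using True xy(2) by (simp add: r0_def)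
    ultimately show ?thesis using d.all_arcs_drop[of ys xs e] xy(1) by simp
  next
    case False
    then have "r0 = 0" "pos_arcs ?N = set es" using pos_arcs_change[OF e \<Delta>] es(2) by (auto simp: z_def r0_def)
    then show ?thesis using d.all_arcs_keep[of es] by simp
  qed
  let ?H = "label_dag ?N d.CL (junk e z)"
  let ?os = "map Idx ((2 * length es + 2) # flat d.vertex_labels @ (3 * length es + 1) # flat ((snk N, src N) # d.all_arcs es))"
  have H: "PQ_dag ?N ?H" by (rule N'.PQ_dag_of_good_labels[OF good])
  have L: "lists_dag ?N ?os ?H"
    by (rule d.lists_label_dag[OF _ _ _ _ good arcs]) (use V_n es(2) in simp_all)
  have lv: "length d.vertex_labels = 2 * length es + 2"
    by (simp add: d.vertex_labels_def d.endpoint_list_def length_flat)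
  have lo: "length ?os = 10 * length es + 8"
    by (simp add: length_flat lv d.length_all_arcs)
  \<comment> \<open>The queried arc shows that there is at least one arc, which lets
    \<open>200 * m + 300\<close> steps fit into \<open>500 * m\<close>.\<close>
  have m: "length es = card (E N)" "1 \<le> length es" using length_es(1) e es(2) by (simp, cases es) auto
  show ?thesis
    unfolding answers_def
  proof (intro allI impI)
    fix M :: "cell list" assume M: "length M = S \<and> (\<forall>c\<in>set M. fits W c)"
    then have "2 * n \<le> length M" using S by simp
    from reaches_run[OF d.dag_run[OF this], unfolded d.vertex_labels_def[symmetric]]
    obtain t where t: "t \<le> 200 * length es + 300" "run W D dag_prog t (query_state (u, v) \<Delta> M) = Some ?os" by blast
    have "t \<le> 500 * card (E N)" "length ?os \<le> 500 * card (E N)" using t(1) lo m by linarith+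
    then show "\<exists>t os. run W D dag_prog t (query_state e \<Delta> M) = Some os \<and>
      (\<exists>H. PQ_dag ?N H \<and> t \<le> 500 * card (E N) \<and> length os \<le> 500 * card (E N) \<and> lists_dag ?N os H)"
      using t(2) H L unfolding uv by blast
  qed
qed

end

lemma exists_data_structure:
  assumes "positive_network n N"
  obtains f es pl T where "data_structure N f n es pl T"
proof -
  have N: "pair_fin_digraph (graph N)" "V N = {..<n}" "src N \<in> V N" "snk N \<in> V N" "src N \<noteq> snk N" "\<forall>e\<in>E N. 0 < cap N e"
    using assms by (auto simp: positive_network_def)
  interpret g: pair_fin_digraph "graph N" by (rule N(1))
  interpret st_net N
  proof
    show "E N \<subseteq> V N \<times> V N" using g.arc_fst_in_verts g.arc_snd_in_verts by fastforce
  qed (use N g.pair_finite_verts less_imp_le in auto)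
  obtain f where "tight_flow N f" using ex_tight_flow by blast
  then interpret tight_flow N f .
  interpret sensitivity N f n by unfold_locales (use N in auto)
  obtain es where es: "set es = E N" "distinct es" using finite_distinct_list[OF finite_E] by blast
  obtain pl where pl: "set pl = pool" "distinct pl" using finite_distinct_list[OF card_pool(1)] by blast
  let ?ok = "\<lambda>e k z ts. tests_ok ts \<and> (\<forall>\<Delta>\<ge>- cap N e. change_kind N e \<Delta> = k \<longrightarrow> (\<Delta> = - cap N e \<longleftrightarrow> z) \<longrightarrow>
    (\<forall>b. good_labels (change_cap N e \<Delta>) (test_label (n * n + n + 1) b ts) (junk e z)))"
  define T where "T = (\<lambda>e k z. SOME ts. ?ok e k z ts)"
  have T: "?ok e k z (T e k z)" if "e \<in> E N" for e k z
    unfolding T_def by (rule someI_ex[OF ex_tests[OF that]])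
  have "data_structure N f n es pl T"
    by unfold_locales (use es pl T in blast)+
  then show ?thesis by (rule that)
qed

theorem theorem9:
  shows "\<exists>(K :: nat) P_cap P_cut P_dag. \<forall>n (N :: nat network). positive_network n N \<longrightarrow>
    (\<exists>D :: cell list. length D \<le> K * n\<^sup>2 \<and> (\<forall>c\<in>set D. storable (n ^ K) N c) \<and>
      (\<forall>e\<in>E N. \<forall>\<Delta> \<ge> - cap N e.
         answers (n ^ K) D (K * n\<^sup>2) P_cap e \<Delta>
           (\<lambda>T os. T \<le> K \<and> os = [Val (mincut_cap (change_cap N e \<Delta>))]) \<and>
         answers (n ^ K) D (K * n\<^sup>2) P_cut e \<Delta>
           (\<lambda>T os. \<exists>C. st_mincut (change_cap N e \<Delta>) C \<and> T \<le> K * card C \<and> lists_set os C) \<and>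
         answers (n ^ K) D (K * n\<^sup>2) P_dag e \<Delta>
           (\<lambda>T os. \<exists>H. PQ_dag (change_cap N e \<Delta>) H \<and> T \<le> K * card (E N) \<and>
                       length os \<le> K * card (E N) \<and> lists_dag N os H)))"
proof -
  \<comment> \<open>A single constant is the factor for space and time and the exponent of the word
    bound; 500 comes from the time of the DAG query.\<close>
  have "\<exists>D. length D \<le> 500 * n\<^sup>2 \<and> (\<forall>c\<in>set D. storable (n ^ 500) N c) \<and>
      (\<forall>e\<in>E N. \<forall>\<Delta> \<ge> - cap N e.
         answers (n ^ 500) D (500 * n\<^sup>2) cap_prog e \<Delta>
           (\<lambda>T os. T \<le> 500 \<and> os = [Val (mincut_cap (change_cap N e \<Delta>))]) \<and>
         answers (n ^ 500) D (500 * n\<^sup>2) cut_prog e \<Delta>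
           (\<lambda>T os. \<exists>C. st_mincut (change_cap N e \<Delta>) C \<and> T \<le> 500 * card C \<and> lists_set os C) \<and>
         answers (n ^ 500) D (500 * n\<^sup>2) dag_prog e \<Delta>
           (\<lambda>T os. \<exists>H. PQ_dag (change_cap N e \<Delta>) H \<and> T \<le> 500 * card (E N) \<and>
                       length os \<le> 500 * card (E N) \<and> lists_dag N os H))"
    if pos: "positive_network n N" for n and N :: "nat network"
  proof -
    obtain f es pl T where "data_structure N f n es pl T" by (rule exists_data_structure[OF pos])
    then interpret data_structure N f n es pl T .
    obtain W where W: "W = n ^ 500" by simp
    have p5: "n ^ 5 = n * n * n * n * n" by (simp add: numeral_eq_Suc)
    have "n * n + n + 1 \<le> 2 * (n * n)" using two_le_n mult_le_mono1[of 2 n n] by linarith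
    then have "total * (n * n + n + 1) * (n + 1) \<le> 200 * n\<^sup>2 * (2 * (n * n)) * (2 * n)"
      using total_le two_le_n by (intro mult_le_mono) auto
    also have "\<dots> = 800 * n ^ 5" unfolding p5 power2_eq_square by simp
    finally have t: "total * (n * n + n + 1) * (n + 1) \<le> 800 * n ^ 5" .
    have n5: "n \<le> n ^ 5" "n * n \<le> n ^ 5" "1 \<le> n ^ 5"
      using two_le_n power_increasing[of 1 5 n] power_increasing[of 2 5 n] by (auto simp: power2_eq_square)
    \<comment> \<open>Labels need about \<open>800 * n ^ 5\<close>; as \<open>n\<close> is at least
      2, the factor \<open>n ^ 10\<close> of the word bound exceeds the constant.\<close>
    have "(1024::nat) = 2 ^ 10" by simp
    also have "\<dots> \<le> n ^ 10" using two_le_n by (intro power_mono) auto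
    finally have "1024 * n ^ 5 \<le> n ^ 10 * n ^ 5" by (rule mult_le_mono1)
    also have "\<dots> \<le> W" unfolding W power_add[symmetric] using two_le_n by (intro power_increasing) auto
    finally have w: "1024 * n ^ 5 \<le> W" .
    have big: "total * (n * n + n + 1) * (n + 1) + n < W" using t n5 w by linarith
    have m3: "3 * length es + 1 < W" using length_es(2) n5 w by linarith
    have W1: "1000 < W" using n5 w by linarith
    have "total * 1 * 1 \<le> total * (n * n + n + 1) * (n + 1)" by (intro mult_le_mono) auto
    then have tW: "total < W" using big by linarith
    have q: "n * n + n + 1 \<le> W" using n5 w by linarith
    have S: "2 * n \<le> 500 * n\<^sup>2" unfolding power2_eq_square using mult_le_mono1[of 1 n n] two_le_n by linarith
    have st: "\<forall>c\<in>set D. storable W N c" by (rule storable_D) (use tW W1 q in auto)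
    have len: "length D \<le> 500 * n\<^sup>2" using total_le by (simp add: length_D)
    have mono: "answers W D S P e \<Delta> Q" if "answers W D S P e \<Delta> Q'" "\<And>t os. Q' t os \<Longrightarrow> Q t os" for S P e \<Delta> Q Q'
      using that unfolding answers_def by blast
    have ld: "lists_dag (change_cap N e \<Delta>) os H = lists_dag N os H" for e \<Delta> os H
      by (simp add: lists_dag_def node_of_def)
    show ?thesis
      unfolding W[symmetric]
    proof (rule exI[of _ D], intro conjI len st ballI allI impI)
      fix e \<Delta> assume e: "e \<in> E N" "- cap N e \<le> \<Delta>"
      show "answers W D (500 * n\<^sup>2) cap_prog e \<Delta> (\<lambda>T os. T \<le> 500 \<and> os = [Val (mincut_cap (change_cap N e \<Delta>))])"
        by (rule mono[OF answers_cap[OF e tW W1]]) auto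
      show "answers W D (500 * n\<^sup>2) cut_prog e \<Delta>
        (\<lambda>T os. \<exists>C. st_mincut (change_cap N e \<Delta>) C \<and> T \<le> 500 * card C \<and> lists_set os C)"
        by (rule mono[OF answers_cut[OF e tW W1]]) (elim exE conjE, intro exI conjI, assumption, linarith)
      show "answers W D (500 * n\<^sup>2) dag_prog e \<Delta>
           (\<lambda>T os. \<exists>H. PQ_dag (change_cap N e \<Delta>) H \<and> T \<le> 500 * card (E N) \<and>
                       length os \<le> 500 * card (E N) \<and> lists_dag N os H)"
        using answers_dag[OF e W1 big m3 S] unfolding ld .
    qed
  qed
  then show ?thesis by blast
qed

end
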